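(* Let $M\subset\mathbb{Z}_{\geq 1}$ be a finite set of positive integers, and let $(H_M,h_M,S)$ be a triple as described in the context such that $M$ is the set of orders of the eigenvalues of $h_M$. Then $$\mathrm{Aut}(H_M,h_M,S)=\{\pm h_M^k\mid k\in\mathbb{Z}\}$$ holds if and only if the graph $\mathcal{G}(M)$ satisfies one of the following two properties. (I) $\mathcal{G}(M)$ is connected, it satisfies $(S_2)$, and it satisfies $(T_p)$ for every prime number $p\geq 3$. (II) $\mathcal{G}(M)$ has exactly two components $M_1$ and $M_2$; the graphs $\mathcal{G}(M_1)$ and $\mathcal{G}(M_2)$ are $2$-planes of $\mathcal{G}(M)$ and each satisfies $(T_p)$ for every prime number $p\geq 3$; furthermore $$\gcd(\mathrm{lcm}(M_1),\mathrm{lcm}(M_2))\in\{1,2\},\qquad l(M_1,2)>l(M_2,2)\in\{0,1\}.$$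
   Context: A triple $(H_M,h_M,S)$ consists of: a $\mathbb{Z}$-lattice $H_M$ of finite rank $n\geq 1$; an automorphism $h_M:H_M\to H_M$ (the monodromy) all of whose eigenvalues are roots of unity, each of multiplicity $1$, and such that there is $e_1\in H_M$ with $H_M=\bigoplus_{i=1}^n\mathbb{Z}\,h_M^{i-1}(e_1)$; and a bilinear form $S$ on $H_M$ which is $h_M$-invariant ($S(h_Ma,h_Mb)=S(a,b)$), such that, with $H_{\mathbb{C}}=H_M\otimes\mathbb{C}$, $S$ extended $\mathbb{C}$-bilinearly, and $H_\lambda=\ker(h_M-\lambda\,\mathrm{id})\subset H_{\mathbb{C}}$, the restriction of $S$ to $\bigoplus_{\lambda\neq\pm1}H_\lambda$ is nondegenerate. $M$ is the set of $m\geq 1$ such that $e^{2\pi i/m}$ is an eigenvalue of $h_M$. $\mathrm{Aut}(H_M,h_M,S)$ is the group of automorphisms of $H_M$ commuting with $h_M$ and preserving $S$. Graph $\mathcal{G}(M)$: vertex set $M$; there is a directed edge from $m_1\in M$ to $m_2\in M$, labelled $p$ (a "$p$-edge"), exactly when $m_1/m_2=p^k$ for a prime $p$ and some $k\geq 1$, and there is no $m_3\in M\setminus\{m_1,m_2\}$ with $m_2\mid m_3\mid m_1$. Connectedness and components refer to the underlying undirected graph. For a prime $p$, the $p$-planes are the components of the graph obtained from $\mathcal{G}(M)$ by deleting all $p$-edges. A $p$-plane is highest if no $p$-edge ends at a vertex of it. A $p$-edge from $m_1$ to $m_2$ is a highest $p$-edge if no $p$-edge ends at $m_1$. Property $(T_p)$: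 $\mathcal{G}(M)$ has only one highest $p$-plane. Property $(S_2)$: the graph $(M, E(M)\setminus\{\text{highest }2\text{-edges}\})$ has only $1$ or $2$ components. For $N\subset M$, $\mathcal{G}(N)$ is the graph defined in the same way with vertex set $N$. $\mathrm{lcm}(N)$ is the least common multiple of the elements of $N$; for a prime $p$, $l(m,p)=\max\{l\geq0: p^l\mid m\}$ and $l(N,p)=\max\{l(m,p):m\in N\}$. *)

theory Defs
  imports Complex_Main "HOL-Library.Poly_Mapping" "HOL-Computational_Algebra.Primes"
begin

section \<open>Abelian groups as modules over the integers\<close>

text \<open>A lattice is an abelian group type that is free of finite rank as a module over \<^typ>\<open>int\<close>;
  the whole type is the lattice. The scalar multiplication is the one determined by the addition.\<close>

definition zscale :: "int \<Rightarrow> 'a::ab_group_add \<Rightarrow> 'a" where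
  "zscale k x = (if 0 \<le> k then \<Sum>i<nat k. x else - (\<Sum>i<nat (- k). x))"

lemma zscale_diff_of_nat: "zscale (int m - int n) x = (\<Sum>i<m. x) - (\<Sum>i<n. x)"
proof -
  have add: "(\<Sum>i<p + q. x) = (\<Sum>i<p. x) + (\<Sum>i<q. x)" for p q :: nat
    by (induction q) (simp_all add: algebra_simps)
  show ?thesis
  proof (cases "n \<le> m")
    case True
    then obtain d where "m = n + d" using le_Suc_ex by blast
    then show ?thesis by (simp add: zscale_def add)
  next
    case False
    then obtain d where "n = m + d" "0 < d" by (metis less_imp_add_positive not_le)
    then show ?thesis by (simp add: zscale_def add)
  qed
qed

interpretation zmod: module zscale
proof
  fix a b :: int and x y :: 'a
  obtain m n where a: "a = int m - int n" by (metis int_diff_cases)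
  obtain p q where b: "b = int p - int q" by (metis int_diff_cases)
  have add: "(\<Sum>i<s + t. x) = (\<Sum>i<s. x) + (\<Sum>i<t. x)" for s t :: nat and x :: 'a
    by (induction t) (simp_all add: algebra_simps)
  have mult: "(\<Sum>i<s * t. x) = (\<Sum>i<s. \<Sum>i<t. x)" for s t :: nat and x :: 'a
    by (induction s) (simp_all add: add algebra_simps)
  show "zscale a (x + y) = zscale a x + zscale a y"
    by (simp only: a zscale_diff_of_nat sum.distrib) simp
  have "a + b = int (m + p) - int (n + q)" by (simp add: a b)
  then show "zscale (a + b) x = zscale a x + zscale b x"
    by (simp only: a b zscale_diff_of_nat add) (simp add: algebra_simps)
  have ab: "a * b = int (m * p + n * q) - int (m * q + n * p)"
    by (simp add: a b algebra_simps)
  show "zscale a (zscale b x) = zscale (a * b) x"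
    by (simp only: ab, simp only: a b zscale_diff_of_nat add mult sum_subtractf)
       (simp add: algebra_simps)
  have "zscale 1 x = zscale (int 1 - int 0) x" by simp
  then show "zscale 1 x = x" by (simp only: zscale_diff_of_nat) simp
qed

definition is_zbasis :: "nat \<Rightarrow> (nat \<Rightarrow> 'a::ab_group_add) \<Rightarrow> bool" where
  "is_zbasis n b \<longleftrightarrow>
     inj_on b {..<n} \<and> zmod.independent (b ` {..<n}) \<and> zmod.span (b ` {..<n}) = UNIV"

section \<open>The complexification\<close>

text \<open>The tensor product of \<open>\<complex>\<close> with an abelian group over the integers: the free abelian group on
  pairs modulo the subgroup generated by the biadditivity relations.\<close>

interpretation frag: module frag_cmul
  by standard (simp_all add: frag_cmul_distrib frag_cmul_distrib2)

definition tensor_relations :: "((complex \<times> 'a::ab_group_add) \<Rightarrow>\<^sub>0 int) set" where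
  "tensor_relations =
     (\<Union>z w a. {frag_of (z + w, a) - frag_of (z, a) - frag_of (w, a)}) \<union>
     (\<Union>z a b. {frag_of (z, a + b) - frag_of (z, a) - frag_of (z, b)})"

lemma tensor_relationsI:
  "frag_of (z + w, a) - frag_of (z, a) - frag_of (w, a) \<in> tensor_relations"
  "frag_of (z, a + b) - frag_of (z, a) - frag_of (z, b) \<in> tensor_relations"
  unfolding tensor_relations_def by (rule UnI1, rule UN_I[OF UNIV_I], rule UN_I[OF UNIV_I],
      rule UN_I[OF UNIV_I], rule singletonI, rule UnI2, rule UN_I[OF UNIV_I],
      rule UN_I[OF UNIV_I], rule UN_I[OF UNIV_I], rule singletonI)

lemma tensor_relationsE:
  assumes "r \<in> tensor_relations"
  obtains z w a where "r = frag_of (z + w, a) - frag_of (z, a) - frag_of (w, a)"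
  | z a b where "r = frag_of (z, a + b) - frag_of (z, a) - frag_of (z, b)"
  using assms unfolding tensor_relations_def by (elim UnE UN_E singletonE) simp_all

definition tensor_rel ::
    "((complex \<times> 'a::ab_group_add) \<Rightarrow>\<^sub>0 int) \<Rightarrow> ((complex \<times> 'a) \<Rightarrow>\<^sub>0 int) \<Rightarrow> bool" where
  "tensor_rel x y \<longleftrightarrow> x - y \<in> frag.span tensor_relations"

lemma equivp_tensor_rel:
  "equivp (tensor_rel :: ((complex \<times> 'a::ab_group_add) \<Rightarrow>\<^sub>0 int) \<Rightarrow> _)"
proof (rule equivpI)
  show "reflp (tensor_rel :: ((complex \<times> 'a) \<Rightarrow>\<^sub>0 int) \<Rightarrow> _)"
    by (simp add: reflp_def tensor_rel_def frag.span_zero)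
  show "symp (tensor_rel :: ((complex \<times> 'a) \<Rightarrow>\<^sub>0 int) \<Rightarrow> _)"
    unfolding symp_def tensor_rel_def by (metis frag.span_neg minus_diff_eq)
  show "transp (tensor_rel :: ((complex \<times> 'a) \<Rightarrow>\<^sub>0 int) \<Rightarrow> _)"
  proof (rule transpI)
    fix x y z :: "(complex \<times> 'a) \<Rightarrow>\<^sub>0 int"
    assume "tensor_rel x y" "tensor_rel y z"
    then have "(x - y) + (y - z) \<in> frag.span tensor_relations"
      unfolding tensor_rel_def by (rule frag.span_add)
    then show "tensor_rel x z" by (simp add: tensor_rel_def)
  qed
qed

quotient_type (overloaded) 'a complexification =
    "(complex \<times> 'a::ab_group_add) \<Rightarrow>\<^sub>0 int" / tensor_rel
  by (rule equivp_tensor_rel)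

instantiation complexification :: (ab_group_add) ab_group_add
begin

lift_definition zero_complexification :: "'a complexification" is 0 .

lift_definition plus_complexification ::
    "'a complexification \<Rightarrow> 'a complexification \<Rightarrow> 'a complexification" is "(+)"
  unfolding tensor_rel_def by (metis add_diff_add frag.span_add)

lift_definition uminus_complexification :: "'a complexification \<Rightarrow> 'a complexification" is uminus
  unfolding tensor_rel_def by (metis frag.span_neg minus_diff_minus)

lift_definition minus_complexification ::
    "'a complexification \<Rightarrow> 'a complexification \<Rightarrow> 'a complexification" is "(-)"
proof -
  fix x y u v :: "(complex \<times> 'a) \<Rightarrow>\<^sub>0 int"
  assume "tensor_rel x y" "tensor_rel u v"
  then have "(x - y) - (u - v) \<in> frag.span tensor_relations"
    unfolding tensor_rel_def by (rule frag.span_diff)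
  moreover have "(x - y) - (u - v) = (x - u) - (y - v)" by (simp add: algebra_simps)
  ultimately show "tensor_rel (x - u) (y - v)" by (simp add: tensor_rel_def)
qed

instance
proof
  fix u v w :: "'a complexification"
  have eq: "tensor_rel x y" if "x = y" for x y :: "(complex \<times> 'a) \<Rightarrow>\<^sub>0 int"
    using that by (simp add: tensor_rel_def frag.span_zero)
  show "u + v + w = u + (v + w)" by transfer (rule eq, rule add.assoc)
  show "u + v = v + u" by transfer (rule eq, rule add.commute)
  show "0 + u = u" by transfer (rule eq, rule add_0)
  show "- u + u = 0" by transfer (rule eq, rule left_minus)
  show "u - v = u + - v" by transfer (rule eq, rule diff_conv_add_uminus)
qed

end

lift_definition ctensor :: "complex \<Rightarrow> 'a::ab_group_add \<Rightarrow> 'a complexification" is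
  "\<lambda>z a. frag_of (z, a)" .

lemma frag_extend_span:
  assumes "\<And>r. r \<in> tensor_relations \<Longrightarrow> frag_extend f r \<in> frag.span tensor_relations"
    and "x \<in> frag.span tensor_relations"
  shows "frag_extend f x \<in> frag.span tensor_relations"
  using assms(2)
  by (induction rule: frag.span_induct_alt)
     (simp_all add: frag.span_zero frag_extend_add frag_extend_cmul frag.span_add frag.span_scale
        assms(1))

lift_definition cscale ::
    "complex \<Rightarrow> 'a::ab_group_add complexification \<Rightarrow> 'a complexification" is
  "\<lambda>z. frag_extend (\<lambda>(w, a). frag_of (z * w, a))"
proof -
  fix z :: complex and x y :: "(complex \<times> 'a) \<Rightarrow>\<^sub>0 int"
  let ?f = "\<lambda>(w, a::'a). frag_of (z * w, a)"
  assume "tensor_rel x y"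
  moreover have "frag_extend ?f r \<in> frag.span tensor_relations"
    if "r \<in> tensor_relations" for r :: "(complex \<times> 'a) \<Rightarrow>\<^sub>0 int"
    using that
    by (cases rule: tensor_relationsE)
       (simp_all add: frag_extend_diff distrib_left frag.span_base tensor_relationsI)
  ultimately show "tensor_rel (frag_extend ?f x) (frag_extend ?f y)"
    unfolding tensor_rel_def frag_extend_diff[symmetric] by (rule frag_extend_span[rotated])
qed

lemma ctensor_add_left: "ctensor (z + w) a = ctensor z a + ctensor w a"
  by transfer (simp add: tensor_rel_def diff_diff_add[symmetric] frag.span_base tensor_relationsI)

lemma ctensor_add_right: "ctensor z (a + b) = ctensor z a + ctensor z b"
  by transfer (simp add: tensor_rel_def diff_diff_add[symmetric] frag.span_base tensor_relationsI)

lemma cscale_ctensor [simp]: "cscale z (ctensor w a) = ctensor (z * w) a"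
  by transfer (simp add: tensor_rel_def frag.span_zero)

lemma cscale_add: "cscale z (v + w) = cscale z v + cscale z w"
  by transfer (simp add: tensor_rel_def frag.span_zero frag_extend_add)

lemma cscale_diff: "cscale z (v - w) = cscale z v - cscale z w"
  by transfer (simp add: tensor_rel_def frag.span_zero frag_extend_diff)

lemma complexification_induct [case_names zero ctensor diff]:
  assumes "P 0" "\<And>z a. P (ctensor z a)" "\<And>v w. P v \<Longrightarrow> P w \<Longrightarrow> P (v - w)"
  shows "P (v :: 'a::ab_group_add complexification)"
proof -
  have "P (abs_complexification x)" for x
    using subset_UNIV
  proof (induction x rule: frag_induction)
    case (one a)
    then show ?case using assms(2)[of "fst a" "snd a"] by (simp add: ctensor.abs_eq)
  qed (use assms(1,3) in \<open>simp_all add: zero_complexification.abs_eq minus_complexification.abs_eq[symmetric]\<close>)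
  then show ?thesis by (metis Quotient_complexification Quotient_def)
qed

interpretation cx: vector_space cscale
proof
  fix a b :: complex and x y :: "'a complexification"
  show "cscale a (x + y) = cscale a x + cscale a y" by (rule cscale_add)
  have z: "cscale c 0 = (0 :: 'a complexification)" for c
    using cscale_diff[of c 0 0] by simp
  show "cscale (a + b) x = cscale a x + cscale b x"
    by (induction x rule: complexification_induct)
       (simp_all add: z cscale_diff ctensor_add_left ring_distribs)
  show "cscale a (cscale b x) = cscale (a * b) x"
    by (induction x rule: complexification_induct) (simp_all add: z cscale_diff mult.assoc)
  show "cscale 1 x = x"
    by (induction x rule: complexification_induct) (simp_all add: z cscale_diff)
qed

text \<open>The complex linear extension of an additive map and the complex bilinear extension of a
  biadditive form. Computing on representatives is legitimate in these cases, as the lemmas below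
  show; for other functions the definitions have no meaning.\<close>

definition cmap :: "('a::ab_group_add \<Rightarrow> 'a) \<Rightarrow> 'a complexification \<Rightarrow> 'a complexification" where
  "cmap f v =
     abs_complexification (frag_extend (\<lambda>(z, a). frag_of (z, f a)) (rep_complexification v))"

definition frag_eval :: "('b \<Rightarrow> complex) \<Rightarrow> ('b \<Rightarrow>\<^sub>0 int) \<Rightarrow> complex" where
  "frag_eval \<phi> x = (\<Sum>i\<in>Poly_Mapping.keys x. of_int (Poly_Mapping.lookup x i) * \<phi> i)"

definition cform ::
    "('a::ab_group_add \<Rightarrow> 'a \<Rightarrow> int) \<Rightarrow> 'a complexification \<Rightarrow> 'a complexification \<Rightarrow> complex" where
  "cform S v w =
     frag_eval (\<lambda>(z, a). frag_eval (\<lambda>(u, b). z * u * of_int (S a b)) (rep_complexification w))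
       (rep_complexification v)"

definition biadditive :: "('a::ab_group_add \<Rightarrow> 'a \<Rightarrow> int) \<Rightarrow> bool" where
  "biadditive S \<longleftrightarrow> (\<forall>b. additive (\<lambda>a. S a b)) \<and> (\<forall>a. additive (S a))"

lemma tensor_rel_rep: "tensor_rel (rep_complexification (abs_complexification x)) x"
  by (metis Quotient3_complexification Quotient3_def complexification.abs_eq_iff)

lemma cmap_abs:
  fixes f :: "'a::ab_group_add \<Rightarrow> 'a"
  assumes "additive f"
  shows "cmap f (abs_complexification x) =
           abs_complexification (frag_extend (\<lambda>(z, a). frag_of (z, f a)) x)"
proof -
  let ?f = "\<lambda>(z::complex, a). frag_of (z, f a)"
  have *: "frag_extend ?f r \<in> frag.span tensor_relations" if "r \<in> tensor_relations" for r
    using that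
    by (cases rule: tensor_relationsE)
       (simp_all add: frag_extend_diff additive.add[OF assms] frag.span_base tensor_relationsI)
  have "rep_complexification (abs_complexification x) - x \<in> frag.span tensor_relations"
    using tensor_rel_rep unfolding tensor_rel_def .
  from frag_extend_span[OF * this] show ?thesis
    by (simp add: cmap_def complexification.abs_eq_iff tensor_rel_def frag_extend_diff)
qed

lemma cmap_ctensor: "additive f \<Longrightarrow> cmap f (ctensor z a) = ctensor z (f a)"
  by (simp add: ctensor.abs_eq cmap_abs)

lemma abs_complexification_cases: obtains x where "v = abs_complexification x"
  by (metis Quotient3_abs_rep Quotient3_complexification)

lemma cmap_diff:
  assumes "additive f" shows "cmap f (v - w) = cmap f v - cmap f w"
  by (cases v rule: abs_complexification_cases; cases w rule: abs_complexification_cases)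
     (simp add: assms cmap_abs minus_complexification.abs_eq frag_extend_diff)

lemma cmap_linear:
  assumes "additive f" shows "Vector_Spaces.linear cscale cscale (cmap f)"
proof -
  have zero: "cmap f 0 = 0"
    using cmap_diff[OF assms, of 0 0] by simp
  have add: "cmap f (v + w) = cmap f v + cmap f w" for v w
    using cmap_diff[OF assms, of v "0 - w"] cmap_diff[OF assms, of 0 w] by (simp add: zero)
  have "cmap f (cscale c v) = cscale c (cmap f v)" for c v
    by (induction v rule: complexification_induct)
       (simp_all add: zero cscale_diff cmap_diff[OF assms] cmap_ctensor[OF assms])
  with add show ?thesis by unfold_locales
qed

lemma frag_eval_superset:
  assumes "finite A" "Poly_Mapping.keys x \<subseteq> A"
  shows "frag_eval \<phi> x = (\<Sum>i\<in>A. of_int (Poly_Mapping.lookup x i) * \<phi> i)"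
  unfolding frag_eval_def using assms
  by (intro sum.mono_neutral_left) (auto simp: in_keys_iff)

lemma frag_eval_diff: "frag_eval \<phi> (x - y) = frag_eval \<phi> x - frag_eval \<phi> y"
proof -
  let ?A = "Poly_Mapping.keys x \<union> Poly_Mapping.keys y"
  have "Poly_Mapping.keys (x - y) \<subseteq> ?A" by (rule keys_diff)
  then show ?thesis
    by (simp add: frag_eval_superset[of ?A] lookup_minus sum_subtractf left_diff_distrib)
qed

lemma frag_eval_of [simp]: "frag_eval \<phi> (frag_of i) = \<phi> i"
  by (simp add: frag_eval_def)

lemma frag_eval_0 [simp]: "frag_eval \<phi> 0 = 0"
  by (simp add: frag_eval_def)

lemma frag_eval_cmul: "frag_eval \<phi> (frag_cmul k x) = of_int k * frag_eval \<phi> x"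
  by (subst frag_eval_superset[OF finite_keys keys_cmul])
     (simp add: frag_eval_def sum_distrib_left mult.assoc)

lemma frag_eval_add: "frag_eval \<phi> (x + y) = frag_eval \<phi> x + frag_eval \<phi> y"
  using frag_eval_diff[of \<phi> "x + y" y] by simp

lemma frag_eval_tensor_rel:
  assumes "\<And>z w a. \<phi> (z + w, a) = \<phi> (z, a) + \<phi> (w, a)"
    and "\<And>z a b. \<phi> (z, a + b) = \<phi> (z, a) + \<phi> (z, b)"
    and "tensor_rel x y"
  shows "frag_eval \<phi> x = frag_eval \<phi> y"
proof -
  have base: "frag_eval \<phi> r = 0" if "r \<in> tensor_relations" for r
    using that by (cases rule: tensor_relationsE) (simp_all add: frag_eval_diff assms(1,2))
  have "frag_eval \<phi> r = 0" if "r \<in> frag.span tensor_relations" for r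
    using that
    by (induction rule: frag.span_induct_alt)
       (simp_all add: frag_eval_add frag_eval_cmul base)
  then have "frag_eval \<phi> (x - y) = 0"
    using assms(3) by (simp add: tensor_rel_def)
  then show ?thesis by (simp add: frag_eval_diff)
qed

lemma cform_abs:
  assumes "biadditive S"
  shows "cform S (abs_complexification x) (abs_complexification y) =
           frag_eval (\<lambda>(z, a). frag_eval (\<lambda>(u, b). z * u * of_int (S a b)) y) x"
proof -
  have S: "S (a + a') b = S a b + S a' b" "S b (a + a') = S b a + S b a'" for a a' b
    using assms by (auto simp: biadditive_def additive_def)
  have inner: "frag_eval (\<lambda>(u, b). z * u * of_int (S a b)) y' =
      z * frag_eval (\<lambda>(u, b). u * of_int (S a b)) y'" for z a y'
    by (simp add: frag_eval_def sum_distrib_left case_prod_beta mult_ac)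
  have add: "frag_eval (\<lambda>(u, b). u * of_int (S (a + a') b)) y' =
      frag_eval (\<lambda>(u, b). u * of_int (S a b)) y' + frag_eval (\<lambda>(u, b). u * of_int (S a' b)) y'"
    for a a' y'
    by (simp add: frag_eval_def sum.distrib[symmetric] case_prod_beta S ring_distribs)
  have y: "frag_eval (\<lambda>(u, b). u * of_int (S a b)) (rep_complexification (abs_complexification y)) =
      frag_eval (\<lambda>(u, b). u * of_int (S a b)) y" for a
    by (rule frag_eval_tensor_rel[OF _ _ tensor_rel_rep]) (simp_all add: S ring_distribs)
  show ?thesis
    unfolding cform_def inner y
    by (rule frag_eval_tensor_rel[OF _ _ tensor_rel_rep]) (simp_all add: add ring_distribs)
qed

lemma cform_ctensor:
  "biadditive S \<Longrightarrow> cform S (ctensor z a) (ctensor w b) = z * w * of_int (S a b)"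
  by (simp add: ctensor.abs_eq cform_abs)

lemma cform_diff_left:
  assumes "biadditive S" shows "cform S (v - v') w = cform S v w - cform S v' w"
  by (cases v rule: abs_complexification_cases; cases v' rule: abs_complexification_cases;
      cases w rule: abs_complexification_cases)
     (simp add: assms cform_abs minus_complexification.abs_eq frag_eval_diff)

lemma cform_diff_right:
  assumes "biadditive S" shows "cform S w (v - v') = cform S w v - cform S w v'"
  by (cases v rule: abs_complexification_cases; cases v' rule: abs_complexification_cases;
      cases w rule: abs_complexification_cases)
     (simp add: assms cform_abs minus_complexification.abs_eq frag_eval_diff,
      simp add: frag_eval_def sum_subtractf[symmetric] case_prod_beta ring_distribs)

lemma cform_cscale:
  assumes "biadditive S"
  shows "cform S (cscale c v) w = c * cform S v w" "cform S v (cscale c w) = c * cform S v w"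
proof -
  have zero: "cform S 0 u = 0" "cform S u 0 = 0" for u
    using cform_diff_left[OF assms, of 0 0 u] cform_diff_right[OF assms, of u 0 0] by simp_all
  note diff = cform_diff_left[OF assms] cform_diff_right[OF assms] cscale_diff
  have *: "cform S (cscale c (ctensor z a)) w = c * cform S (ctensor z a) w" for z a
    by (induction w rule: complexification_induct)
       (simp_all add: zero diff cform_ctensor[OF assms] ring_distribs)
  show "cform S (cscale c v) w = c * cform S v w"
    by (induction v rule: complexification_induct)
       (simp_all add: zero diff * ring_distribs del: cscale_ctensor)
  have *: "cform S v (cscale c (ctensor z a)) = c * cform S v (ctensor z a)" for z a
    by (induction v rule: complexification_induct)
       (simp_all add: zero diff cform_ctensor[OF assms] ring_distribs)
  show "cform S v (cscale c w) = c * cform S v w"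
    by (induction w rule: complexification_induct)
       (simp_all add: zero diff * ring_distribs del: cscale_ctensor)
qed

section \<open>Lattices with a cyclic automorphism of finite order\<close>

definition eigenspace ::
    "('a::ab_group_add \<Rightarrow> 'a) \<Rightarrow> complex \<Rightarrow> 'a complexification set" where
  "eigenspace h \<mu> = {v. cmap h v = cscale \<mu> v}"

definition is_eigenvalue :: "('a::ab_group_add \<Rightarrow> 'a) \<Rightarrow> complex \<Rightarrow> bool" where
  "is_eigenvalue h \<mu> \<longleftrightarrow> (\<exists>v\<in>eigenspace h \<mu>. v \<noteq> 0)"

text \<open>The algebraic multiplicity, i.e. the dimension of the generalized eigenspace.\<close>

definition eigenvalue_mult :: "('a::ab_group_add \<Rightarrow> 'a) \<Rightarrow> complex \<Rightarrow> nat" where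
  "eigenvalue_mult h \<mu> = cx.dim {v. \<exists>k. ((\<lambda>u. cmap h u - cscale \<mu> u) ^^ k) v = 0}"

definition nondegenerate_on ::
    "'a::ab_group_add complexification set \<Rightarrow> ('a \<Rightarrow> 'a \<Rightarrow> int) \<Rightarrow> bool" where
  "nondegenerate_on W S \<longleftrightarrow>
     (\<forall>v\<in>W. (\<forall>w\<in>W. cform S v w = 0) \<longrightarrow> v = 0) \<and>
     (\<forall>w\<in>W. (\<forall>v\<in>W. cform S v w = 0) \<longrightarrow> w = 0)"

definition cyclic_lattice_triple ::
    "nat \<Rightarrow> ('a::ab_group_add \<Rightarrow> 'a) \<Rightarrow> ('a \<Rightarrow> 'a \<Rightarrow> int) \<Rightarrow> bool" where
  "cyclic_lattice_triple n h S \<longleftrightarrow>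
     (\<exists>b :: nat \<Rightarrow> 'a. is_zbasis n b) \<and>
     additive h \<and> bij h \<and>
     (\<forall>\<mu>. is_eigenvalue h \<mu> \<longrightarrow> (\<exists>k\<ge>1. \<mu> ^ k = 1) \<and> eigenvalue_mult h \<mu> = 1) \<and>
     (\<exists>e. is_zbasis n (\<lambda>i. (h ^^ i) e)) \<and>
     biadditive S \<and> (\<forall>a b. S (h a) (h b) = S a b) \<and>
     nondegenerate_on (cx.span (\<Union>\<mu>\<in>- {1, -1}. eigenspace h \<mu>)) S"

definition eigenvalue_orders :: "('a::ab_group_add \<Rightarrow> 'a) \<Rightarrow> nat set" where
  "eigenvalue_orders h = {m. 1 \<le> m \<and> is_eigenvalue h (exp (2 * of_real pi * \<i> / of_nat m))}"

definition lattice_aut :: "('a::ab_group_add \<Rightarrow> 'a) \<Rightarrow> ('a \<Rightarrow> 'a \<Rightarrow> int) \<Rightarrow> ('a \<Rightarrow> 'a) set" where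
  "lattice_aut h S =
     {g. additive g \<and> bij g \<and> g \<circ> h = h \<circ> g \<and> (\<forall>a b. S (g a) (g b) = S a b)}"

definition int_iterate :: "('a \<Rightarrow> 'a) \<Rightarrow> int \<Rightarrow> 'a \<Rightarrow> 'a" where
  "int_iterate h k = (if 0 \<le> k then h ^^ nat k else inv h ^^ nat (- k))"

section \<open>The labelled divisibility graph of a set of positive integers\<close>

definition p_edges :: "nat set \<Rightarrow> nat \<Rightarrow> (nat \<times> nat) set" where
  "p_edges M p =
     {(m1, m2). m1 \<in> M \<and> m2 \<in> M \<and> prime p \<and> (\<exists>k\<ge>1. m1 = p ^ k * m2) \<and>
        \<not> (\<exists>m3\<in>M - {m1, m2}. m2 dvd m3 \<and> m3 dvd m1)}"

definition edges :: "nat set \<Rightarrow> (nat \<times> nat) set" where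
  "edges M = (\<Union>p. p_edges M p)"

text \<open>The vertex sets of the connected components of the undirected graph underlying \<open>(V, E)\<close>.\<close>

definition graph_components :: "nat set \<Rightarrow> (nat \<times> nat) set \<Rightarrow> nat set set" where
  "graph_components V E = V // {(a, b). a \<in> V \<and> b \<in> V \<and> (a, b) \<in> (E \<union> E\<inverse>)\<^sup>*}"

definition p_planes :: "nat set \<Rightarrow> nat \<Rightarrow> nat set set" where
  "p_planes M p = graph_components M (edges M - p_edges M p)"

definition highest_p_plane :: "nat set \<Rightarrow> nat \<Rightarrow> nat set \<Rightarrow> bool" where
  "highest_p_plane M p P \<longleftrightarrow>
     P \<in> p_planes M p \<and> \<not> (\<exists>m1. \<exists>m2\<in>P. (m1, m2) \<in> p_edges M p)"

definition highest_p_edges :: "nat set \<Rightarrow> nat \<Rightarrow> (nat \<times> nat) set" where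
  "highest_p_edges M p = {(m1, m2) \<in> p_edges M p. \<not> (\<exists>m. (m, m1) \<in> p_edges M p)}"

definition T_property :: "nat set \<Rightarrow> nat \<Rightarrow> bool" where
  "T_property M p \<longleftrightarrow> (\<exists>!P. highest_p_plane M p P)"

definition S2_property :: "nat set \<Rightarrow> bool" where
  "S2_property M \<longleftrightarrow> card (graph_components M (edges M - highest_p_edges M 2)) \<in> {1, 2}"

definition max_valuation :: "nat set \<Rightarrow> nat \<Rightarrow> nat" where
  "max_valuation N p = Max (multiplicity p ` N)"

definition condition_I :: "nat set \<Rightarrow> bool" where
  "condition_I M \<longleftrightarrow>
     card (graph_components M (edges M)) = 1 \<and> S2_property M \<and>
     (\<forall>p. prime p \<and> 3 \<le> p \<longrightarrow> T_property M p)"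

text \<open>A component and a 2-plane of the graph of \<open>M\<close> are given by their vertex sets. On a
  component, the induced subgraph is the graph of the vertex set, because a divisibility chain
  between the ends of a would-be edge stays inside the component.\<close>

definition condition_II :: "nat set \<Rightarrow> bool" where
  "condition_II M \<longleftrightarrow>
     (\<exists>M1 M2. M1 \<noteq> M2 \<and> graph_components M (edges M) = {M1, M2} \<and>
        M1 \<in> p_planes M 2 \<and> M2 \<in> p_planes M 2 \<and>
        (\<forall>p. prime p \<and> 3 \<le> p \<longrightarrow> T_property M1 p \<and> T_property M2 p) \<and>
        gcd (Lcm M1) (Lcm M2) \<in> {1, 2} \<and>
        max_valuation M1 2 > max_valuation M2 2 \<and> max_valuation M2 2 \<in> {0, 1})"

end

theory Submission
  imports Defs "HOL-Computational_Algebra.Computational_Algebra" "HOL-Number_Theory.Cong"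
begin

text \<open>As a module over \<open>\<int>[t]\<close>, the lattice is \<open>\<int>[t] / (\<Prod>m\<in>M. Phi m)\<close>, and an automorphism
  preserving \<open>S\<close> is given by a polynomial \<open>f\<close> that has absolute value \<open>1\<close> at all eigenvalues of
  \<open>h\<close>. By Kronecker's theorem, \<open>f\<close> agrees at each primitive \<open>m\<close>-th root of unity \<open>zeta m\<close> with
  some \<open>\<plusminus> t ^ k\<close>, where the sign and \<open>k\<close> depend on \<open>m \<in> M\<close>. If \<open>m / m'\<close> is not a prime power, then
  \<open>Phi m\<close> and \<open>Phi m'\<close> generate the unit ideal and the data at \<open>m\<close> and \<open>m'\<close> are independent;
  if it is a power of \<open>p\<close>, then the two monomials are congruent modulo \<open>p\<close> in \<open>\<int>[zeta m']\<close>, hence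
  equal there for odd \<open>p\<close> and equal up to sign for \<open>p = 2\<close>. Two consecutive \<open>2\<close>-edges
  exclude a sign change along the lower one, so that signs are free only along
  highest \<open>2\<close>-edges. The properties \<open>T_p\<close> allow one to choose the \<open>p\<close>-part of a common
  exponent, and \<open>S_2\<close> restricts the signs to the one pattern that a power of \<open>t\<close> realizes.
  Conversely, a second highest \<open>p\<close>-plane, or a third component in \<open>S_2\<close>, or a further splitting
  of the graph yields a unit that is not of the form \<open>\<plusminus> t ^ k\<close>.\<close>

section \<open>Integer polynomials at roots of unity\<close>

text \<open>All computations take place in the rings Z[zeta n], whose elements are represented as
  values \<open>ev (zeta n) f\<close>. Two facts carry them: an integer that is a multiple of q in
  Z[zeta n] is one in Z, and \<open>zeta n\<close> satisfies the same integer relations as its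
  powers with exponent prime to n. The obstacle is the prime 2, modulo which 1 and -1 agree. The
  exponents are therefore adjusted at the odd primes, which leaves signs and roots of unity of
  2-power order. Uniqueness of the highest 2-plane follows from connectedness and S_2. The sign
  pattern left over, 1 on that plane and -1 elsewhere, belongs to -t^k with k =
  \<open>odd_total\<close> * 2^(l-1), where l is the 2-multiplicity on the plane. For necessity, the
  values of u on A and of v on M - A are glued when u - v lies in the ideal of \<open>Phis A\<close>
  and \<open>Phis (M - A)\<close>. This ideal contains 1 if no edge leaves A, 2 if only highest
  2-edges do, and t^e - 1 for a suitable e if A is a highest p-plane. The form S may be degenerate
  on the eigenspaces of 1 and -1; there, invertibility over Z takes the place of the isometry
  property.\<close>

definition ev :: "complex \<Rightarrow> int poly \<Rightarrow> complex" where
  "ev w f = poly (map_poly of_int f) w"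

lemma ev_pCons: "ev w (pCons a f) = of_int a + w * ev w f"
  by (cases "pCons a f = 0") (auto simp: ev_def map_poly_pCons)

lemma ev_0 [simp]: "ev w 0 = 0" by (simp add: ev_def)

lemma ev_const [simp]: "ev w [:a:] = of_int a" by (simp add: ev_pCons)

lemma ev_1 [simp]: "ev w 1 = 1" by (simp add: one_pCons)

lemma ev_add [simp]: "ev w (f + g) = ev w f + ev w g"
  by (induction f g rule: poly_induct2) (simp_all add: ev_pCons algebra_simps)

lemma ev_minus [simp]: "ev w (- f) = - ev w f"
  by (induction f) (simp_all add: ev_pCons)

lemma ev_diff [simp]: "ev w (f - g) = ev w f - ev w g"
  using ev_add[of w f "- g"] by simp

lemma ev_smult [simp]: "ev w (smult c f) = of_int c * ev w f"
  by (induction f) (simp_all add: ev_pCons algebra_simps)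

lemma ev_mult [simp]: "ev w (f * g) = ev w f * ev w g"
  by (induction f) (simp_all add: ev_pCons algebra_simps)

lemma ev_power [simp]: "ev w (f ^ n) = ev w f ^ n"
  by (induction n) simp_all

lemma ev_prod: "ev w (prod f A) = (\<Prod>a\<in>A. ev w (f a))"
  by (induction A rule: infinite_finite_induct) simp_all

lemma ev_sum: "ev w (sum f A) = (\<Sum>a\<in>A. ev w (f a))"
  by (induction A rule: infinite_finite_induct) simp_all

lemma ev_monom [simp]: "ev w (monom a n) = of_int a * w ^ n"
  by (induction n) (simp_all add: monom_0 monom_Suc ev_pCons)

lemma ev_pcompose [simp]: "ev w (pcompose f g) = ev (ev w g) f"
  by (induction f) (simp_all add: pcompose_pCons ev_pCons)

lemma ev_of_nat [simp]: "ev w (of_nat n) = of_nat n"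
  by (simp add: of_nat_poly)

lemma ev_altdef: "degree f < n \<Longrightarrow> ev w f = (\<Sum>i<n. of_int (coeff f i) * w ^ i)"
  unfolding ev_def poly_altdef
  by (simp add: coeff_map_poly degree_map_poly)
     (rule sum.mono_neutral_left, auto simp: coeff_eq_0)

lemma monic_division:
  fixes g :: "'a :: idom poly"
  assumes "lead_coeff g = 1"
  obtains q r where "f = g * q + r" "r = 0 \<or> degree r < degree g"
proof -
  have "g \<noteq> 0" using assms by auto
  obtain q r where "pseudo_divmod f g = (q, r)" by fastforce
  from pseudo_divmod[OF \<open>g \<noteq> 0\<close> this] show ?thesis
    using assms that by simp
qed

lemma
  assumes "n > 0"
  shows degree_X_minus_1: "degree (monom 1 n - 1 :: int poly) = n"
    and lead_coeff_X_minus_1: "lead_coeff (monom 1 n - 1 :: int poly) = 1"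
proof -
  have c: "coeff (monom 1 n - 1 :: int poly) n = 1" using assms by simp
  then show d: "degree (monom 1 n - 1 :: int poly) = n"
    by (intro antisym degree_diff_le le_degree) (simp_all add: degree_monom_le)
  show "lead_coeff (monom 1 n - 1 :: int poly) = 1" unfolding d by (rule c)
qed

text \<open>Gauss's lemma: by pseudo-division and multiplicativity of the content, the primitive
  part of a nonzero kernel element of least degree divides the whole kernel over the integers. As it
  divides X^N - 1, its leading coefficient is a unit, so it can be made monic.\<close>

lemma ev_kernel_principal:
  assumes "N > 0" "w ^ N = 1"
  shows "\<exists>g. lead_coeff g = 1 \<and> degree g > 0 \<and> (\<forall>f. ev w f = 0 \<longleftrightarrow> g dvd f)"
proof -
  let ?X = "monom 1 N - 1 :: int poly"
  have lX: "lead_coeff ?X = 1" by (rule lead_coeff_X_minus_1[OF assms(1)])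
  then have X0: "?X \<noteq> 0" by (metis coeff_0 zero_neq_one)
  have "ev w ?X = 0" using assms by simp
  define d where "d = (LEAST d. \<exists>f. f \<noteq> 0 \<and> ev w f = 0 \<and> degree f = d)"
  have "\<exists>f. f \<noteq> 0 \<and> ev w f = 0 \<and> degree f = d"
    unfolding d_def by (rule LeastI_ex) (use X0 \<open>ev w ?X = 0\<close> in blast)
  then obtain f0 where f0: "f0 \<noteq> 0" "ev w f0 = 0" "degree f0 = d" by blast
  have least: "d \<le> degree f" if "f \<noteq> 0" "ev w f = 0" for f
    unfolding d_def by (rule Least_le) (use that in blast)
  define g where "g = primitive_part f0"
  have g0: "g \<noteq> 0" and cg: "content g = 1" and dg: "degree g = d"
    using f0 by (simp_all add: g_def)
  have "ev w (smult (content f0) g) = 0" using f0 by (simp add: g_def)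
  then have evg: "ev w g = 0" using f0 by simp
  have dvd: "g dvd f" if "ev w f = 0" for f
  proof -
    obtain a q where a: "a \<noteq> 0" "smult a f = g * q + pseudo_mod f g"
      and r: "pseudo_mod f g = 0 \<or> degree (pseudo_mod f g) < degree g"
      using pseudo_mod[OF g0, of f] by blast
    have "ev w (g * q + pseudo_mod f g) = of_int a * ev w f" by (metis a(2) ev_smult)
    then have "ev w (pseudo_mod f g) = 0" using evg that by simp
    then have "pseudo_mod f g = 0" using r least dg by (metis not_le)
    then have *: "smult a f = g * q" using a by simp
    then have "content (smult a f) = content g * content q" by (metis content_mult)
    then have "normalize a * content f = content q" using cg by simp
    then have "a dvd content q" by (metis dvd_triv_left normalize_dvd_iff)
    then have "[:a:] dvd q" by (simp add: const_poly_dvd_iff_dvd_content)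
    then obtain q' where "q = smult a q'" by auto
    then have "smult a f = smult a (g * q')" using * by simp
    then have "smult a (f - g * q') = 0" by (simp add: smult_diff_right)
    then have "f = g * q'" using a(1) by simp
    then show ?thesis by simp
  qed
  have "g dvd ?X" using dvd \<open>ev w ?X = 0\<close> by blast
  then obtain k where k: "?X = g * k" by blast
  have "lead_coeff g * lead_coeff k = 1" using lX k by (metis lead_coeff_mult)
  then have u: "lead_coeff g = 1 \<or> lead_coeff g = - 1"
    by (metis abs_zmult_eq_1 abs_1 abs_eq_iff')
  define h where "h = smult (lead_coeff g) g"
  have "lead_coeff h = 1" using u by (auto simp: h_def)
  moreover have hd: "h dvd f \<longleftrightarrow> ev w f = 0" for f
  proof
    assume "h dvd f" then show "ev w f = 0" using evg by (auto simp: h_def elim!: dvdE)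
  next
    assume "ev w f = 0"
    from dvd[OF this] obtain k where "f = g * k" by blast
    then have "f = h * smult (lead_coeff g) k" using u by (auto simp: h_def)
    then show "h dvd f" by (simp add: dvd_smult)
  qed
  moreover have "degree h > 0"
  proof (rule ccontr)
    assume "\<not> degree h > 0"
    then obtain c where "h = [:c:]" by (metis degree_eq_zeroE neq0_conv)
    with \<open>lead_coeff h = 1\<close> have "h = 1" by (simp add: one_pCons)
    then show False using hd[of 1] by simp
  qed
  ultimately show ?thesis by blast
qed

text \<open>Modulo the monic generator \<open>g\<close> of the kernel, \<open>s\<close> may be taken
  of degree below that of \<open>g\<close>, and then both sides agree as polynomials. Integrality
  arguments at roots of unity end here, once an integer has been written as a multiple of
  \<open>q\<close> in Z[w].\<close>

lemma int_dvd_at_root_of_unity: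
  assumes "N > 0" "w ^ N = 1" "of_int c = of_int q * ev w s"
  shows "q dvd c"
proof -
  obtain g where g: "lead_coeff g = 1" "degree g > 0" "\<And>f. ev w f = 0 \<longleftrightarrow> g dvd f"
    using ev_kernel_principal[OF assms(1,2)] by blast
  obtain k r where kr: "s = g * k + r" "r = 0 \<or> degree r < degree g"
    using monic_division[OF g(1)] by blast
  have "ev w g = 0" using g(3) by simp
  then have "ev w r = ev w s" using kr by simp
  then have "g dvd [:c:] - smult q r" using g(3)[of "[:c:] - smult q r"] assms(3) by simp
  moreover have "degree ([:c:] - smult q r) < degree g"
    using kr(2) g(2) by (intro degree_diff_less) auto
  ultimately have "[:c:] - smult q r = 0"
    by (metis dvd_imp_degree_le not_le)
  then have "coeff ([:c:] - smult q r) 0 = 0" by simp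
  then show ?thesis by simp
qed

section \<open>Frobenius modulo a prime, and conjugate roots of unity\<close>

lemma const_dvd_freshman:
  fixes x y :: "int poly"
  assumes "prime (q::nat)"
  shows "[:int q:] dvd (x + y) ^ q - (x ^ q + y ^ q)"
proof -
  have q: "q > 0" using assms by (simp add: prime_gt_0_nat)
  let ?t = "\<lambda>k. of_nat (q choose k) * x ^ k * y ^ (q - k)"
  have "(x + y) ^ q = (\<Sum>k\<le>q. ?t k)" by (rule binomial_ring)
  also have "{..q} = insert 0 (insert q {1..<q})" using q by auto
  also have "(\<Sum>k\<in>insert 0 (insert q {1..<q}). ?t k) = y ^ q + x ^ q + (\<Sum>k\<in>{1..<q}. ?t k)"
    using q by (simp add: add.assoc)
  finally have e: "(x + y) ^ q - (x ^ q + y ^ q) = (\<Sum>k\<in>{1..<q}. ?t k)" by simp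
  have *: "[:int q:] dvd ?t k" if "k \<in> {1..<q}" for k
  proof -
    have "q dvd (q choose k)" using that assms by (intro dvd_choose_prime) auto
    then obtain c where c: "q choose k = q * c" by blast
    have "of_nat (q choose k) = [:int q:] * of_nat c" by (simp add: c of_nat_poly)
    then have "?t k = [:int q:] * (of_nat c * x ^ k * y ^ (q - k))"
      by (simp only: mult.assoc)
    then show ?thesis by (simp only: dvd_triv_left)
  qed
  show ?thesis unfolding e by (rule dvd_sum) (rule *)
qed

lemma fermat_int:
  assumes "prime (q::nat)"
  shows "int q dvd a ^ q - a"
proof -
  have nat: "int q dvd int n ^ q - int n" for n
  proof (induction n)
    case 0 then show ?case using assms by (simp add: prime_gt_0_nat zero_power)
  next
    case (Suc n)
    have "[:int q:] dvd ([:int n:] + 1) ^ q - ([:int n:] ^ q + 1 ^ q)"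
      by (rule const_dvd_freshman[OF assms])
    also have "([:int n:] + 1) ^ q - ([:int n:] ^ q + 1 ^ q) = [:(int n + 1) ^ q - (int n ^ q + 1):]"
      by (simp add: one_pCons poly_const_pow del: pCons_one)
    finally have "int q dvd (int n + 1) ^ q - (int n ^ q + 1)" by (simp add: const_poly_dvd_iff_dvd_content)
    then have "int q dvd ((int n + 1) ^ q - (int n ^ q + 1)) + (int n ^ q - int n)"
      using Suc by (rule dvd_add)
    then show ?case by (simp add: algebra_simps)
  qed
  have "int (nat (a mod int q)) = a mod int q" using assms by (simp add: prime_gt_0_nat)
  then have "[(a mod int q) ^ q = a mod int q] (mod int q)"
    using nat[of "nat (a mod int q)"] by (simp add: cong_iff_dvd_diff)
  then have "[a ^ q = a] (mod int q)" by (simp add: cong_def power_mod)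
  then show ?thesis by (simp add: cong_iff_dvd_diff)
qed

lemma frobenius_poly:
  fixes f :: "int poly"
  assumes "prime (q::nat)"
  shows "[:int q:] dvd pcompose f (monom 1 q) - f ^ q"
proof (induction f)
  case 0 then show ?case using assms by (simp add: prime_gt_0_nat zero_power)
next
  case (pCons a f)
  let ?x = "monom 1 1 :: int poly"
  have e: "pCons a f = [:a:] + ?x * f" by (simp add: monom_Suc monom_0)
  have x: "?x ^ q = monom 1 q" by (simp add: monom_power)
  obtain s where s: "(pCons a f) ^ q = [:a:] ^ q + (?x * f) ^ q + [:int q:] * s"
    using const_dvd_freshman[OF assms, of "[:a:]" "?x * f"] unfolding e
    by (metis add_diff_cancel_left' dvdE diff_add_cancel add.commute)
  obtain u where u: "pcompose f (monom 1 q) = f ^ q + [:int q:] * u"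
    using pCons.IH by (metis diff_eq_eq dvdE add.commute)
  obtain v where v: "a ^ q = a + int q * v"
    using fermat_int[OF assms, of a] by (metis diff_eq_eq dvdE add.commute)
  have "pcompose (pCons a f) (monom 1 q) - (pCons a f) ^ q =
     [:a:] + monom 1 q * (f ^ q + [:int q:] * u) - ([:a + int q * v:] + monom 1 q * f ^ q + [:int q:] * s)"
    unfolding s by (simp only: pcompose_pCons u power_mult_distrib x poly_const_pow v)
  also have "\<dots> = [:int q:] * (monom 1 q * u - [:v:] - s)"
    by (simp add: algebra_simps smult_diff_right smult_add_right)
  finally show ?case by (simp only: dvd_triv_left)
qed

text \<open>The heart of Dedekind's proof that cyclotomic polynomials are irreducible: otherwise
  \<open>q\<close> would divide a power of \<open>N\<close>, by the derivative of \<open>X\<^sup>N - 1\<close>.\<close>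

lemma ev_conjugate_prime:
  assumes "N > 0" "w ^ N = 1" "ev w f = 0" "prime (q::nat)" "coprime q N"
  shows "ev (w ^ q) f = 0"
proof -
  obtain g where g: "\<And>f. ev w f = 0 \<longleftrightarrow> g dvd f"
    using ev_kernel_principal[OF assms(1,2)] by blast
  let ?X = "monom 1 N - 1 :: int poly"
  have "ev w ?X = 0" using assms(2) by simp
  then have "g dvd ?X" using g by blast
  then obtain k where k: "?X = g * k" by blast
  have gw: "ev w g = 0" using g by simp
  have "ev (w ^ q) g = 0"
  proof (rule ccontr)
    assume "ev (w ^ q) g \<noteq> 0"
    moreover have "ev (w ^ q) ?X = 0"
      using assms(2) by (simp flip: power_mult add: mult.commute[of q]) (simp add: power_mult)
    ultimately have kq: "ev (w ^ q) k = 0" by (simp add: k)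
    \<comment> \<open>By the Frobenius congruence, k(w)^q is congruent to k(w^q) = 0 modulo
      \<open>q\<close>. Differentiating X^N - 1 = g k at \<open>w\<close>, where \<open>g\<close>
      vanishes, expresses N w^(N-1) as a multiple of k(w), so that its q-th power is a multiple of
      \<open>q\<close>.\<close>
    obtain s where "pcompose k (monom 1 q) - k ^ q = [:int q:] * s"
      using frobenius_poly[OF assms(4)] by (metis dvdE)
    then have "ev w (pcompose k (monom 1 q) - k ^ q) = ev w ([:int q:] * s)" by simp
    then have kw: "ev w k ^ q = - (of_nat q * ev w s)" using kq by (simp add: neg_eq_iff_add_eq_0 eq_neg_iff_add_eq_0)
    have "pderiv ?X = g * pderiv k + k * pderiv g" by (simp add: k pderiv_mult)
    then have "ev w (monom (int N) (N - 1)) = ev w (g * pderiv k + k * pderiv g)"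
      by (simp add: pderiv_diff pderiv_monom)
    then have "of_nat N * w ^ (N - 1) = ev w k * ev w (pderiv g)" using gw by simp
    then have "of_nat N * w ^ N = w * ev w k * ev w (pderiv g)"
      using assms(1) by (simp add: power_eq_if mult_ac)
    then have "of_nat N = w * ev w k * ev w (pderiv g)" using assms(2) by simp
    then have "of_nat N ^ q = ev w k ^ q * (w * ev w (pderiv g)) ^ q"
      by (metis mult.commute mult.left_commute power_mult_distrib)
    also have "\<dots> = of_int (int q) * ev w (- (s * (monom 1 1 * pderiv g) ^ q))"
      by (simp add: kw)
    finally have "of_int (int (N ^ q)) = of_int (int q) * ev w (- (s * (monom 1 1 * pderiv g) ^ q))"
      by simp
    from int_dvd_at_root_of_unity[OF assms(1,2) this] have "q dvd N ^ q"
      by (simp only: of_nat_dvd_iff)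
    then have "q dvd N" using assms(4) prime_dvd_power_nat by blast
    then show False using assms(4,5) by (metis coprime_absorb_left not_prime_unit)
  qed
  then show ?thesis using g[of f] assms(3) by (auto elim!: dvdE)
qed

text \<open>Plays the role of the Galois action on Z[w]; the prime factors of \<open>a\<close> are
  applied one after another. The order of \<open>w\<close> may be any divisor of
  \<open>N\<close>.\<close>

lemma ev_conjugate:
  assumes "N > 0" "w ^ N = 1" "ev w f = 0" "coprime a N" "a > 0"
  shows "ev (w ^ a) f = 0"
  using assms(2-)
proof (induction a arbitrary: w rule: less_induct)
  case (less a)
  show ?case
  proof (cases "a = 1")
    case False
    then obtain q where q: "prime q" "q dvd a" using prime_factor_nat by blast
    then obtain b where b: "a = q * b" by blast
    have cop: "coprime q N" "coprime b N" using less.prems b by (auto simp: coprime_mult_left_iff)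
    have "b > 0" "b < a" using b less.prems prime_gt_1_nat[OF q(1)] by auto
    moreover have "(w ^ q) ^ N = 1" using less.prems(1) by (metis power_commutes power_mult power_one mult.commute)
    moreover have "ev (w ^ q) f = 0"
      using ev_conjugate_prime[OF assms(1) less.prems(1,2) q(1) cop(1)] .
    ultimately have "ev ((w ^ q) ^ b) f = 0" using less.IH cop(2) by blast
    then show ?thesis by (simp add: b power_mult)
  qed (use less.prems in simp)
qed

section \<open>Cyclotomic polynomials\<close>

definition zeta :: "nat \<Rightarrow> complex" where
  "zeta m = cis (2 * pi / real m)"

lemma zeta_power: "zeta m ^ k = cis (2 * pi * real k / real m)"
  by (simp add: zeta_def Complex.DeMoivre mult_ac)

lemma zeta_power_self [simp]: "m > 0 \<Longrightarrow> zeta m ^ m = 1"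
  by (simp add: zeta_power)

lemma zeta_nonzero [simp]: "zeta m \<noteq> 0" by (simp add: zeta_def)

lemma norm_zeta [simp]: "cmod (zeta m) = 1" by (simp add: zeta_def)

lemma zeta_power_mod: "m > 0 \<Longrightarrow> zeta m ^ (k mod m) = zeta m ^ k"
  by (metis mult_1 div_mult_mod_eq mult.commute power_add power_mult power_one zeta_power_self)

lemma zeta_power_eq_iff:
  assumes "m > 0" shows "zeta m ^ k = zeta m ^ l \<longleftrightarrow> [k = l] (mod m)"
proof -
  have "inj_on (\<lambda>k. cis (2 * pi * real k / real m)) {..<m}"
    using bij_betw_roots_unity[OF assms] by (simp add: bij_betw_def)
  then have "zeta m ^ (k mod m) = zeta m ^ (l mod m) \<longleftrightarrow> k mod m = l mod m"
    unfolding zeta_power by (rule inj_on_eq_iff) (use assms in auto)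
  then show ?thesis using assms by (simp add: zeta_power_mod cong_def)
qed

lemma zeta_power_eq_1_iff: "m > 0 \<Longrightarrow> zeta m ^ k = 1 \<longleftrightarrow> m dvd k"
  using zeta_power_eq_iff[of m k 0] by (simp add: cong_0_iff)

lemma zeta_mult: "a > 0 \<Longrightarrow> m > 0 \<Longrightarrow> zeta (a * m) ^ a = zeta m"
  by (simp add: zeta_power) (simp add: zeta_def)

lemma root_of_unity_eq_zeta_power:
  assumes "m > 0" "w ^ m = 1" obtains k where "w = zeta m ^ k"
proof -
  have "w \<in> (\<lambda>k. cis (2 * pi * real k / real m)) ` {..<m}"
    using bij_betw_roots_unity[OF assms(1)] assms(2) by (auto simp: bij_betw_def)
  then show ?thesis using that by (auto simp: zeta_power)
qed

lemma zeta_power_eq_minus_1_iff: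
  assumes "m > 0" shows "zeta m ^ k = - 1 \<longleftrightarrow> \<not> m dvd k \<and> m dvd 2 * k"
proof -
  have "zeta m ^ (2 * k) = (zeta m ^ k)\<^sup>2" by (simp add: power_mult mult.commute)
  then have "m dvd 2 * k \<longleftrightarrow> (zeta m ^ k)\<^sup>2 = 1"
    using assms zeta_power_eq_1_iff by metis
  also have "\<dots> \<longleftrightarrow> zeta m ^ k = 1 \<or> zeta m ^ k = - 1" by (rule power2_eq_1_iff)
  finally show ?thesis using zeta_power_eq_1_iff[OF assms, of k] by (metis one_neq_neg_one)
qed

text \<open>The cyclotomic polynomial, as the monic generator of the ideal of all integer polynomials
  that vanish at \<open>zeta m\<close>; for \<open>m = 0\<close> it is unspecified.\<close>

definition Phi :: "nat \<Rightarrow> int poly" where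
  "Phi m = (SOME g. lead_coeff g = 1 \<and> degree g > 0 \<and> (\<forall>f. ev (zeta m) f = 0 \<longleftrightarrow> g dvd f))"

lemma
  assumes "m > 0"
  shows lead_coeff_Phi: "lead_coeff (Phi m) = 1"
    and degree_Phi: "degree (Phi m) > 0"
    and Phi_dvd_iff: "Phi m dvd f \<longleftrightarrow> ev (zeta m) f = 0"
proof -
  have "lead_coeff (Phi m) = 1 \<and> degree (Phi m) > 0 \<and>
      (\<forall>f. ev (zeta m) f = 0 \<longleftrightarrow> Phi m dvd f)"
    unfolding Phi_def by (rule someI_ex, rule ev_kernel_principal[OF assms]) (use assms in simp)
  then show "lead_coeff (Phi m) = 1" "degree (Phi m) > 0"
    "Phi m dvd f \<longleftrightarrow> ev (zeta m) f = 0" by blast+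
qed

lemma ev_zeta_Phi [simp]: "m > 0 \<Longrightarrow> ev (zeta m) (Phi m) = 0"
  using Phi_dvd_iff[of m "Phi m"] by simp

lemma Phi_dvd_X:
  assumes "m > 0" "m dvd n" shows "Phi m dvd monom 1 n - 1"
  using assms by (simp add: Phi_dvd_iff zeta_power_eq_1_iff)

lemma zeta_primitive_order:
  assumes "N > 0" "w ^ N = 1"
  obtains d a b where "d > 0" "d dvd N" "w = zeta d ^ a" "coprime a d" "a > 0" "zeta d = w ^ b" "coprime b d" "b > 0"
proof -
  obtain k0 where k0: "w = zeta N ^ k0" using root_of_unity_eq_zeta_power[OF assms] .
  \<comment> \<open>The summand \<open>N\<close> keeps the exponents positive even for w = 1, as
    \<open>ev_conjugate\<close> demands.\<close>
  define k where "k = k0 + N"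
  have k: "w = zeta N ^ k" "k > 0" using assms(1) by (simp_all add: k0 k_def power_add)
  define g d a where "g = gcd k N" "d = N div g" "a = k div g"
  have g: "g > 0" using assms(1) by (simp add: g_d_a_def)
  have N: "N = g * d" and kk: "k = g * a" by (simp_all add: g_d_a_def)
  have d: "d > 0" and a: "a > 0" using assms(1) k(2) N kk by auto
  have cop: "coprime a d" unfolding g_d_a_def using assms(1) by (simp add: div_gcd_coprime)
  have w: "w = zeta d ^ a"
    using zeta_mult[OF g d] by (simp add: k(1) N kk power_mult)
  obtain b0 where b0: "[a * b0 = 1] (mod d)" using cong_solve_coprime_nat[OF cop] by auto
  define b where "b = b0 + d"
  have b: "[a * b = 1] (mod d)" unfolding b_def using b0
    by (simp add: distrib_left cong_def)
  then have "coprime b d" by (metis cong_imp_coprime cong_sym coprime_1_left coprime_mult_left_iff)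
  moreover have "zeta d = w ^ b"
    using zeta_power_eq_iff[OF d, of "a * b" 1] b by (simp add: w power_mult)
  moreover have "d dvd N" "b > 0" using d by (simp_all add: N b_def)
  ultimately show ?thesis using that d w cop a by blast
qed

lemma root_of_Phi:
  assumes "m > 0" "ev w (Phi m) = 0"
  shows "w ^ m = 1"
proof -
  obtain k where "monom 1 m - 1 = Phi m * k" using Phi_dvd_X[OF assms(1) dvd_refl] by (metis dvdE)
  then have "ev w (monom 1 m - 1) = 0" using assms(2) by (metis ev_mult mult_zero_left)
  then show ?thesis by simp
qed

lemma simple_root_of_unity:
  assumes "N > 0" "monom 1 N - 1 = f * g" "ev w f = 0"
  shows "ev w g \<noteq> 0"
proof
  assume "ev w g = 0"
  have "ev w (monom 1 N - 1) = 0" using assms(2,3) by simp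
  then have "w ^ N = 1" by simp
  then have "w \<noteq> 0" using assms(1) by (auto simp: zero_power)
  have "pderiv (monom 1 N - 1) = f * pderiv g + g * pderiv f"
    by (simp add: assms(2) pderiv_mult)
  then have "ev w (monom (int N) (N - 1)) = ev w (f * pderiv g + g * pderiv f)"
    by (simp add: pderiv_diff pderiv_monom)
  then show False using assms \<open>w \<noteq> 0\<close> \<open>ev w g = 0\<close> by simp
qed

text \<open>Since \<open>Phi m\<close> divides X^m - 1, \<open>d\<close> divides \<open>m\<close>.
  If \<open>Phi d\<close> did not vanish at \<open>zeta m\<close>, its cofactor in
  \<open>Phi m\<close> would, and would be a multiple of \<open>Phi m\<close> of smaller degree. So
  \<open>m\<close> divides \<open>d\<close> as well.\<close>

lemma ev_Phi_zeta_eq_0: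
  assumes "m > 0" "d > 0" "ev (zeta d) (Phi m) = 0" shows "d = m"
proof -
  have "zeta d ^ m = 1" using root_of_Phi assms by blast
  then have "d dvd m" using assms zeta_power_eq_1_iff by blast
  obtain k where k: "Phi m = Phi d * k" using assms Phi_dvd_iff by (metis dvdE)
  have "ev (zeta m) (Phi d) = 0"
  proof (rule ccontr)
    assume "ev (zeta m) (Phi d) \<noteq> 0"
    moreover have "ev (zeta m) (Phi d * k) = 0" using assms(1) by (metis ev_zeta_Phi k)
    ultimately have "Phi m dvd k" using Phi_dvd_iff[OF assms(1)] by simp
    moreover have "lead_coeff (Phi d) * lead_coeff k = 1"
      using lead_coeff_Phi[OF assms(1)] by (metis k lead_coeff_mult)
    then have "k \<noteq> 0" by auto
    moreover have "Phi d \<noteq> 0" using degree_Phi[OF assms(2)] by auto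
    ultimately have "degree (Phi m) \<le> degree k" "degree (Phi m) = degree (Phi d) + degree k"
      by (blast intro: dvd_imp_degree_le) (simp only: k degree_mult_eq \<open>k \<noteq> 0\<close> \<open>Phi d \<noteq> 0\<close> not_False_eq_True)
    then show False using degree_Phi[OF assms(2)] by simp
  qed
  then have "zeta m ^ d = 1" using root_of_Phi assms(2) by blast
  then have "m dvd d" using assms(1) zeta_power_eq_1_iff by blast
  with \<open>d dvd m\<close> show ?thesis by (simp add: dvd_antisym)
qed

definition Phis :: "nat set \<Rightarrow> int poly" where "Phis A = (\<Prod>m\<in>A. Phi m)"

lemma ev_Phis_eq_0_iff: "finite A \<Longrightarrow> ev w (Phis A) = 0 \<longleftrightarrow> (\<exists>m\<in>A. ev w (Phi m) = 0)"
  by (simp add: Phis_def ev_prod)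

lemma Phis_dvdI:
  assumes "finite A" "\<And>m. m \<in> A \<Longrightarrow> m > 0 \<and> Phi m dvd f"
  shows "Phis A dvd f"
  using assms
proof (induction A)
  case (insert m A)
  then obtain g where g: "f = Phis A * g" by (metis dvdE insertCI)
  have m: "m > 0" "ev (zeta m) f = 0" using insert.prems Phi_dvd_iff by auto
  have "ev (zeta m) (Phis A) \<noteq> 0"
  proof
    assume "ev (zeta m) (Phis A) = 0"
    then obtain n where "n \<in> A" "ev (zeta m) (Phi n) = 0"
      using ev_Phis_eq_0_iff[OF insert.hyps(1)] by blast
    then have "m = n" using ev_Phi_zeta_eq_0 insert.prems m(1) by blast
    then show False using \<open>n \<in> A\<close> insert.hyps by simp
  qed
  then have "ev (zeta m) g = 0" using m(2) g by simp
  then obtain k where "g = Phi m * k" using Phi_dvd_iff[OF m(1)] by (metis dvdE)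
  then have "f = Phis (insert m A) * k" using insert.hyps g by (simp add: Phis_def mult_ac)
  then show ?case by simp
qed (simp add: Phis_def)

lemma Phi_dvd_Phis: "finite A \<Longrightarrow> m \<in> A \<Longrightarrow> Phi m dvd Phis A"
  by (simp add: Phis_def dvd_prodI)

lemma lead_coeff_Phis:
  assumes "finite A" "\<And>m. m \<in> A \<Longrightarrow> m > 0" shows "lead_coeff (Phis A) = 1"
  using assms by (induction A) (simp_all add: Phis_def lead_coeff_mult lead_coeff_Phi)

text \<open>A complex root of the remaining cofactor would be a root of \<open>D\<close>, hence
  conjugate to some \<open>zeta d\<close> at which \<open>D\<close> vanishes, hence a root of the
  product too: a double root of X^N - 1.\<close>

lemma monic_factor_of_X:
  assumes N: "N > 0" and D: "lead_coeff D = 1" "D dvd monom 1 N - 1"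
  shows "D = Phis {d. d > 0 \<and> d dvd N \<and> ev (zeta d) D = 0}"
proof -
  let ?A = "{d. d > 0 \<and> d dvd N \<and> ev (zeta d) D = 0}"
  have fin: "finite ?A" by (rule finite_subset[of _ "{..N}"]) (use N in \<open>auto dest: dvd_imp_le\<close>)
  have "Phis ?A dvd D" using Phis_dvdI[OF fin] Phi_dvd_iff by simp
  then obtain g where g: "D = Phis ?A * g" by blast
  obtain E where E: "monom 1 N - 1 = D * E" using D(2) by blast
  have lg: "lead_coeff g = 1"
    using D(1) lead_coeff_Phis[OF fin] g by (metis (no_types, lifting) lead_coeff_mult mem_Collect_eq mult_1)
  have "degree g = 0"
  proof (rule ccontr)
    assume "degree g \<noteq> 0"
    then have "degree (map_poly of_int g :: complex poly) \<noteq> 0" by (simp add: degree_map_poly)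
    then obtain w where w: "ev w g = 0" unfolding ev_def
      by (metis constant_degree fundamental_theorem_of_algebra)
    have Dw: "ev w D = 0" using w arg_cong[OF g, of "ev w"] by simp
    then have "ev w (monom 1 N - 1) = 0" unfolding E by simp
    then have "w ^ N = 1" by simp
    then obtain d a b where d: "d > 0" "d dvd N" "w = zeta d ^ a" "coprime a d" "a > 0"
      "zeta d = w ^ b" "coprime b d" "b > 0"
      using zeta_primitive_order[OF N] by blast
    have "w ^ d = 1" using d(1,3) by (metis power_commutes power_mult power_one mult.commute zeta_power_self)
    then have "ev (zeta d) D = 0" unfolding d(6) by (rule ev_conjugate[OF d(1) _ Dw d(7,8)])
    then have "d \<in> ?A" using d(1,2) by simp
    moreover have "ev w (Phi d) = 0" unfolding d(3) using d(1)
      by (intro ev_conjugate[OF d(1) _ _ d(4,5)]) simp_all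
    ultimately have "ev w (Phis ?A) = 0" using ev_Phis_eq_0_iff[OF fin] by blast
    moreover have "ev w (g * E) \<noteq> 0"
    proof (rule simple_root_of_unity[OF N _ \<open>ev w (Phis ?A) = 0\<close>])
      have "Phis ?A * g * E = D * E" by (simp only: g[symmetric])
      then show "monom 1 N - 1 = Phis ?A * (g * E)" by (simp only: E mult.assoc)
    qed
    ultimately show False using w by simp
  qed
  then obtain c where c: "g = [:c:]" by (rule degree_eq_zeroE)
  then have "g = 1" using lg by (simp add: one_pCons)
  then show ?thesis using g by (simp only: mult_1_right)
qed

section \<open>Kronecker's theorem\<close>

lemma sum_zeta_power:
  assumes "m > 0"
  shows "(\<Sum>k<m. (zeta m ^ n) ^ k) = (if m dvd n then of_nat m else 0)"
proof (cases "m dvd n")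
  case True
  then have "zeta m ^ n = 1" using assms by (simp add: zeta_power_eq_1_iff)
  then show ?thesis using True by simp
next
  case False
  then have "zeta m ^ n \<noteq> 1" using assms by (simp add: zeta_power_eq_1_iff)
  moreover have "(zeta m ^ n) ^ m = 1" using assms
    by (metis mult.commute power_mult power_one zeta_power_self)
  ultimately show ?thesis using False by (simp add: geometric_sum)
qed

text \<open>Inversion of the discrete Fourier transform, with m - i in place of the exponent
  -i.\<close>

lemma coeff_from_roots_of_unity:
  assumes "m > 0" "degree h < m" "i < m"
  shows "of_nat m * of_int (coeff h i) = (\<Sum>k<m. ev (zeta m ^ k) h * (zeta m ^ k) ^ (m - i))"
proof -
  have dvd: "m dvd l + (m - i) \<longleftrightarrow> l = i" if "l < m" for l
  proof
    assume "m dvd l + (m - i)"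
    then obtain c where c: "l + (m - i) = m * c" by blast
    then have "0 < m * c" "m * c < m * 2" using that assms(3) by linarith+
    then have "c = 1" by (cases c) auto
    then show "l = i" using c assms(3) by simp
  qed (use assms(3) in simp)
  have "(\<Sum>k<m. ev (zeta m ^ k) h * (zeta m ^ k) ^ (m - i)) =
     (\<Sum>k<m. \<Sum>l<m. of_int (coeff h l) * (zeta m ^ (l + (m - i))) ^ k)"
    by (simp add: ev_altdef[OF assms(2)] sum_distrib_right mult.assoc)
       (simp flip: power_mult power_add add: algebra_simps)
  also have "\<dots> = (\<Sum>l<m. of_int (coeff h l) * (\<Sum>k<m. (zeta m ^ (l + (m - i))) ^ k))"
    by (subst sum.swap) (simp add: sum_distrib_left)
  also have "\<dots> = (\<Sum>l<m. of_int (coeff h l) * (if l = i then of_nat m else 0))"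
    unfolding sum_zeta_power[OF assms(1)] by (intro sum.cong) (auto simp: dvd)
  also have "\<dots> = of_int (coeff h i) * of_nat m" using assms(3) by (simp add: if_distrib cong: if_cong)
  finally show ?thesis by (simp add: mult.commute)
qed

lemma finite_bounded_polys: "finite {h :: int poly. degree h < m \<and> (\<forall>i<m. \<bar>coeff h i\<bar> \<le> B)}"
proof (rule finite_subset)
  show "{h :: int poly. degree h < m \<and> (\<forall>i<m. \<bar>coeff h i\<bar> \<le> B)} \<subseteq>
      Poly ` {xs. set xs \<subseteq> {- B..B} \<and> length xs = m}"
  proof
    fix h :: "int poly" assume h: "h \<in> {h. degree h < m \<and> (\<forall>i<m. \<bar>coeff h i\<bar> \<le> B)}"
    have "h = Poly (map (coeff h) [0..<m])"
      using h by (intro poly_eqI) (auto simp: nth_default_def coeff_eq_0)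
    moreover have "set (map (coeff h) [0..<m]) \<subseteq> {- B..B}" using h by (auto simp: abs_le_iff)
    ultimately show "h \<in> Poly ` {xs. set xs \<subseteq> {- B..B} \<and> length xs = m}"
      by (intro image_eqI[of _ _ "map (coeff h) [0..<m]"]) auto
  qed
  show "finite (Poly ` {xs. set xs \<subseteq> {- B..B} \<and> length xs = m})"
    by (intro finite_imageI finite_lists_length_eq) simp
qed

text \<open>Multiplying the powers of \<open>f\<close> by the complementary factor of
  \<open>X\<^sup>m - 1\<close> bounds their values at all \<open>m\<close>-th roots of unity, hence the coefficients of
  their remainders, so that two powers agree.\<close>

lemma kronecker:
  assumes "m > 0" "\<And>w. ev w (Phi m) = 0 \<Longrightarrow> cmod (ev w f) = 1"
  shows "\<exists>N>0. ev (zeta m) f ^ N = 1"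
proof -
  let ?X = "monom 1 m - 1 :: int poly"
  note dX = degree_X_minus_1[OF assms(1)] and lX = lead_coeff_X_minus_1[OF assms(1)]
  obtain G where G: "?X = Phi m * G" using Phi_dvd_X[OF assms(1) dvd_refl] by blast
  define B where "B = (\<Sum>k<m. cmod (ev (zeta m ^ k) G))"
  let ?H = "{h :: int poly. degree h < m \<and> (\<forall>i<m. \<bar>coeff h i\<bar> \<le> \<lceil>B\<rceil>)}"
  have "\<exists>h. h \<in> ?H \<and> ev (zeta m) h = ev (zeta m) f ^ j * ev (zeta m) G" for j
  proof -
    obtain q r where qr: "f ^ j * G = ?X * q + r" "r = 0 \<or> degree r < degree ?X"
      using monic_division[OF lX] by blast
    have dr: "degree r < m" using qr(2) dX assms(1) by auto
    have ev: "ev w r = ev w f ^ j * ev w G" if "w ^ m = 1" for w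
      using arg_cong[OF qr(1), of "ev w"] that by simp
    have w: "(zeta m ^ k) ^ m = 1" for k
      using assms(1) by (metis mult.commute power_mult power_one zeta_power_self)
    \<comment> \<open>At an m-th root of unity either \<open>Phi m\<close> vanishes, so that
      \<open>f\<close> has absolute value 1, or \<open>G\<close> does; the bound is thus independent
      of \<open>j\<close>.\<close>
    have bound: "cmod (ev (zeta m ^ k) r) \<le> cmod (ev (zeta m ^ k) G)" for k
    proof -
      have "ev (zeta m ^ k) ?X = 0" using w by simp
      then have "ev (zeta m ^ k) (Phi m) = 0 \<or> ev (zeta m ^ k) G = 0" unfolding G by simp
      then show ?thesis using assms(2) by (auto simp: ev w norm_mult norm_power)
    qed
    have "\<bar>coeff r i\<bar> \<le> \<lceil>B\<rceil>" if "i < m" for i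
    proof -
      have "real m * \<bar>real_of_int (coeff r i)\<bar> = cmod (of_nat m * of_int (coeff r i))"
        by (simp add: norm_mult)
      also have "\<dots> \<le> (\<Sum>k<m. cmod (ev (zeta m ^ k) r * (zeta m ^ k) ^ (m - i)))"
        unfolding coeff_from_roots_of_unity[OF assms(1) dr that] by (rule norm_sum)
      also have "\<dots> = (\<Sum>k<m. cmod (ev (zeta m ^ k) r))" by (simp add: norm_mult norm_power)
      also have "\<dots> \<le> B" unfolding B_def by (intro sum_mono bound)
      finally have "real m * \<bar>real_of_int (coeff r i)\<bar> \<le> B" .
      moreover have "1 * \<bar>real_of_int (coeff r i)\<bar> \<le> real m * \<bar>real_of_int (coeff r i)\<bar>"
        using assms(1) by (intro mult_right_mono) auto
      ultimately show ?thesis by linarith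
    qed
    then show ?thesis using dr ev assms(1) by (intro exI[of _ r]) auto
  qed
  then have "\<forall>j. \<exists>h. h \<in> ?H \<and> ev (zeta m) h = ev (zeta m) f ^ j * ev (zeta m) G" by blast
  from choice[OF this] obtain h
    where h: "\<And>j. h j \<in> ?H" "\<And>j. ev (zeta m) (h j) = ev (zeta m) f ^ j * ev (zeta m) G"
    by blast
  have "finite (range h)" by (rule finite_subset[OF _ finite_bounded_polys]) (use h(1) in blast)
  then have "\<not> inj h" using finite_imageD by blast
  then obtain i j where ij: "h i = h j" "i < j" by (metis injI linorder_neqE_nat)
  have "ev (zeta m) G \<noteq> 0"
    using simple_root_of_unity[OF assms(1) G] assms(1) by simp
  then have eq: "ev (zeta m) f ^ i = ev (zeta m) f ^ j" using h(2) ij(1) by (metis mult_cancel_right)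
  have "ev (zeta m) f \<noteq> 0" using assms(2)[of "zeta m"] assms(1) by auto
  moreover have "ev (zeta m) f ^ j = ev (zeta m) f ^ i * ev (zeta m) f ^ (j - i)"
    using ij(2) by (simp flip: power_add)
  ultimately have "ev (zeta m) f ^ (j - i) = 1" using eq by simp
  then show ?thesis using ij(2) by (intro exI[of _ "j - i"]) simp
qed

text \<open>Let \<open>N\<close> be the least positive multiple of \<open>m\<close> that annihilates
  the order of the value \<open>e\<close>. A conjugation zeta N -> (zeta N)^a with a = 1 modulo m
  fixes \<open>zeta m\<close>, hence fixes \<open>e\<close>, but also sends \<open>e\<close> to e^a;
  so \<open>N\<close> divides a - 1. Suitable \<open>a\<close> force N = m, or N = 2m with
  \<open>m\<close> odd.\<close>

lemma root_of_unity_at_zeta: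
  assumes "m > 0" "K > 0" "ev (zeta m) f ^ K = 1"
  shows "\<exists>s\<in>{1, - 1}. \<exists>k. ev (zeta m) f = of_int s * zeta m ^ k"
proof -
  define e where "e = ev (zeta m) f"
  define N where "N = (LEAST N. N > 0 \<and> m dvd N \<and> e ^ N = 1)"
  have "m * K > 0 \<and> m dvd m * K \<and> e ^ (m * K) = 1"
    using assms by (simp add: e_def power_mult mult.commute[of m])
  then have N: "N > 0 \<and> m dvd N \<and> e ^ N = 1" unfolding N_def by (rule LeastI)
  have Ndvd: "N dvd x" if "m dvd x" "e ^ x = 1" for x
  proof (rule ccontr)
    assume "\<not> N dvd x"
    then have "x mod N > 0" by (simp add: mod_greater_zero_iff_not_dvd)
    moreover have "m dvd x mod N" using that N by (simp add: dvd_mod)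
    moreover have "e ^ (x mod N) = 1"
    proof -
      have "e ^ x = (e ^ N) ^ (x div N) * e ^ (x mod N)" by (simp flip: power_mult power_add)
      then show ?thesis using that N by simp
    qed
    ultimately have "N \<le> x mod N" unfolding N_def by (intro Least_le) simp
    then show False using N by (metis mod_less_divisor not_le)
  qed
  have key: "N dvd a - 1" if a: "a > 0" "coprime a N" "[a = 1] (mod m)" for a
  proof -
    obtain c where c: "N = c * m" using N by (metis dvdE mult.commute)
    then have c0: "c > 0" using N by (cases c) auto
    obtain k where k: "e = zeta N ^ k" using root_of_unity_eq_zeta_power N by blast
    define g where "g = pcompose f (monom 1 c) - monom 1 k"
    have zN: "zeta N ^ c = zeta m" unfolding c using c0 assms(1) by (rule zeta_mult)
    have "ev (zeta N) g = 0" using zN by (simp add: g_def e_def[symmetric] k[symmetric])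
    then have "ev (zeta N ^ a) g = 0" using ev_conjugate[of N "zeta N" g a] N a by simp
    then have "ev (zeta m ^ a) f = e ^ a"
      unfolding g_def by (simp add: k zN[symmetric]) (simp flip: power_mult add: mult.commute)
    moreover have "zeta m ^ a = zeta m" using zeta_power_eq_iff[OF assms(1), of a 1] a by simp
    ultimately have "e = e ^ a" by (simp add: e_def)
    moreover have "e ^ a = e * e ^ (a - 1)" using a(1) by (simp add: power_eq_if)
    moreover have "e \<noteq> 0" using N by (metis power_0_left less_numeral_extra(3) zero_neq_one)
    ultimately have "e ^ (a - 1) = 1" by simp
    moreover have "m dvd a - 1" using a(1,3) by (metis cong_altdef_nat cong_sym Suc_leI One_nat_def)
    ultimately show ?thesis using Ndvd by blast
  qed
  obtain s where s: "N = m * s" using N by blast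
  have s0: "s > 0" using N s by simp
  \<comment> \<open>For a common prime p of \<open>s\<close> and \<open>m\<close> and r = s / p, the
    number 1 + m r would be prime to \<open>N\<close> and 1 modulo \<open>m\<close>, but not 1
    modulo \<open>N\<close>.\<close>
  have cop: "coprime s m"
  proof (rule ccontr)
    assume "\<not> coprime s m"
    then obtain p where p: "prime p" "p dvd s" "p dvd m"
      by (metis coprime_iff_gcd_eq_1 gcd_dvd1 gcd_dvd2 dvd_trans prime_factor_nat)
    obtain r where r: "s = p * r" using p by blast
    have r0: "r > 0" and p1: "p > 1" using s0 r p(1) prime_gt_1_nat by auto
    have Np: "N = p * (m * r)" by (simp add: s r)
    have "coprime (1 + m * r) N"
      unfolding Np by (metis coprime_add_one_left coprime_mult_right_iff p(3) dvd_mult2 coprime_divisors dvd_refl add.commute)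
    moreover have "[1 + m * r = 1] (mod m)" unfolding cong_def by (rule mod_mult_self2)
    ultimately have "N dvd 1 + m * r - 1" by (intro key) simp_all
    then have "N \<le> m * r" using r0 assms(1) by (simp add: dvd_imp_le)
    then show False unfolding Np using p1 r0 assms(1) by simp
  qed
  \<comment> \<open>An exponent that is 1 modulo \<open>m\<close> and -1 modulo \<open>s\<close>;
    \<open>key\<close> then yields 1 = -1 modulo \<open>s\<close>.\<close>
  obtain x0 where x0: "[x0 = 1] (mod m)" "[x0 = s - 1] (mod s)"
    using binary_chinese_remainder_nat[of m s 1 "s - 1"] cop by (auto simp: coprime_commute)
  define x where "x = x0 + N"
  have x: "[x = 1] (mod m)" "[x = s - 1] (mod s)" "x > 0"
    using x0 N by (simp_all add: x_def s cong_def)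
  have "coprime x N" unfolding s coprime_mult_right_iff
    using x s0 by (metis cong_imp_coprime cong_sym coprime_1_left coprime_diff_one_left_nat)
  then have "N dvd x - 1" using key x by blast
  then have "s dvd x - 1" using s by auto
  then have "[x = 1] (mod s)" using x(3) by (metis cong_altdef_nat Suc_leI One_nat_def)
  then have "[s - 1 = 1] (mod s)" using x(2) by (metis cong_sym cong_trans)
  then have "[s - 1 + 1 = 1 + 1] (mod s)" by (rule cong_add) simp
  then have "s dvd 2" using s0 by (simp add: cong_def mod_eq_0_iff_dvd numeral_2_eq_2)
  then have "s \<le> 2" by (rule dvd_imp_le) simp
  then have "s = 1 \<or> s = 2" using s0 by linarith
  then consider "s = 1" | "s = 2" by fastforce
  then show ?thesis
  proof cases
    case 1
    then have "e ^ m = 1" using N s by simp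
    then obtain k where "e = zeta m ^ k" using root_of_unity_eq_zeta_power assms(1) by blast
    then show ?thesis by (auto simp: e_def)
  next
    case 2
    then have odd: "odd m" using cop by simp
    have "(e ^ m)\<^sup>2 = 1" using N s 2 by (simp add: power_mult)
    then consider "e ^ m = 1" | "(- e) ^ m = 1" using odd by (auto simp: power2_eq_1_iff power_minus_odd)
    then obtain k where "e = zeta m ^ k \<or> - e = zeta m ^ k"
      using root_of_unity_eq_zeta_power assms(1) by metis
    then show ?thesis unfolding e_def[symmetric] by (auto simp: minus_equation_iff[of e])
  qed
qed

section \<open>Ideals generated by cyclotomic polynomials\<close>

text \<open>Membership of \<open>c\<close> in the ideal generated by \<open>a\<close> and
  \<open>b\<close>. For \<open>Phis A\<close>, \<open>Phis B\<close> and c = u - v it is the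
  compatibility condition of the Chinese remainder theorem, which is how \<open>glue_values\<close>
  uses it.\<close>

definition comb :: "'a::comm_ring_1 \<Rightarrow> 'a \<Rightarrow> 'a \<Rightarrow> bool" where
  "comb c a b \<longleftrightarrow> (\<exists>x y. c = a * x + b * y)"

lemma combI: "c = a * x + b * y \<Longrightarrow> comb c a b" by (auto simp: comb_def)

lemma comb_commute: "comb c a b \<longleftrightarrow> comb c b a"
  unfolding comb_def by (metis add.commute)

lemma comb_dvd: "a dvd c \<Longrightarrow> comb c a b"
  by (metis add.right_neutral combI dvdE mult_zero_right)

lemma comb_add: "comb c a b \<Longrightarrow> comb d a b \<Longrightarrow> comb (c + d) a b"
  unfolding comb_def
proof (elim exE)
  fix x y x' y' assume "c = a * x + b * y" "d = a * x' + b * y'"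
  then have "c + d = a * (x + x') + b * (y + y')" by (simp add: algebra_simps)
  then show "\<exists>x y. c + d = a * x + b * y" by blast
qed

lemma comb_mult: "comb c a b \<Longrightarrow> comb (c * d) a b"
  unfolding comb_def
proof (elim exE)
  fix x y assume "c = a * x + b * y"
  then have "c * d = a * (x * d) + b * (y * d)" by (simp add: algebra_simps)
  then show "\<exists>x y. c * d = a * x + b * y" by blast
qed

lemma comb_diff: "comb c a b \<Longrightarrow> comb d a b \<Longrightarrow> comb (c - d) a b"
  using comb_add[of c a b "d * (- 1)"] comb_mult[of d a b "- 1"] by simp

lemma comb_1: "comb 1 a b \<Longrightarrow> comb c a b"
  using comb_mult[of 1 a b c] by simp

lemma comb_mult_right:
  assumes "comb c a b" "comb 1 a b'" shows "comb c a (b * b')"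
proof -
  obtain x y where xy: "c = a * x + b * y" using assms by (auto simp: comb_def)
  obtain u v where uv: "1 = a * u + b' * v" using assms by (auto simp: comb_def)
  have "c = c * (a * u + b' * v)" by (simp flip: uv)
  also have "\<dots> = a * (c * u + x * b' * v) + b * b' * (y * v)"
    unfolding xy by (simp add: algebra_simps)
  finally show ?thesis by (rule combI)
qed

text \<open>Multiply \<open>c\<close> by both representations of 1 and expand: in each mixed term,
  one of the two representations of \<open>c\<close> supplies the missing factor.\<close>

lemma comb_cross:
  assumes "comb c a b" "comb c a' b'" "comb 1 a b'" "comb 1 a' b"
  shows "comb c (a * a') (b * b')"
proof -
  obtain x y where 1: "c = a * x + b * y" using assms by (auto simp: comb_def)
  obtain x' y' where 2: "c = a' * x' + b' * y'" using assms by (auto simp: comb_def)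
  obtain u v where 3: "1 = a * u + b' * v" using assms by (auto simp: comb_def)
  obtain u' v' where 4: "1 = a' * u' + b * v'" using assms by (auto simp: comb_def)
  have "c = c * (a * u + b' * v) * (a' * u' + b * v')" by (simp flip: 3 4)
  also have "\<dots> = c * (a * u * a' * u') + c * (a * u * b * v') + c * (b' * v * a' * u') + c * (b' * v * b * v')"
    by (simp add: algebra_simps)
  also have "c * (a * u * b * v') = (a' * x' + b' * y') * (a * u * b * v')" by (simp flip: 2)
  also have "c * (b' * v * a' * u') = (a * x + b * y) * (b' * v * a' * u')" by (simp flip: 1)
  also have "c * (a * u * a' * u') + (a' * x' + b' * y') * (a * u * b * v') +
      (a * x + b * y) * (b' * v * a' * u') + c * (b' * v * b * v') =
    (a * a') * (c * u * u' + x' * u * b * v' + x * b' * v * u') +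
    (b * b') * (y' * a * u * v' + y * v * a' * u' + c * v * v')"
    by (simp add: algebra_simps)
  finally show ?thesis by (rule combI)
qed

lemma comb_1_prod:
  "finite B \<Longrightarrow> (\<And>b. b \<in> B \<Longrightarrow> comb 1 a (F b)) \<Longrightarrow> comb 1 a (prod F B)"
proof (induction B rule: finite_induct)
  case empty then show ?case by (auto intro: combI[of _ _ 0 _ 1])
next
  case (insert b B)
  then show ?case using comb_mult_right[of 1 a "prod F B" "F b"] by (simp add: mult.commute)
qed

lemma Phi_dvd_geometric:
  assumes "a > 0" "a dvd d * c" "\<not> a dvd d"
  shows "Phi a dvd (\<Sum>i<c. monom 1 d ^ i)"
proof -
  have "zeta a ^ d \<noteq> 1" "(zeta a ^ d) ^ c = 1"
    using assms by (simp_all add: zeta_power_eq_1_iff flip: power_mult)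
  then show ?thesis using assms(1) by (simp add: Phi_dvd_iff ev_sum geometric_sum)
qed

lemma geometric_diff_dvd: "(x - 1) dvd (\<Sum>i<c. x ^ i) - of_nat c" for x :: "'a::comm_ring_1"
proof -
  have "(\<Sum>i<c. x ^ i) - of_nat c = (\<Sum>i<c. x ^ i - 1)" by (simp add: sum_subtractf)
  also have "x - 1 dvd \<dots>" by (rule dvd_sum) (simp add: power_diff_1_eq)
  finally show ?thesis .
qed

text \<open>The geometric sum of \<open>c\<close> powers of X^d is a multiple of
  \<open>Phi a\<close> and is congruent to \<open>c\<close> modulo X^d - 1.\<close>

lemma comb_Phi_const:
  assumes "a > 0" "a = d * c" "c > 1" "comb (monom 1 d - 1) (Phi a) y"
  shows "comb (of_nat c) (Phi a) y"
proof -
  let ?S = "\<Sum>i<c. monom 1 d ^ i :: int poly"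
  have "\<not> a dvd d" using assms(1-3) by (auto dest!: dvd_imp_le)
  then have "comb ?S (Phi a) y" using assms by (intro comb_dvd Phi_dvd_geometric) auto
  moreover obtain z where "?S - of_nat c = (monom 1 d - 1) * z"
    using geometric_diff_dvd[of "monom 1 d :: int poly" c] by (metis dvdE)
  then have "comb (?S - of_nat c) (Phi a) y" using assms(4) comb_mult by metis
  ultimately have "comb (?S - (?S - of_nat c)) (Phi a) y" by (rule comb_diff)
  then show ?thesis by simp
qed

lemma comb_1_coprime:
  assumes "comb (of_nat m) a b" "comb (of_nat n) a b" "coprime m n"
  shows "comb 1 a b"
proof -
  obtain x y where "int m * x + int n * y = 1"
    using bezout_int[of "int m" "int n"] assms(3) by (auto simp: mult.commute coprime_int_iff simp del: coprime_int_iff)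
  then have "of_nat m * of_int x + of_nat n * of_int y = (1 :: 'a)"
    by (metis of_int_1 of_int_add of_int_mult of_int_of_nat_eq)
  then show ?thesis using comb_add[OF comb_mult[OF assms(1)] comb_mult[OF assms(2)]] by metis
qed

lemma comb_X_gcd:
  fixes x y :: "int poly"
  assumes "a > 0" "comb (monom 1 a - 1) x y" "comb (monom 1 b - 1) x y"
  shows "comb (monom 1 (gcd a b) - 1) x y"
proof -
  obtain u v where uv: "a * u = b * v + gcd a b" using bezout_nat[of a b] assms(1) by auto
  have pow: "comb (monom 1 (k * l) - 1) x y" if "comb (monom 1 k - 1) x y" for k l
  proof -
    have "monom 1 (k * l) - 1 = (monom 1 k - 1) * (\<Sum>i<l. monom 1 k ^ i :: int poly)"
      by (subst power_diff_1_eq[symmetric]) (simp add: monom_power)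
    then show ?thesis using comb_mult[OF that] by metis
  qed
  have "comb ((monom 1 (a * u) - 1) - (monom 1 (b * v) - 1) * monom 1 (gcd a b)) x y"
    by (intro comb_diff comb_mult pow assms)
  also have "(monom 1 (a * u) - 1) - (monom 1 (b * v) - 1) * monom 1 (gcd a b) =
      (monom 1 (gcd a b) - 1 :: int poly)"
    unfolding uv by (simp add: algebra_simps mult_monom)
  finally show ?thesis .
qed

section \<open>Comaximality of cyclotomic polynomials, and their reduction modulo primes\<close>

definition prime_power_ratio :: "nat \<Rightarrow> nat \<Rightarrow> bool" where
  "prime_power_ratio a b \<longleftrightarrow> (\<exists>p k. prime p \<and> k \<ge> 1 \<and> a = p ^ k * b)"

text \<open>For every prime p dividing \<open>c\<close>, \<open>Phi b\<close> divides X^(c b / p) -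
  1, so p lies in the ideal. A number \<open>c\<close> that is not a prime power has two different
  prime factors.\<close>

lemma comb_1_Phi_dvd:
  assumes "b > 0" "c > 1" "\<not> prime_power_ratio (c * b) b"
  shows "comb 1 (Phi (c * b)) (Phi b)"
proof -
  have I: "comb (of_nat p) (Phi (c * b)) (Phi b)" if p: "prime p" "p dvd c" for p
  proof -
    obtain r where r: "c = p * r" using p(2) by blast
    have "Phi b dvd monom 1 (r * b) - 1" using Phi_dvd_X assms(1) by simp
    then have "comb (monom 1 (r * b) - 1) (Phi (c * b)) (Phi b)"
      by (simp add: comb_commute[of _ "Phi (c * b)"] comb_dvd)
    then show ?thesis
      using assms r prime_gt_1_nat[OF p(1)]
      by (intro comb_Phi_const[of _ "r * b" p]) (auto simp: mult_ac intro!: Nat.gr0I)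
  qed
  obtain p where p: "prime p" "p dvd c" using assms(2) prime_factor_nat by (metis less_irrefl)
  obtain r where r: "c = p ^ multiplicity p c * r" "\<not> p dvd r"
    using multiplicity_decompose'[of c p] assms(2) p(1) by (metis not_prime_unit not_one_less_zero)
  have "multiplicity p c \<ge> 1"
    using p assms(2) by (simp add: Suc_leI prime_multiplicity_gt_zero_iff)
  then have "r \<noteq> 1" using assms(3) p(1) r(1) unfolding prime_power_ratio_def by (metis mult_1_right)
  then obtain q where q: "prime q" "q dvd r" using prime_factor_nat by blast
  then have "coprime p q" using p r by (metis primes_coprime)
  moreover have "q dvd c" using q(2) r(1) by (metis dvd_mult)
  ultimately show ?thesis using comb_1_coprime I p q(1) by blast
qed

text \<open>If neither number divides the other, Euclid's algorithm on the exponents puts X^g - 1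
  into the ideal, where g is their gcd. Since a / g and b / g exceed 1, both lie in the ideal by
  \<open>comb_Phi_const\<close>, and they are coprime.\<close>

lemma comb_1_Phi:
  assumes "a > 0" "b > 0" "a \<noteq> b" "\<not> prime_power_ratio a b" "\<not> prime_power_ratio b a"
  shows "comb 1 (Phi a) (Phi b)"
proof -
  consider "b dvd a" | "a dvd b" | "\<not> b dvd a" "\<not> a dvd b" by blast
  then show ?thesis
  proof cases
    case 1
    then obtain c where c: "a = c * b" by (metis dvdE mult.commute)
    moreover have "c > 1" using assms(1,3) c by (cases "c = 0"; cases "c = 1") auto
    ultimately show ?thesis using comb_1_Phi_dvd assms by blast
  next
    case 2
    then obtain c where c: "b = c * a" by (metis dvdE mult.commute)
    moreover have "c > 1" using assms(2,3) c by (cases "c = 0"; cases "c = 1") auto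
    ultimately show ?thesis using comb_1_Phi_dvd assms comb_commute by blast
  next
    case 3
    define g where "g = gcd a b"
    obtain x y where x: "a = g * x" and y: "b = g * y" unfolding g_def by (metis dvdE gcd_dvd1 gcd_dvd2)
    have "coprime x y" using assms(1)
      by (metis g_def x y div_gcd_coprime gcd_eq_0_iff less_irrefl nonzero_mult_div_cancel_left)
    have "x > 1" using 3 assms(1) x y by (cases "x = 0"; cases "x = 1") auto
    have "y > 1" using 3 assms(2) x y by (cases "y = 0"; cases "y = 1") auto
    have A: "comb (monom 1 a - 1) (Phi a) (Phi b)"
      by (rule comb_dvd) (simp add: Phi_dvd_X assms)
    have B: "comb (monom 1 b - 1) (Phi a) (Phi b)"
      unfolding comb_commute[of _ "Phi a"] by (rule comb_dvd) (simp add: Phi_dvd_X assms)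
    have G: "comb (monom 1 g - 1) (Phi a) (Phi b)"
      unfolding g_def by (rule comb_X_gcd[OF assms(1) A B])
    have "comb (of_nat x) (Phi a) (Phi b)"
      by (rule comb_Phi_const[OF assms(1) x \<open>x > 1\<close> G])
    moreover have "comb (of_nat y) (Phi a) (Phi b)"
      using comb_Phi_const[OF assms(2) y \<open>y > 1\<close>] G comb_commute by blast
    ultimately show ?thesis using comb_1_coprime \<open>coprime x y\<close> by blast
  qed
qed

text \<open>The quotient of X^(p n) - 1 by X^n - 1 is congruent to p modulo X^n - 1, and it is
  \<open>Phi (p * n)\<close> times factors comaximal with \<open>Phi n\<close>; these can be removed
  modulo \<open>Phi n\<close>. The cases p dividing n and p not dividing n need no
  distinction.\<close>

lemma Phi_mod_prime:
  assumes "prime p" "n > 0"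
  shows "comb (Phi (p * n)) [:int p:] (Phi n)"
proof -
  let ?E = "\<Sum>i<p. monom 1 n ^ i :: int poly"
  have p: "p > 1" using prime_gt_1_nat assms by blast
  have XE: "monom 1 (p * n) - 1 = (monom 1 n - 1) * ?E"
    by (subst power_diff_1_eq[symmetric]) (simp add: monom_power mult.commute)
  have "lead_coeff ?E = 1"
    using lead_coeff_X_minus_1[of n] lead_coeff_X_minus_1[of "p * n"] assms(2) p
    by (simp add: XE lead_coeff_mult del: coeff_diff)
  moreover have "?E dvd monom 1 (p * n) - 1" by (simp only: XE dvd_triv_right)
  moreover define A where "A = {d. d > 0 \<and> d dvd p * n \<and> ev (zeta d) ?E = 0}"
  ultimately have EA: "?E = Phis A" unfolding A_def using assms p by (intro monic_factor_of_X) auto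
  have fin: "finite A"
    by (rule finite_subset[of _ "{..p * n}"]) (use assms p in \<open>auto simp: A_def dest: dvd_imp_le\<close>)
  have ndvd: "\<not> d dvd n" if "d \<in> A" for d
  proof
    assume "d dvd n"
    then have "zeta d ^ n = 1" using that by (simp add: A_def zeta_power_eq_1_iff)
    then show False using that p by (simp add: A_def ev_sum)
  qed
  have "Phi (p * n) dvd ?E"
    using assms p by (intro Phi_dvd_geometric) (auto simp: mult.commute dest!: dvd_imp_le)
  then have "p * n \<in> A" using assms p by (simp add: A_def Phi_dvd_iff)
  then have EG: "?E = Phi (p * n) * Phis (A - {p * n})"
    unfolding EA Phis_def using fin by (simp add: prod.remove)
  have "comb 1 (Phi n) (Phis (A - {p * n}))"
    unfolding Phis_def
  proof (rule comb_1_prod)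
    fix d assume d: "d \<in> A - {p * n}"
    then have d0: "d > 0" "d dvd p * n" by (auto simp: A_def)
    show "comb 1 (Phi n) (Phi d)"
    proof (rule comb_1_Phi)
      show "n \<noteq> d" "\<not> prime_power_ratio n d" using ndvd[of d] d by (auto simp: prime_power_ratio_def)
      show "\<not> prime_power_ratio d n"
      proof
        assume "prime_power_ratio d n"
        then obtain c where c: "d = c * n" by (auto simp: prime_power_ratio_def)
        then have "c dvd p" using d0 assms(2) by simp
        then have "c = 1 \<or> c = p" using assms(1) prime_nat_iff by blast
        then show False using c d ndvd[of d] by auto
      qed
    qed (use assms d0 in auto)
  qed (use fin in auto)
  then obtain x y where xy: "1 = Phi n * x + Phis (A - {p * n}) * y" by (auto simp: comb_def)
  obtain z where "?E - of_nat p = (monom 1 n - 1) * z"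
    using geometric_diff_dvd[of "monom 1 n :: int poly" p] by (metis dvdE)
  moreover obtain z' where "monom 1 n - 1 = Phi n * z'"
    using Phi_dvd_X[OF assms(2) dvd_refl] by blast
  ultimately have E: "?E = [:int p:] + Phi n * (z' * z)"
    by (simp add: of_nat_poly algebra_simps)
  have "Phi (p * n) = Phi (p * n) * (Phi n * x + Phis (A - {p * n}) * y)" by (simp flip: xy)
  also have "\<dots> = Phi n * (Phi (p * n) * x) + ?E * y" unfolding EG by (simp add: algebra_simps)
  also have "\<dots> = [:int p:] * y + Phi n * (Phi (p * n) * x + z' * z * y)"
    unfolding E by (simp add: algebra_simps)
  finally show ?thesis by (rule combI)
qed

lemma Phi_mod_prime_power:
  assumes "prime p" "n > 0" "k \<ge> 1"
  shows "comb (Phi (p ^ k * n)) [:int p:] (Phi n)"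
  using assms(3)
proof (induction k rule: dec_induct)
  case base then show ?case using Phi_mod_prime assms by simp
next
  case (step k)
  have "p ^ k * n > 0" using assms prime_gt_0_nat by simp
  then have "comb (Phi (p * (p ^ k * n))) [:int p:] (Phi (p ^ k * n))"
    by (rule Phi_mod_prime[OF assms(1)])
  then obtain x y where "Phi (p ^ Suc k * n) = [:int p:] * x + Phi (p ^ k * n) * y"
    by (auto simp: comb_def mult.assoc simp del: mult_pCons_left)
  moreover obtain x' y' where "Phi (p ^ k * n) = [:int p:] * x' + Phi n * y'"
    using step.IH by (auto simp: comb_def)
  ultimately have "Phi (p ^ Suc k * n) = [:int p:] * (x + x' * y) + Phi n * (y' * y)"
    by (simp add: algebra_simps smult_add_right)
  then show ?case by (rule combI)
qed

lemma ev_Phi_prime_power: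
  assumes "prime p" "n > 0" "k \<ge> 1"
  obtains A where "ev (zeta n) (Phi (p ^ k * n)) = of_nat p * ev (zeta n) A"
proof -
  obtain A B where "Phi (p ^ k * n) = [:int p:] * A + Phi n * B"
    using Phi_mod_prime_power[OF assms] by (auto simp: comb_def)
  then have "ev (zeta n) (Phi (p ^ k * n)) = of_nat p * ev (zeta n) A" using assms(2) by simp
  then show ?thesis using that by blast
qed

section \<open>Congruences between values at roots of unity\<close>

text \<open>Both sides are the value at 1 of (X^r - 1) / (X - 1).\<close>

lemma prod_one_minus_roots:
  fixes w :: complex
  assumes "r > 0" "w ^ r = 1" "\<And>j. 0 < j \<Longrightarrow> j < r \<Longrightarrow> w ^ j \<noteq> 1"
  shows "(\<Prod>j\<in>{1..<r}. 1 - w ^ j) = of_nat r"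
proof -
  let ?P = "\<Prod>j\<in>{1..<r}. [:- (w ^ j), 1:]" and ?Q = "\<Sum>i<r. monom 1 i :: complex poly"
  let ?A = "(\<lambda>j. w ^ j) ` {1..<r}"
  have w0: "w \<noteq> 0" using assms(1,2) by (auto simp: zero_power)
  have inj: "inj_on (\<lambda>j. w ^ j) {1..<r}"
  proof (rule linorder_inj_onI)
    fix i j assume ij: "i < j" "i \<in> {1..<r}" "j \<in> {1..<r}"
    show "w ^ i \<noteq> w ^ j"
    proof
      assume "w ^ i = w ^ j"
      also have "w ^ j = w ^ i * w ^ (j - i)" using ij by (simp flip: power_add)
      finally have "w ^ (j - i) = 1" using w0 by simp
      then show False using assms(3)[of "j - i"] ij
        by (metis atLeastLessThan_iff diff_le_self less_le_trans linorder_not_less zero_less_diff)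
    qed
  qed auto
  have dP: "degree ?P = r - 1" by (subst degree_prod_eq_sum_degree) auto
  have lP: "lead_coeff ?P = 1" by (simp add: lead_coeff_prod)
  have "?P = ?Q"
  proof (rule poly_eqI_degree_lead_coeff[where n = "r - 1" and A = ?A])
    have "coeff ?Q (r - 1) = (\<Sum>i<r. if i = r - 1 then 1 else 0)"
      unfolding coeff_sum by (intro sum.cong) auto
    also have "\<dots> = 1" using assms(1) by simp
    finally show "coeff ?P (r - 1) = coeff ?Q (r - 1)" using lP unfolding dP by simp
    show "r - 1 \<le> card ?A" by (subst card_image[OF inj]) simp
    show "degree ?P \<le> r - 1" using dP by simp
    show "degree ?Q \<le> r - 1"
      by (rule degree_sum_le) (auto intro: order.trans[OF degree_monom_le])
    fix z assume "z \<in> ?A"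
    then obtain j where j: "j \<in> {1..<r}" "z = w ^ j" by blast
    have "poly ?P z = 0" using j by (auto simp: poly_prod)
    moreover have "z \<noteq> 1" "z ^ r = 1"
      using assms j by (auto simp flip: power_mult simp: mult.commute[of j]) (simp add: power_mult)
    then have "poly ?Q z = 0" by (simp add: poly_sum poly_monom geometric_sum)
    ultimately show "poly ?P z = poly ?Q z" by simp
  qed
  then have "poly ?P 1 = poly ?Q 1" by simp
  then show ?thesis by (simp add: poly_prod poly_sum poly_monom)
qed

text \<open>If the value has order r, each factor 1 - w^j with 0 < j < r is a multiple of 1 - w,
  hence of \<open>p\<close>, while their product is r. So p^(r-1) divides r, which leaves r = 1 or p
  = r = 2.\<close>

lemma root_of_unity_cong_1:
  assumes "n > 0" "K > 0" "ev (zeta n) y ^ K = 1" "prime p"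
    and "1 - ev (zeta n) y = of_nat p * ev (zeta n) v"
  shows "ev (zeta n) y = 1 \<or> p = 2 \<and> ev (zeta n) y = - 1"
proof -
  define w where "w = ev (zeta n) y"
  define r where "r = (LEAST r. r > 0 \<and> w ^ r = 1)"
  have r: "r > 0 \<and> w ^ r = 1" unfolding r_def w_def by (rule LeastI[of _ K]) (use assms in simp)
  have min: "w ^ j \<noteq> 1" if "0 < j" "j < r" for j
    using not_less_Least[of j "\<lambda>r. r > 0 \<and> w ^ r = 1"] that unfolding r_def by blast
  have "1 - w ^ j = of_nat p * ev (zeta n) (v * (\<Sum>i<j. y ^ i))" for j
    by (simp add: one_diff_power_eq w_def assms(5) ev_sum mult.assoc)
  then have "of_nat r = (\<Prod>j\<in>{1..<r}. of_nat p * ev (zeta n) (v * (\<Sum>i<j. y ^ i)))"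
    using prod_one_minus_roots[of r w] r min by simp
  also have "\<dots> = of_nat p ^ (r - 1) * ev (zeta n) (\<Prod>j\<in>{1..<r}. v * (\<Sum>i<j. y ^ i))"
    by (simp add: prod.distrib ev_prod)
  finally have "of_int (int r) = of_int (int (p ^ (r - 1))) * ev (zeta n) (\<Prod>j\<in>{1..<r}. v * (\<Sum>i<j. y ^ i))"
    by simp
  then have "int (p ^ (r - 1)) dvd int r"
    by (rule int_dvd_at_root_of_unity[rotated 2]) (use assms(1) in auto)
  then have le: "p ^ (r - 1) \<le> r" using r by (simp only: of_nat_dvd_iff dvd_imp_le)
  have p2: "p \<ge> 2" using assms(4) by (rule prime_ge_2_nat)
  have "r \<le> 2"
  proof (rule ccontr)
    assume "\<not> r \<le> 2"
    then have "3 \<le> r" by simp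
    have "r < 2 ^ (r - 1)" using \<open>3 \<le> r\<close>
    proof (induction r rule: dec_induct)
      case (step k)
      then have "Suc k < 2 * 2 ^ (k - 1)" by linarith
      also have "\<dots> = 2 ^ (Suc k - 1)" using step by (cases k) simp_all
      finally show ?case .
    qed simp
    also have "\<dots> \<le> p ^ (r - 1)" using p2 by (rule power_mono) simp
    finally show False using le by simp
  qed
  then consider "r = 1" | "r = 2" using r by linarith
  then show ?thesis
  proof cases
    case 1 then show ?thesis using r by (simp add: w_def)
  next
    case 2
    then have "p = 2" using le p2 by simp
    moreover have "w\<^sup>2 = 1" "w \<noteq> 1" using r 2 min[of 1] by auto
    ultimately show ?thesis by (auto simp: w_def power2_eq_1_iff)
  qed
qed

text \<open>In \<open>\<int>[zeta n]\<close>, the value of \<open>Phi (p ^ j * n)\<close> is divisible by \<open>p\<close>, so the two values of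
  \<open>f\<close> below are congruent modulo \<open>p\<close>.\<close>

lemma edge_congruence:
  assumes p: "prime p" "n > 0" "j \<ge> 1"
    and s: "s \<in> {1, - 1}" "s' \<in> {1, - 1}"
    and f: "ev (zeta (p ^ j * n)) f = of_int s * zeta (p ^ j * n) ^ k" "ev (zeta n) f = of_int s' * zeta n ^ k'"
  shows "of_int s * zeta n ^ k = of_int s' * zeta n ^ k' \<or>
    p = 2 \<and> of_int s * zeta n ^ k = - (of_int s' * zeta n ^ k')"
proof -
  let ?m = "p ^ j * n"
  have m0: "?m > 0" using p prime_gt_0_nat by simp
  have "ev (zeta ?m) (f - monom s k) = 0" using f by simp
  then obtain g where g: "f - monom s k = Phi ?m * g" using Phi_dvd_iff[OF m0] by blast
  obtain A where A: "ev (zeta n) (Phi ?m) = of_nat p * ev (zeta n) A"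
    using ev_Phi_prime_power[OF p] .
  \<comment> \<open>The quotient of the two monomials: \<open>s\<close> is its own inverse, and the
    exponent \<open>(n - 1) * k\<close> stands for -k modulo \<open>n\<close>.\<close>
  define y where "y = monom (s * s') (k' + (n - 1) * k)"
  have z: "zeta n ^ k * zeta n ^ ((n - 1) * k) = 1"
  proof -
    have "k + (n - 1) * k = n * k" using p(2) by (cases n) simp_all
    then have "zeta n ^ k * zeta n ^ ((n - 1) * k) = (zeta n ^ n) ^ k"
      by (simp only: power_mult[symmetric] power_add[symmetric])
    then show ?thesis using p(2) by simp
  qed
  have "ev (zeta n) (f - monom s k) = of_nat p * ev (zeta n) (A * g)" unfolding g by (simp add: A)
  then have e: "of_int s' * zeta n ^ k' - of_int s * zeta n ^ k = of_nat p * ev (zeta n) (A * g)"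
    using f(2) by simp
  have y: "ev (zeta n) y = of_int s * zeta n ^ ((n - 1) * k) * (of_int s' * zeta n ^ k')"
    by (simp add: y_def power_add mult_ac)
  have ss: "of_int s * of_int s = (1 :: complex)" "of_int s' * of_int s' = (1 :: complex)"
    using s by auto
  have one: "of_int s * zeta n ^ ((n - 1) * k) * (of_int s * zeta n ^ k) = 1"
    using z ss by (simp add: mult_ac)
  have "1 - ev (zeta n) y =
      - (of_int s * zeta n ^ ((n - 1) * k) * (of_int s' * zeta n ^ k' - of_int s * zeta n ^ k))"
    unfolding right_diff_distrib one y by simp
  also have "\<dots> = of_nat p * ev (zeta n) (- (monom s ((n - 1) * k) * (A * g)))"
    unfolding e by simp
  finally have h: "1 - ev (zeta n) y = of_nat p * ev (zeta n) (- (monom s ((n - 1) * k) * (A * g)))" .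
  have "ev (zeta n) y ^ (2 * n) = 1"
  proof -
    have "(of_int s * of_int s') ^ 2 = (1 :: complex)" using s by auto
    then have "(of_int s * of_int s') ^ (2 * n) = (1 :: complex)" by (simp only: power_mult power_one)
    moreover have "(zeta n ^ l) ^ (2 * n) = 1" for l
      using p(2) by (metis mult.commute power_mult power_one zeta_power_self)
    ultimately show ?thesis by (simp add: y_def power_mult_distrib)
  qed
  then have "ev (zeta n) y = 1 \<or> p = 2 \<and> ev (zeta n) y = - 1"
    using root_of_unity_cong_1[OF p(2) _ _ p(1) h, of "2 * n"] p(2) by simp
  moreover have "of_int s * zeta n ^ k * ev (zeta n) y = of_int s' * zeta n ^ k'"
    unfolding y using one by (simp add: mult_ac)
  ultimately show ?thesis
    by (metis add.inverse_inverse mult.right_neutral mult_minus1_right)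
qed

text \<open>If \<open>d' \<noteq> d''\<close>, then \<open>f - d\<close> is divisible by \<open>Phi\<close> of the top element and of exactly one of
  the other two, so its value \<open>\<plusminus> 2\<close> at the remaining one would be \<open>2\<close> times a non-unit.\<close>

lemma chain_congruence:
  assumes n: "n > 0" "i \<ge> 1" "j \<ge> 1"
    and d: "{d, d', d''} \<subseteq> {1, - 1 :: int}"
    and f: "ev (zeta (2 ^ i * (2 ^ j * n))) f = of_int d" "ev (zeta (2 ^ j * n)) f = of_int d'"
      "ev (zeta n) f = of_int d''"
  shows "d' = d''"
proof (rule ccontr)
  assume ne: "d' \<noteq> d''"
  let ?m = "2 ^ j * n" and ?l = "2 ^ i * (2 ^ j * n)"
  have m0: "?m > 0" "?l > 0" using n by auto
  have "?l = 2 ^ (i + j) * n" by (simp add: power_add)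
  then obtain A where A: "ev (zeta n) (Phi ?l) = of_nat 2 * ev (zeta n) A"
    using ev_Phi_prime_power[of 2 n "i + j"] n by (metis le_add1 order.trans two_is_prime_nat)
  obtain B where B: "ev (zeta n) (Phi ?m) = of_nat 2 * ev (zeta n) B"
    using ev_Phi_prime_power[of 2 n j] n by (metis two_is_prime_nat)
  obtain C where C: "ev (zeta ?m) (Phi ?l) = of_nat 2 * ev (zeta ?m) C"
    using ev_Phi_prime_power[of 2 ?m i] n m0 by (metis two_is_prime_nat)
  have p: "2 ^ i > (1::nat)" "2 ^ j > (1::nat)" using n by (simp_all add: one_less_power del: One_nat_def)
  have ne_l: "?l \<noteq> ?m" "?l \<noteq> n" "?m \<noteq> n" using p n by auto
  consider "d = d'" | "d = d''" using d ne by auto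
  then show False
  proof cases
    case 1
    have "Phis {?l, ?m} dvd f - [:d:]"
      by (rule Phis_dvdI) (use m0 f 1 in \<open>auto simp: Phi_dvd_iff\<close>)
    then obtain g where g: "f - [:d:] = Phi ?l * Phi ?m * g"
      using ne_l by (auto simp: Phis_def)
    have "of_int (d'' - d) = ev (zeta n) (f - [:d:])" using f by simp
    also have "\<dots> = of_int 4 * ev (zeta n) (A * B * g)" unfolding g by (simp add: A B)
    finally have "4 dvd d'' - d"
      by (rule int_dvd_at_root_of_unity[of n "zeta n", rotated 2]) (use n in simp_all)
    then show False using d ne 1 by auto
  next
    case 2
    have "Phis {?l, n} dvd f - [:d:]"
      by (rule Phis_dvdI) (use m0 n f 2 in \<open>auto simp: Phi_dvd_iff\<close>)
    then obtain g where g: "f - [:d:] = Phi ?l * Phi n * g"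
      using ne_l by (auto simp: Phis_def)
    obtain e where e: "d' - d = 2 * e" "e \<in> {1, - 1}" using d ne 2 by (cases "d = 1") (auto intro: that[of 1] that[of "- 1"])
    have "of_int (d' - d) = ev (zeta ?m) (f - [:d:])" using f by simp
    also have "\<dots> = 2 * ev (zeta ?m) (C * Phi n * g)" unfolding g by (simp add: C)
    \<comment> \<open>Passing from \<open>zeta ?m\<close> to \<open>zeta n\<close> adds a multiple
      of \<open>Phi ?m\<close>, whose value at \<open>zeta n\<close> is divisible by 2; as
      \<open>Phi n\<close> vanishes there, the odd number \<open>e\<close> would be even.\<close>
    finally have "ev (zeta ?m) (C * Phi n * g - [:e:]) = 0" using e by simp
    then obtain h where "C * Phi n * g - [:e:] = Phi ?m * h" using Phi_dvd_iff[OF m0(1)] by blast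
    then have "ev (zeta n) (C * Phi n * g - [:e:]) = ev (zeta n) (Phi ?m * h)" by simp
    then have "of_int (- e) = of_int 2 * ev (zeta n) (B * h)" using n by (simp add: B)
    then have "2 dvd - e"
      by (rule int_dvd_at_root_of_unity[of n "zeta n", rotated 2]) (use n in simp_all)
    then show False using e by auto
  qed
qed

section \<open>Graph components and closed vertex sets\<close>

text \<open>A union of components. Closed sets replace arguments with paths: invariants along edges
  define closed sets, and a component lies inside every closed set that it meets.\<close>

definition closed_in :: "nat set \<Rightarrow> (nat \<times> nat) set \<Rightarrow> nat set \<Rightarrow> bool" where
  "closed_in V E A \<longleftrightarrow> A \<subseteq> V \<and> (\<forall>(a, b)\<in>E. a \<in> A \<longleftrightarrow> b \<in> A)"

lemma closed_inD: "closed_in V E A \<Longrightarrow> (a, b) \<in> E \<Longrightarrow> a \<in> A \<longleftrightarrow> b \<in> A"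
  by (auto simp: closed_in_def)

lemma closed_in_subset: "closed_in V E A \<Longrightarrow> A \<subseteq> V"
  by (simp add: closed_in_def)

lemma closed_in_Diff: "E \<subseteq> V \<times> V \<Longrightarrow> closed_in V E A \<Longrightarrow> closed_in V E (V - A)"
  by (fastforce simp: closed_in_def)

lemma closed_in_Un: "closed_in V E A \<Longrightarrow> closed_in V E B \<Longrightarrow> closed_in V E (A \<union> B)"
  by (fastforce simp: closed_in_def)

abbreviation component_rel :: "nat set \<Rightarrow> (nat \<times> nat) set \<Rightarrow> (nat \<times> nat) set" where
  "component_rel V E \<equiv> {(a, b). a \<in> V \<and> b \<in> V \<and> (a, b) \<in> (E \<union> E\<inverse>)\<^sup>*}"

lemma equiv_component_rel: "equiv V (component_rel V E)"
proof (rule equivI)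
  show "component_rel V E \<subseteq> V \<times> V" by auto
  show "refl_on V (component_rel V E)" by (auto simp: refl_on_def)
  have "sym ((E \<union> E\<inverse>)\<^sup>*)" by (intro sym_rtrancl sym_Un_converse)
  then show "sym (component_rel V E)" by (auto simp: sym_def)
  show "trans (component_rel V E)" by (auto simp: trans_def intro: rtrancl_trans)
qed

lemma component_cover:
  assumes "x \<in> V" obtains C where "C \<in> graph_components V E" "x \<in> C"
  using that[OF _ equiv_class_self[OF equiv_component_rel assms]] assms
  unfolding graph_components_def by (blast intro: quotientI)

lemma component_disjoint:
  assumes "C \<in> graph_components V E" "D \<in> graph_components V E" "x \<in> C" "x \<in> D"
  shows "C = D"
  using quotient_disj[OF equiv_component_rel assms(1,2)[unfolded graph_components_def]] assms(3,4)
  by blast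

lemma component_nonempty: "C \<in> graph_components V E \<Longrightarrow> C \<noteq> {}"
  unfolding graph_components_def using in_quotient_imp_non_empty[OF equiv_component_rel] by blast

lemma component_subset: "C \<in> graph_components V E \<Longrightarrow> C \<subseteq> V"
  unfolding graph_components_def using in_quotient_imp_subset[OF equiv_component_rel] by blast

lemma component_closed:
  assumes "E \<subseteq> V \<times> V" "C \<in> graph_components V E" shows "closed_in V E C"
proof -
  obtain x where x: "x \<in> V" "C = component_rel V E `` {x}"
    using assms(2) by (auto simp: graph_components_def elim: quotientE)
  have "b \<in> C" if "a \<in> C" "(a, b) \<in> E \<union> E\<inverse>" for a b
    using that assms(1) x by (auto intro: rtrancl_into_rtrancl)
  then show ?thesis using component_subset[OF assms(2)] unfolding closed_in_def by blast
qed

lemma component_minimal: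
  assumes "C \<in> graph_components V E" "closed_in V E A" "x \<in> C" "x \<in> A"
  shows "C \<subseteq> A"
proof
  fix y assume "y \<in> C"
  obtain z where "C = component_rel V E `` {z}" "z \<in> V"
    using assms(1) by (auto simp: graph_components_def elim: quotientE)
  then have "(x, z) \<in> (E \<union> E\<inverse>)\<^sup>*" "(z, y) \<in> (E \<union> E\<inverse>)\<^sup>*"
    using \<open>y \<in> C\<close> assms(3) sym_rtrancl[OF sym_Un_converse[of E]] by (auto dest: symD)
  then have "(x, y) \<in> (E \<union> E\<inverse>)\<^sup>*" by (rule rtrancl_trans)
  then show "y \<in> A" using assms(4)
    by (induction rule: rtrancl_induct) (auto dest: closed_inD[OF assms(2)])
qed

lemma component_induct:
  assumes "C \<in> graph_components V E" "E \<subseteq> V \<times> V" "x \<in> C" "Q x"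
    and "\<And>a b. (a, b) \<in> E \<Longrightarrow> Q a \<longleftrightarrow> Q b" and "y \<in> C"
  shows "Q y"
proof -
  have "closed_in V E {v \<in> V. Q v}" using assms(2,5) by (fastforce simp: closed_in_def)
  then have "C \<subseteq> {v \<in> V. Q v}"
    using component_minimal[OF assms(1)] component_subset[OF assms(1)] assms(3,4) by blast
  then show ?thesis using assms(6) by blast
qed

lemma finite_components: "finite V \<Longrightarrow> finite (graph_components V E)"
  by (meson PowI component_subset finite_Pow_iff finite_subset subsetI)

lemma connected_iff:
  assumes "E \<subseteq> V \<times> V"
  shows "card (graph_components V E) = 1 \<longleftrightarrow>
    V \<noteq> {} \<and> (\<forall>A. closed_in V E A \<longrightarrow> A = {} \<or> A = V)"
proof
  assume "card (graph_components V E) = 1"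
  then obtain C where C: "graph_components V E = {C}" by (rule card_1_singletonE)
  have "V \<subseteq> C"
  proof
    fix x assume "x \<in> V"
    then obtain D where "D \<in> graph_components V E" "x \<in> D" by (rule component_cover)
    then show "x \<in> C" using C by simp
  qed
  moreover have C': "C \<in> graph_components V E" using C by simp
  ultimately have CV: "C = V" using component_subset by blast
  have "A = V" if "closed_in V E A" "x \<in> A" for A x
    using component_minimal[OF C' that(1), of x] that CV by (auto simp: closed_in_def)
  then show "V \<noteq> {} \<and> (\<forall>A. closed_in V E A \<longrightarrow> A = {} \<or> A = V)"
    using component_nonempty[OF C'] CV by blast
next
  assume *: "V \<noteq> {} \<and> (\<forall>A. closed_in V E A \<longrightarrow> A = {} \<or> A = V)"
  then have all: "C = V" if "C \<in> graph_components V E" for C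
    using component_closed[OF assms that] component_nonempty[OF that] by blast
  obtain C where "C \<in> graph_components V E" using * component_cover by (metis ex_in_conv)
  then have "graph_components V E = {V}" using all by blast
  then show "card (graph_components V E) = 1" by simp
qed

section \<open>The divisibility graph\<close>

lemma p_edges_subset: "p_edges M p \<subseteq> M \<times> M" by (auto simp: p_edges_def)

lemma edges_subset: "edges M \<subseteq> M \<times> M" by (auto simp: edges_def p_edges_def)

lemma p_edgesE:
  assumes "(m, n) \<in> p_edges M p"
  obtains k where "prime p" "k \<ge> 1" "m = p ^ k * n" "m \<in> M" "n \<in> M"
  using assms by (auto simp: p_edges_def)

locale pos_set =
  fixes M :: "nat set"
  assumes finite_M: "finite M" and pos_M: "m \<in> M \<Longrightarrow> m > 0"
begin

text \<open>Edges join only neighbours within \<open>M\<close>. An element between the two numbers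
  in the divisibility order is itself a power of \<open>p\<close> times \<open>n\<close>, so the
  ratio splits there.\<close>

lemma prime_ratio_trancl:
  assumes "prime p" "n \<in> M" "p ^ k * n \<in> M" "k \<ge> 1"
  shows "(p ^ k * n, n) \<in> (p_edges M p)\<^sup>+"
  using assms(2-)
proof (induction k arbitrary: n rule: less_induct)
  case (less k)
  have p: "p > 1" using prime_gt_1_nat assms(1) by blast
  show ?case
  proof (cases "\<exists>m3\<in>M - {p ^ k * n, n}. n dvd m3 \<and> m3 dvd p ^ k * n")
    case True
    then obtain m3 where m3: "m3 \<in> M" "m3 \<noteq> p ^ k * n" "m3 \<noteq> n" "n dvd m3" "m3 dvd p ^ k * n"
      by blast
    obtain c where c: "m3 = c * n" using m3 by (metis dvdE mult.commute)
    then have "c dvd p ^ k" using m3 pos_M[OF less.prems(1)] by simp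
    then obtain i where i: "i \<le> k" "c = p ^ i" using divides_primepow_nat[OF assms(1)] by blast
    have ik: "i < k" "i \<ge> 1" using i c m3 by (auto simp: order_le_less intro!: Suc_leI Nat.gr0I)
    have e: "p ^ k * n = p ^ (k - i) * m3" using ik by (simp add: c i(2) flip: mult.assoc power_add)
    have "(p ^ (k - i) * m3, m3) \<in> (p_edges M p)\<^sup>+"
      using less.IH[of "k - i" m3] ik m3 less.prems e by simp
    moreover have "(m3, n) \<in> (p_edges M p)\<^sup>+"
      using less.IH[of i n] ik m3 less.prems c i by simp
    ultimately show ?thesis unfolding e by (rule trancl_trans)
  next
    case False
    then have "(p ^ k * n, n) \<in> p_edges M p" unfolding p_edges_def using less.prems assms(1) by blast
    then show ?thesis by blast
  qed
qed

lemma p_edges_disjoint: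
  assumes "e \<in> p_edges M p" "e \<in> p_edges M q" shows "p = q"
proof -
  obtain m n where e: "e = (m, n)" by force
  obtain k where k: "prime p" "k \<ge> 1" "m = p ^ k * n" "n \<in> M" using assms e by (auto elim: p_edgesE)
  obtain l where l: "prime q" "l \<ge> 1" "m = q ^ l * n" using assms e by (auto elim: p_edgesE)
  have "p ^ k = q ^ l" using k l pos_M by (metis mult_cancel2 less_irrefl)
  moreover have "p dvd p ^ k" using k by simp
  ultimately have "p dvd q ^ l" by simp
  then show ?thesis using k(1) l(1) by (meson prime_dvd_power primes_dvd_imp_eq)
qed

lemma edges_Diff_iff: "(a, b) \<in> edges M - p_edges M p \<longleftrightarrow> (\<exists>q. q \<noteq> p \<and> (a, b) \<in> p_edges M q)"
proof
  assume "(a, b) \<in> edges M - p_edges M p"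
  then show "\<exists>q. q \<noteq> p \<and> (a, b) \<in> p_edges M q" by (auto simp: edges_def)
next
  assume "\<exists>q. q \<noteq> p \<and> (a, b) \<in> p_edges M q"
  then show "(a, b) \<in> edges M - p_edges M p" using p_edges_disjoint by (auto simp: edges_def)
qed

lemma multiplicity_p_edge:
  assumes "(m, n) \<in> p_edges M p" shows "multiplicity p n < multiplicity p m"
proof -
  obtain k where k: "prime p" "k \<ge> 1" "m = p ^ k * n" "n \<in> M" using assms by (rule p_edgesE)
  then have "multiplicity p m = k + multiplicity p n"
    using pos_M[OF k(4)] prime_gt_0_nat[OF k(1)]
    by (simp add: prime_elem_multiplicity_mult_distrib multiplicity_same_power)
  then show ?thesis using k(2) by simp
qed

lemma multiplicity_other_edge:
  assumes "(m, n) \<in> p_edges M q" "q \<noteq> p" "prime p" shows "multiplicity p m = multiplicity p n"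
proof -
  obtain k where k: "prime q" "k \<ge> 1" "m = q ^ k * n" "n \<in> M" using assms(1) by (rule p_edgesE)
  have "multiplicity p (q ^ k) = 0"
    using k(1) assms by (intro not_dvd_imp_multiplicity_0) (metis prime_dvd_power primes_dvd_imp_eq)
  then show ?thesis
    using pos_M[OF k(4)] prime_gt_0_nat[OF k(1)] assms(3) k(3)
    by (simp add: prime_elem_multiplicity_mult_distrib)
qed

lemma multiplicity_plane:
  assumes "P \<in> p_planes M p" "prime p" "m \<in> P" "n \<in> P"
  shows "multiplicity p m = multiplicity p n"
proof -
  have "edges M - p_edges M p \<subseteq> M \<times> M" using edges_subset by blast
  from component_induct[OF assms(1)[unfolded p_planes_def] this assms(3),
      of "\<lambda>x. multiplicity p m = multiplicity p x" n]
  show ?thesis using assms(2,4) multiplicity_other_edge unfolding edges_Diff_iff by metis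
qed

lemma closed_in_ratio:
  assumes "closed_in M (edges M) A" "prime p" "k \<ge> 1" "n \<in> M" "p ^ k * n \<in> M"
  shows "p ^ k * n \<in> A \<longleftrightarrow> n \<in> A"
proof -
  have "x \<in> A \<longleftrightarrow> y \<in> A" if "(x, y) \<in> (p_edges M p)\<^sup>+" for x y
    using that
    by (induction rule: trancl_induct) (use closed_inD[OF assms(1)] in \<open>auto simp: edges_def\<close>)
  then show ?thesis using prime_ratio_trancl assms by blast
qed

lemma closed_in_plane:
  assumes "P \<in> p_planes M p" shows "closed_in M (edges M - p_edges M p) P"
  using assms edges_subset unfolding p_planes_def by (intro component_closed) auto

text \<open>The only prime power ratios between a highest p-plane and the other vertices are powers
  of \<open>p\<close>, with the larger number in the plane. This controls the ideal of the two
  products of cyclotomic polynomials.\<close>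

lemma highest_plane_ratio:
  assumes "highest_p_plane M p P" "prime q" "k \<ge> 1" "m \<in> P" "n \<in> M - P"
  shows "m \<noteq> q ^ k * n \<or> q = p" "n \<noteq> q ^ k * m"
proof -
  have P: "P \<in> p_planes M p" using assms(1) by (simp add: highest_p_plane_def)
  then have m: "m \<in> M" using assms(4) component_subset unfolding p_planes_def by blast
  have edge: "x \<in> P \<longleftrightarrow> y \<in> P" if "(x, y) \<in> p_edges M q" "q \<noteq> p" for x y
    using closed_inD[OF closed_in_plane[OF P], of x y] that edges_Diff_iff by blast
  have eq: "x \<in> P \<longleftrightarrow> y \<in> P" if "(x, y) \<in> (p_edges M q)\<^sup>+" "q \<noteq> p" for x y
    using that(1) by (induction rule: trancl_induct) (use that(2) edge in blast)+
  show "m \<noteq> q ^ k * n \<or> q = p"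
    using eq prime_ratio_trancl[OF assms(2) _ _ assms(3), of n] assms(4,5) m by blast
  show "n \<noteq> q ^ k * m"
  proof
    assume n: "n = q ^ k * m"
    have t: "(n, m) \<in> (p_edges M q)\<^sup>+"
      using prime_ratio_trancl[OF assms(2) m _ assms(3)] n assms(5) by auto
    then have "q = p" using eq assms(4,5) by blast
    then show False using t assms(1,4) unfolding highest_p_plane_def by (metis tranclD2)
  qed
qed

text \<open>The plane of an element of \<open>N\<close> with the largest p-multiplicity is highest:
  the start of a p-edge has larger p-multiplicity than its end and, by \<open>up\<close>, stays in
  \<open>N\<close>.\<close>

lemma highest_plane_within:
  assumes "prime p" "N \<subseteq> M" "N \<noteq> {}"
    and up: "\<And>a b. (a, b) \<in> p_edges M p \<Longrightarrow> b \<in> N \<Longrightarrow> a \<in> N"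
    and cl: "closed_in M (edges M - p_edges M p) N"
  obtains P where "highest_p_plane M p P" "P \<subseteq> N" "P \<noteq> {}"
proof -
  have fin: "finite N" using assms(2) finite_M finite_subset by blast
  obtain m where m: "m \<in> N" "\<And>n. n \<in> N \<Longrightarrow> multiplicity p n \<le> multiplicity p m"
    using fin assms(3) Max_ge[of "multiplicity p ` N"] Max_in[of "multiplicity p ` N"]
    by (metis (no_types, lifting) empty_is_image finite_imageI imageE image_eqI)
  obtain P where P: "P \<in> p_planes M p" "m \<in> P"
    using component_cover m(1) assms(2) unfolding p_planes_def by blast
  have PN: "P \<subseteq> N" using component_minimal P cl m(1) unfolding p_planes_def by blast
  have "\<not> (\<exists>a. \<exists>b\<in>P. (a, b) \<in> p_edges M p)"
  proof (safe)
    fix a b assume ab: "b \<in> P" "(a, b) \<in> p_edges M p"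
    then have "a \<in> N" using up PN by blast
    moreover have "multiplicity p b = multiplicity p m" using multiplicity_plane P ab(1) assms(1) by blast
    ultimately show False using m(2) multiplicity_p_edge[OF ab(2)] by fastforce
  qed
  then show ?thesis using that[of P] P PN by (auto simp: highest_p_plane_def)
qed

lemma highest_plane_exists:
  assumes "prime p" "M \<noteq> {}" obtains P where "highest_p_plane M p P" "P \<noteq> {}"
proof (rule highest_plane_within[OF assms(1) subset_refl assms(2)])
  show "closed_in M (edges M - p_edges M p) M" using edges_subset by (auto simp: closed_in_def)
qed (use p_edges_subset in blast)+

text \<open>Every vertex is reached from a highest \<open>p\<close>-plane by edges other than \<open>p\<close>-edges in both
  directions and by \<open>p\<close>-edges downwards.\<close>

lemma T_property_descent:
  assumes "prime p" "\<And>P'. highest_p_plane M p P' \<Longrightarrow> P' = P" "\<And>m. m \<in> P \<Longrightarrow> Q m"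
    and "\<And>a b. (a, b) \<in> edges M - p_edges M p \<Longrightarrow> Q a \<longleftrightarrow> Q b"
    and "\<And>a b. (a, b) \<in> p_edges M p \<Longrightarrow> Q a \<Longrightarrow> Q b"
    and "m \<in> M"
  shows "Q m"
proof (rule ccontr)
  assume "\<not> Q m"
  \<comment> \<open>The vertices violating \<open>Q\<close> are closed upwards along p-edges and
    closed under all other edges, so they contain a highest p-plane, which can only be
    \<open>P\<close>.\<close>
  obtain P' where "highest_p_plane M p P'" "P' \<subseteq> {m \<in> M. \<not> Q m}" "P' \<noteq> {}"
  proof (rule highest_plane_within[OF assms(1), of "{m \<in> M. \<not> Q m}"])
    show "closed_in M (edges M - p_edges M p) {m \<in> M. \<not> Q m}"
      using assms(4) edges_subset by (fastforce simp: closed_in_def)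
  qed (use assms(5,6) \<open>\<not> Q m\<close> p_edges_subset in blast)+
  then show False using assms(2,3) by blast
qed

end

section \<open>Sufficiency of the graph conditions\<close>

lemma three_closed_sets:
  assumes "finite V" "E \<subseteq> V \<times> V" "card (graph_components V E) \<le> 2"
    and cl: "closed_in V E A" "closed_in V E B" "closed_in V E C"
    and ne: "A \<noteq> {}" "B \<noteq> {}" "C \<noteq> {}"
    and disj: "A \<inter> B = {}" "A \<inter> C = {}" "B \<inter> C = {}"
  shows False
proof -
  have ex: "\<exists>D. D \<in> graph_components V E \<and> D \<subseteq> X \<and> D \<noteq> {}" if "closed_in V E X" "X \<noteq> {}" for X
  proof -
    obtain x where x: "x \<in> X" "x \<in> V" using \<open>closed_in V E X\<close> \<open>X \<noteq> {}\<close> by (auto simp: closed_in_def)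
    obtain D where D: "D \<in> graph_components V E" "x \<in> D" using x(2) by (rule component_cover)
    then show ?thesis using component_minimal[OF D(1) \<open>closed_in V E X\<close> D(2) x(1)] by blast
  qed
  obtain A' where A': "A' \<in> graph_components V E" "A' \<subseteq> A" "A' \<noteq> {}" using ex[OF cl(1) ne(1)] by blast
  obtain B' where B': "B' \<in> graph_components V E" "B' \<subseteq> B" "B' \<noteq> {}" using ex[OF cl(2) ne(2)] by blast
  obtain C' where C': "C' \<in> graph_components V E" "C' \<subseteq> C" "C' \<noteq> {}" using ex[OF cl(3) ne(3)] by blast
  have "A' \<noteq> B'" "A' \<noteq> C'" "B' \<noteq> C'" using disj A' B' C' by blast+
  then have "card {A', B', C'} = 3" by simp
  moreover have "card {A', B', C'} \<le> card (graph_components V E)"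
    using A' B' C' by (intro card_mono finite_components assms(1)) auto
  ultimately show False using assms(3) by simp
qed

definition unit_on :: "nat set \<Rightarrow> int poly \<Rightarrow> bool" where
  "unit_on M f \<longleftrightarrow> (\<forall>m\<in>M. \<exists>s\<in>{1, - 1}. \<exists>k. ev (zeta m) f = of_int s * zeta m ^ k)"

definition monomial_on :: "nat set \<Rightarrow> int poly \<Rightarrow> bool" where
  "monomial_on M f \<longleftrightarrow> (\<exists>s\<in>{1, - 1}. \<exists>k. \<forall>m\<in>M. ev (zeta m) f = of_int s * zeta m ^ k)"

text \<open>The arithmetic form of the equality of groups: \<open>unit_on\<close> corresponds to the
  automorphisms of the triple and \<open>monomial_on\<close> to plus or minus the powers of
  h.\<close>

definition trivial_units :: "nat set \<Rightarrow> bool" where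
  "trivial_units M \<longleftrightarrow> (\<forall>f. unit_on M f \<longrightarrow> monomial_on M f)"

lemma cong_odd_factor:
  fixes x y :: nat
  assumes "odd c" "c dvd d" "m = 2 ^ b * c"
  shows "[d * x = d * y] (mod m) \<longleftrightarrow> [d * x = d * y] (mod 2 ^ b)"
proof
  assume "[d * x = d * y] (mod 2 ^ b)"
  moreover have "[d * x = d * y] (mod c)" using assms(2) by (simp add: cong_def mod_eq_0_iff_dvd[THEN iffD2])
  moreover have "coprime (2 ^ b) c" using assms(1) by simp
  ultimately show "[d * x = d * y] (mod m)" unfolding assms(3) by (rule coprime_cong_mult_nat)
next
  assume "[d * x = d * y] (mod m)"
  then show "[d * x = d * y] (mod 2 ^ b)" by (rule cong_dvd_modulus_nat) (simp add: assms(3))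
qed

text \<open>The exponents being multiples of all odd parts, only the powers of \<open>2\<close> in the orders matter.\<close>

lemma signed_power_transfer:
  assumes m: "m > 0" "odd c" "c dvd d" "m = 2 ^ b * c"
    and n: "n > 0" "odd c'" "c' dvd d" "n = 2 ^ b * c'"
    and s: "s \<in> {1, - 1 :: int}" "s' \<in> {1, - 1 :: int}"
  shows "of_int s * zeta m ^ (d * x) = of_int s' * zeta m ^ (d * y) \<longleftrightarrow>
    of_int s * zeta n ^ (d * x) = of_int s' * zeta n ^ (d * y)"
proof -
  have eq: "zeta m ^ (d * x) = zeta m ^ (d * y) \<longleftrightarrow> zeta n ^ (d * x) = zeta n ^ (d * y)" for x y
    unfolding zeta_power_eq_iff[OF m(1)] zeta_power_eq_iff[OF n(1)]
      cong_odd_factor[OF m(2-4)] cong_odd_factor[OF n(2-4)] ..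
  have neg: "zeta l ^ (d * x) = - (zeta l ^ (d * y)) \<longleftrightarrow>
      zeta l ^ (d * (2 * x)) = zeta l ^ (d * (2 * y)) \<and> zeta l ^ (d * x) \<noteq> zeta l ^ (d * y)" for l
  proof -
    have "zeta l ^ (d * (2 * x)) = (zeta l ^ (d * x))\<^sup>2" for x
      by (simp flip: power_mult add: mult_ac)
    then have "zeta l ^ (d * (2 * x)) = zeta l ^ (d * (2 * y)) \<longleftrightarrow>
        zeta l ^ (d * x) = zeta l ^ (d * y) \<or> zeta l ^ (d * x) = - (zeta l ^ (d * y))"
      by (simp add: power2_eq_iff)
    moreover have "zeta l ^ (d * y) \<noteq> - (zeta l ^ (d * y))" by simp
    ultimately show ?thesis by metis
  qed
  have neg': "zeta m ^ (d * x) = - (zeta m ^ (d * y)) \<longleftrightarrow> zeta n ^ (d * x) = - (zeta n ^ (d * y))"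
    unfolding neg eq ..
  have "s = s' \<or> s' = - s" using s by auto
  then show ?thesis
  proof
    assume "s = s'" then show ?thesis using eq s by auto
  next
    have neg'': "- (zeta m ^ (d * x)) = zeta m ^ (d * y) \<longleftrightarrow> - (zeta n ^ (d * x)) = zeta n ^ (d * y)"
      using neg' by (metis minus_minus)
    assume "s' = - s" then show ?thesis using neg' neg'' s by auto
  qed
qed

section \<open>A common exponent at the odd primes\<close>

context pos_set
begin

text \<open>Serves as a common multiple of all orders, so that the exponent
  \<open>(total - 1) * k\<close> stands for -k at every vertex.\<close>

definition total :: nat where "total = \<Prod>M"

lemma total_pos: "total > 0" unfolding total_def using pos_M by (simp add: prod_pos)

lemma dvd_total: "m \<in> M \<Longrightarrow> m dvd total"
  unfolding total_def using dvd_prodI[OF finite_M, of m "\<lambda>x. x"] by simp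

lemma zeta_total: "m \<in> M \<Longrightarrow> zeta m ^ (total * k) = 1"
  using dvd_total pos_M by (simp add: zeta_power_eq_1_iff)

lemma zeta_inverse: "m \<in> M \<Longrightarrow> zeta m ^ k * zeta m ^ ((total - 1) * k) = 1"
proof -
  assume m: "m \<in> M"
  have "k + (total - 1) * k = total * k" using total_pos by (cases total) simp_all
  then show ?thesis using zeta_total[OF m] by (simp flip: power_add)
qed

lemma monomial_on_shift:
  assumes "monomial_on M (f * monom s k)" "s \<in> {1, - 1}"
  shows "monomial_on M f"
proof -
  obtain s' k' where s': "s' \<in> {1, - 1}"
    and eq: "\<And>m. m \<in> M \<Longrightarrow> ev (zeta m) (f * monom s k) = of_int s' * zeta m ^ k'"
    using assms(1) unfolding monomial_on_def by blast
  have "ev (zeta m) f = of_int (s * s') * zeta m ^ (k' + (total - 1) * k)" if "m \<in> M" for m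
  proof -
    have "ev (zeta m) f = ev (zeta m) f * (of_int s * of_int s) * (zeta m ^ k * zeta m ^ ((total - 1) * k))"
      using zeta_inverse[OF that] assms(2) by auto
    also have "\<dots> = ev (zeta m) (f * monom s k) * of_int s * zeta m ^ ((total - 1) * k)"
      by (simp add: mult_ac)
    also have "\<dots> = of_int (s * s') * zeta m ^ (k' + (total - 1) * k)"
      unfolding eq[OF that] by (simp add: power_add mult_ac)
    finally show ?thesis .
  qed
  moreover have "s * s' \<in> {1, - 1}" using assms(2) s' by auto
  ultimately show ?thesis unfolding monomial_on_def by blast
qed

text \<open>Along 2-edges a sign stays undetermined. Squaring removes it, so one congruence for
  doubled exponents serves all primes; the factor 2 is cancelled later modulo odd prime
  powers.\<close>

lemma p_edge_exponents:
  assumes "(m, n) \<in> p_edges M q" "s \<in> {1, - 1}" "s' \<in> {1, - 1}"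
    and "ev (zeta m) f = of_int s * zeta m ^ k" "ev (zeta n) f = of_int s' * zeta n ^ k'"
  shows "[2 * k = 2 * k'] (mod n)"
    and "of_int s * zeta n ^ k = of_int s' * zeta n ^ k' \<or>
      q = 2 \<and> of_int s * zeta n ^ k = - (of_int s' * zeta n ^ k')"
proof -
  obtain j where j: "prime q" "j \<ge> 1" "m = q ^ j * n" "n \<in> M" using assms(1) by (rule p_edgesE)
  show *: "of_int s * zeta n ^ k = of_int s' * zeta n ^ k' \<or>
      q = 2 \<and> of_int s * zeta n ^ k = - (of_int s' * zeta n ^ k')"
    by (rule edge_congruence[OF j(1) pos_M[OF j(4)] j(2) assms(2,3)]) (use assms(4,5) j(3) in auto)
  then have "(of_int s * zeta n ^ k)\<^sup>2 = (of_int s' * zeta n ^ k')\<^sup>2" by (auto simp: power2_eq_iff)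
  then have "(zeta n ^ k)\<^sup>2 = (zeta n ^ k')\<^sup>2" using assms(2,3) by (auto simp: power_mult_distrib)
  then have "zeta n ^ (2 * k) = zeta n ^ (2 * k')" by (simp flip: power_mult add: mult.commute)
  then show "[2 * k = 2 * k'] (mod n)" using zeta_power_eq_iff pos_M[OF j(4)] by blast
qed

text \<open>Edges other than p-edges preserve the p-multiplicity, so the congruence passes along
  them in both directions; down a p-edge the modulus shrinks. A unique highest p-plane therefore
  determines \<open>c\<close> for all of \<open>M\<close>.\<close>

lemma common_odd_exponent:
  assumes p: "prime p" "p \<noteq> 2" and T: "T_property M p"
    and s: "\<And>m. m \<in> M \<Longrightarrow> s m \<in> {1, - 1}"
    and k: "\<And>m. m \<in> M \<Longrightarrow> ev (zeta m) f = of_int (s m) * zeta m ^ k m"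
  shows "\<exists>c. \<forall>m\<in>M. [k m = c] (mod p ^ multiplicity p m)"
proof -
  obtain P where P: "highest_p_plane M p P" "\<And>P'. highest_p_plane M p P' \<Longrightarrow> P' = P"
    using T unfolding T_property_def by blast
  have PP: "P \<in> p_planes M p" using P(1) by (simp add: highest_p_plane_def)
  then obtain x where x: "x \<in> P" using component_nonempty unfolding p_planes_def by blast
  have edge: "[k a = k b] (mod p ^ multiplicity p b)" if "(a, b) \<in> p_edges M q" for a b q
  proof -
    have ab: "a \<in> M" "b \<in> M" using that p_edges_subset by auto
    have "[2 * k a = 2 * k b] (mod b)" using p_edge_exponents(1)[OF that] s k ab by blast
    then have "[2 * k a = 2 * k b] (mod p ^ multiplicity p b)"
      by (rule cong_dvd_modulus_nat) (rule multiplicity_dvd)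
    moreover have "coprime 2 (p ^ multiplicity p b)"
      using primes_dvd_imp_eq[OF two_is_prime_nat p(1)] p(2) by auto
    ultimately show ?thesis using cong_mult_lcancel_nat by blast
  qed
  define Q where "Q m \<longleftrightarrow> [k m = k x] (mod p ^ multiplicity p m)" for m
  have other: "Q a \<longleftrightarrow> Q b" if ab: "(a, b) \<in> edges M - p_edges M p" for a b
  proof -
    obtain q where q: "q \<noteq> p" "(a, b) \<in> p_edges M q" using ab edges_Diff_iff by blast
    have "multiplicity p a = multiplicity p b" using multiplicity_other_edge q p by blast
    then show ?thesis using edge[OF q(2)] unfolding Q_def by (metis cong_sym cong_trans)
  qed
  have "Q m" if "m \<in> M" for m
  proof (rule T_property_descent[OF p(1) P(2) _ other _ that])
    fix y assume "y \<in> P"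
    show "Q y"
      by (rule component_induct[OF PP[unfolded p_planes_def] _ x _ other \<open>y \<in> P\<close>])
         (use edges_subset in \<open>auto simp: Q_def\<close>)
  next
    fix a b assume ab: "(a, b) \<in> p_edges M p" "Q a"
    have "multiplicity p b \<le> multiplicity p a" using multiplicity_p_edge[OF ab(1)] by simp
    then have "[k a = k x] (mod p ^ multiplicity p b)"
      using ab(2) unfolding Q_def by (meson cong_dvd_modulus_nat le_imp_power_dvd)
    then show "Q b" using edge[OF ab(1)] unfolding Q_def by (metis cong_sym cong_trans)
  qed
  then show ?thesis unfolding Q_def by blast
qed

lemma common_odd_exponent_all:
  assumes T: "\<And>p. prime p \<Longrightarrow> p \<ge> 3 \<Longrightarrow> T_property M p"
    and s: "\<And>m. m \<in> M \<Longrightarrow> s m \<in> {1, - 1}"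
    and k: "\<And>m. m \<in> M \<Longrightarrow> ev (zeta m) f = of_int (s m) * zeta m ^ k m"
  shows "\<exists>c. \<forall>m\<in>M. \<forall>p. prime p \<longrightarrow> p \<noteq> 2 \<longrightarrow> [k m = c] (mod p ^ multiplicity p m)"
proof -
  have "\<exists>c. \<forall>m\<in>M. [k m = c] (mod p ^ multiplicity p m)" if "prime p" "p \<noteq> 2" for p
    using common_odd_exponent[OF that T s k] that prime_ge_2_nat[of p] by fastforce
  then obtain c where c: "\<And>p m. prime p \<Longrightarrow> p \<noteq> 2 \<Longrightarrow> m \<in> M \<Longrightarrow> [k m = c p] (mod p ^ multiplicity p m)"
    by metis
  have "\<exists>x. \<forall>p\<in>prime_factors total - {2}. [x = c p] (mod p ^ multiplicity p total)"
    by (rule chinese_remainder_nat) (auto simp: in_prime_factors_iff primes_coprime)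
  then obtain x where x: "\<And>p. p \<in> prime_factors total - {2} \<Longrightarrow> [x = c p] (mod p ^ multiplicity p total)"
    by blast
  have "[k m = x] (mod p ^ multiplicity p m)" if m: "m \<in> M" and p: "prime p" "p \<noteq> 2" for m p
  proof (cases "p dvd total")
    case True
    then have "[x = c p] (mod p ^ multiplicity p total)"
      using x total_pos p by (auto simp: in_prime_factors_iff)
    moreover have "multiplicity p m \<le> multiplicity p total"
      using dvd_total[OF m] total_pos by (intro dvd_imp_multiplicity_le) auto
    ultimately have "[x = c p] (mod p ^ multiplicity p m)"
      by (meson cong_dvd_modulus_nat le_imp_power_dvd)
    then show ?thesis using c[OF p m] by (metis cong_sym cong_trans)
  next
    case False
    then have "\<not> p dvd m" using dvd_total[OF m] dvd_trans by blast
    then show ?thesis by (simp add: not_dvd_imp_multiplicity_0)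
  qed
  then show ?thesis by blast
qed

section \<open>Roots of unity of 2-power order, and signs on a connected graph\<close>

definition odd_total :: nat where "odd_total = total div 2 ^ multiplicity 2 total"

lemma total_eq: "total = 2 ^ multiplicity 2 total * odd_total" and odd_odd_total: "odd odd_total"
proof -
  show "total = 2 ^ multiplicity 2 total * odd_total"
    unfolding odd_total_def by (simp add: multiplicity_dvd)
  show "odd odd_total" unfolding odd_total_def
    using total_pos by (intro multiplicity_decompose) auto
qed

lemma odd_part:
  assumes "m \<in> M" obtains c where "m = 2 ^ multiplicity 2 m * c" "odd c" "c dvd odd_total"
proof -
  obtain c where c: "m = 2 ^ multiplicity 2 m * c" "odd c"
    using multiplicity_decompose'[of m "2::nat"] pos_M[OF assms] by auto
  have "c dvd m" by (subst c(1)) simp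
  then have "c dvd 2 ^ multiplicity 2 total * odd_total"
    using dvd_total[OF assms] total_eq dvd_trans by metis
  moreover have "coprime c (2 ^ multiplicity 2 total)" using c(2) by simp
  ultimately have "c dvd odd_total" by (simp add: coprime_dvd_mult_right_iff)
  then show ?thesis using that c by blast
qed

text \<open>As the odd part of each \<open>m\<close> divides \<open>odd_total\<close>, these values
  are, up to sign, roots of unity of 2-power order.\<close>

definition two_power_on :: "int poly \<Rightarrow> bool" where
  "two_power_on f \<longleftrightarrow> (\<forall>m\<in>M. \<exists>s\<in>{1, - 1}. \<exists>r. ev (zeta m) f = of_int s * zeta m ^ (odd_total * r))"

lemma two_power_reduction:
  assumes T: "\<And>p. prime p \<Longrightarrow> p \<ge> 3 \<Longrightarrow> T_property M p" and f: "unit_on M f"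
  shows "\<exists>k. two_power_on (f * monom 1 k)"
proof -
  obtain s where s: "\<And>m. m \<in> M \<Longrightarrow> s m \<in> {1, - 1} \<and> (\<exists>k. ev (zeta m) f = of_int (s m) * zeta m ^ k)"
    using f unfolding unit_on_def by metis
  then obtain k where k: "\<And>m. m \<in> M \<Longrightarrow> ev (zeta m) f = of_int (s m) * zeta m ^ k m" by metis
  obtain c where c: "\<And>m p. m \<in> M \<Longrightarrow> prime p \<Longrightarrow> p \<noteq> 2 \<Longrightarrow> [k m = c] (mod p ^ multiplicity p m)"
    using common_odd_exponent_all[OF T _ k] s by blast
  \<comment> \<open>\<open>odd_total * u\<close> is 1 modulo the 2-part of each \<open>m\<close> and
    0 modulo its odd part. Multiplication by it thus fixes, modulo \<open>m\<close>, every exponent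
    divisible by that odd part.\<close>
  obtain u where u: "[odd_total * u = 1] (mod 2 ^ multiplicity 2 total)"
    using cong_solve_coprime_nat[of odd_total "2 ^ multiplicity 2 total"] odd_odd_total by auto
  have ex: "\<exists>r. zeta m ^ k m * zeta m ^ ((total - 1) * c) = zeta m ^ (odd_total * r)" if m: "m \<in> M" for m
  proof -
    let ?l = "k m + (total - 1) * c"
    obtain d where d: "m = 2 ^ multiplicity 2 m * d" "odd d" "d dvd odd_total" using odd_part[OF m] .
    \<comment> \<open>The shift \<open>(total - 1) * c\<close> subtracts the common exponent
      \<open>c\<close>, which leaves 0 modulo each odd prime power in \<open>m\<close>.\<close>
    have "d dvd ?l"
    proof (cases "?l = 0")
      case False
      show ?thesis
      proof (rule multiplicity_le_imp_dvd)
        show "d \<noteq> 0" using d(2) by (cases "d = 0") auto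
        fix p :: nat assume p: "prime p"
        show "multiplicity p d \<le> multiplicity p ?l"
        proof (cases "p = 2")
          case True then show ?thesis using d(2) by (simp add: not_dvd_imp_multiplicity_0)
        next
          case p2: False
          have "[?l = c + (total - 1) * c] (mod p ^ multiplicity p m)"
            using c[OF m p p2] by (rule cong_add) simp
          also have "c + (total - 1) * c = total * c" using total_pos by (cases total) simp_all
          also have "[total * c = 0] (mod p ^ multiplicity p m)"
            using dvd_total[OF m] multiplicity_dvd[of p m] by (auto simp: cong_0_iff intro: dvd_trans)
          finally have "p ^ multiplicity p m dvd ?l" by (simp add: cong_0_iff)
          moreover have "multiplicity p d \<le> multiplicity p m"
            using d(1) pos_M[OF m] by (intro dvd_imp_multiplicity_le) (metis dvd_triv_right, simp)
          ultimately have "p ^ multiplicity p d dvd ?l" by (meson dvd_trans le_imp_power_dvd)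
          then show ?thesis using False p by (intro multiplicity_geI) auto
        qed
      qed
    qed (simp only: dvd_0_right)
    then obtain e where e: "?l = d * e" by blast
    have "multiplicity 2 m \<le> multiplicity 2 total"
      using dvd_total[OF m] total_pos by (intro dvd_imp_multiplicity_le) auto
    then have "[odd_total * u = 1] (mod 2 ^ multiplicity 2 m)"
      using u by (meson cong_dvd_modulus_nat le_imp_power_dvd)
    then have "[odd_total * u * ?l = 1 * ?l] (mod 2 ^ multiplicity 2 m)" by (rule cong_mult) simp
    moreover have "[odd_total * u * ?l = 1 * ?l] (mod d)" unfolding e by (simp add: cong_def)
    moreover have "coprime (2 ^ multiplicity 2 m) d" using d(2) by simp
    ultimately have "[odd_total * u * ?l = 1 * ?l] (mod 2 ^ multiplicity 2 m * d)"
      by (rule coprime_cong_mult_nat)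
    then have "[odd_total * (u * ?l) = ?l] (mod m)" using d(1) by (simp add: mult.assoc)
    then have "zeta m ^ (odd_total * (u * ?l)) = zeta m ^ ?l"
      using zeta_power_eq_iff pos_M[OF m] by blast
    then show ?thesis by (metis power_add)
  qed
  have "two_power_on (f * monom 1 ((total - 1) * c))"
    unfolding two_power_on_def
  proof
    fix m assume m: "m \<in> M"
    obtain r where "zeta m ^ k m * zeta m ^ ((total - 1) * c) = zeta m ^ (odd_total * r)"
      using ex[OF m] by blast
    then have "ev (zeta m) (f * monom 1 ((total - 1) * c)) = of_int (s m) * zeta m ^ (odd_total * r)"
      using k[OF m] by (simp add: mult.assoc)
    then show "\<exists>s\<in>{1, - 1}. \<exists>r. ev (zeta m) (f * monom 1 ((total - 1) * c)) =
        of_int s * zeta m ^ (odd_total * r)"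
      using s[OF m] by blast
  qed
  then show ?thesis by blast
qed

text \<open>Across an edge for an odd prime there is no sign ambiguity, and its ends have the same
  2-multiplicity, so that equations between 2-power roots of unity transfer from one end to the
  other.\<close>

lemma two_power_odd_edge:
  assumes f: "two_power_on f" and ab: "(a, b) \<in> edges M - p_edges M 2" and s: "s \<in> {1, - 1}"
  shows "ev (zeta a) f = of_int s * zeta a ^ (odd_total * r) \<longleftrightarrow>
    ev (zeta b) f = of_int s * zeta b ^ (odd_total * r)"
proof -
  obtain q where q: "q \<noteq> 2" "(a, b) \<in> p_edges M q" using ab edges_Diff_iff by blast
  have M: "a \<in> M" "b \<in> M" using q p_edges_subset by auto
  have v: "multiplicity 2 a = multiplicity 2 b" using multiplicity_other_edge q by simp
  obtain t x where t: "t \<in> {1, - 1}" "ev (zeta a) f = of_int t * zeta a ^ (odd_total * x)"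
    using f M(1) unfolding two_power_on_def by blast
  obtain t' y where t': "t' \<in> {1, - 1}" "ev (zeta b) f = of_int t' * zeta b ^ (odd_total * y)"
    using f M(2) unfolding two_power_on_def by blast
  obtain c where c: "a = 2 ^ multiplicity 2 b * c" "odd c" "c dvd odd_total"
    using odd_part[OF M(1)] v by metis
  obtain c' where c': "b = 2 ^ multiplicity 2 b * c'" "odd c'" "c' dvd odd_total"
    using odd_part[OF M(2)] by metis
  have e: "of_int t * zeta b ^ (odd_total * x) = of_int t' * zeta b ^ (odd_total * y)"
    using p_edge_exponents(2)[OF q(2) t(1) t'(1) t(2) t'(2)] q(1) by blast
  have "ev (zeta a) f = of_int s * zeta a ^ (odd_total * r) \<longleftrightarrow>
      of_int t * zeta b ^ (odd_total * x) = of_int s * zeta b ^ (odd_total * r)"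
    unfolding t(2)
    by (rule signed_power_transfer[OF pos_M[OF M(1)] c(2,3,1) pos_M[OF M(2)] c'(2,3,1) t(1) s])
  then show ?thesis unfolding e t'(2) .
qed

text \<open>No 2-edge ends in \<open>P\<close>. So a 2-edge that touches \<open>P\<close> starts at
  a vertex where no 2-edge ends: it is a highest 2-edge and has been deleted.\<close>

lemma highest_2_plane_closed:
  assumes "highest_p_plane M 2 P"
  shows "closed_in M (edges M - highest_p_edges M 2) P"
proof -
  have P: "P \<in> p_planes M 2" "\<And>a b. b \<in> P \<Longrightarrow> (a, b) \<notin> p_edges M 2"
    using assms by (auto simp: highest_p_plane_def)
  have "a \<in> P \<longleftrightarrow> b \<in> P" if ab: "(a, b) \<in> edges M - highest_p_edges M 2" for a b
  proof (cases "(a, b) \<in> p_edges M 2")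
    case True
    then obtain c where "(c, a) \<in> p_edges M 2" using ab by (auto simp: highest_p_edges_def)
    then show ?thesis using P(2) True by blast
  next
    case False then show ?thesis using closed_inD[OF closed_in_plane[OF P(1)]] ab by blast
  qed
  moreover have "P \<subseteq> M" using closed_in_plane[OF P(1)] by (simp add: closed_in_def)
  ultimately show ?thesis by (auto simp: closed_in_def)
qed

text \<open>Two highest 2-planes and the remaining vertices would be three closed sets, so the
  remainder is empty. As 2-edges end outside highest 2-planes, there are none at all, and
  \<open>P\<close> would be a proper closed subset of a connected graph.\<close>

lemma unique_highest_2_plane:
  assumes con: "card (graph_components M (edges M)) = 1" and S: "S2_property M"
    and P: "highest_p_plane M 2 P" and P': "highest_p_plane M 2 P'"
  shows "P' = P"
proof (rule ccontr)
  assume ne: "P' \<noteq> P"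
  let ?E = "edges M - highest_p_edges M 2"
  have sub: "?E \<subseteq> M \<times> M" using edges_subset by blast
  have PP: "P \<in> p_planes M 2" "P' \<in> p_planes M 2" using P P' by (auto simp: highest_p_plane_def)
  then have disj: "P \<inter> P' = {}" using ne component_disjoint unfolding p_planes_def by blast
  have nonempty: "P \<noteq> {}" "P' \<noteq> {}" using PP component_nonempty unfolding p_planes_def by blast+
  have cl: "closed_in M ?E P" "closed_in M ?E P'" using highest_2_plane_closed P P' by blast+
  have "M - (P \<union> P') = {}"
  proof (rule ccontr)
    assume "M - (P \<union> P') \<noteq> {}"
    moreover have "closed_in M ?E (M - (P \<union> P'))" using closed_in_Diff[OF sub] closed_in_Un cl by blast
    moreover have "card (graph_components M ?E) \<le> 2" using S by (auto simp: S2_property_def)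
    moreover have "P \<inter> (M - (P \<union> P')) = {}" "P' \<inter> (M - (P \<union> P')) = {}" by blast+
    ultimately show False
      using three_closed_sets[OF finite_M sub _ cl] nonempty disj by blast
  qed
  then have no2: "p_edges M 2 = {}"
    using P P' p_edges_subset[of M 2] unfolding highest_p_plane_def by blast
  then have "closed_in M (edges M) P" using closed_in_plane[OF PP(1)] by simp
  then have "P = M" using con nonempty unfolding connected_iff[OF edges_subset] by blast
  moreover have "P' \<subseteq> M" using cl(2) by (simp add: closed_in_def)
  ultimately show False using disj nonempty by blast
qed

text \<open>After division by the monomial found on the highest 2-plane \<open>P\<close>, all values
  are 1 or -1 and are constant on the components counted by \<open>S2_property\<close>. As
  \<open>P\<close> is a union of such components, a value -1 occurs nowhere or on the whole
  complement of \<open>P\<close>.\<close>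

lemma condition_I_two_power:
  assumes con: "card (graph_components M (edges M)) = 1" and S: "S2_property M"
    and f: "two_power_on f"
  shows "monomial_on M f"
proof -
  let ?E = "edges M - highest_p_edges M 2"
  have sub: "?E \<subseteq> M \<times> M" using edges_subset by blast
  have "M \<noteq> {}" using con connected_iff[OF edges_subset] by blast
  then obtain P where P: "highest_p_plane M 2 P" "P \<noteq> {}"
    using highest_plane_exists[OF two_is_prime_nat] by blast
  have uniq: "P' = P" if "highest_p_plane M 2 P'" for P'
    using unique_highest_2_plane[OF con S P(1) that] .
  have PP: "P \<in> p_planes M 2" using P(1) by (simp add: highest_p_plane_def)
  have PM: "P \<subseteq> M" using closed_in_plane[OF PP] by (simp add: closed_in_def)
  obtain x where x: "x \<in> P" using P(2) by blast
  obtain s r where s: "s \<in> {1, - 1}" and r: "ev (zeta x) f = of_int s * zeta x ^ (odd_total * r)"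
    using f x PM unfolding two_power_on_def by blast
  have fP: "ev (zeta m) f = of_int s * zeta m ^ (odd_total * r)" if "m \<in> P" for m
    by (rule component_induct[where Q = "\<lambda>m. ev (zeta m) f = of_int s * zeta m ^ (odd_total * r)",
          OF PP[unfolded p_planes_def] _ x r _ that])
       (use edges_subset two_power_odd_edge[OF f _ s] in blast)+
  define g where "g = f * monom s (odd_total * ((total - 1) * r))"
  have evg: "ev (zeta m) g = ev (zeta m) f * of_int s * zeta m ^ (odd_total * ((total - 1) * r))" for m
    by (simp add: g_def)
  have g: "two_power_on g"
    unfolding two_power_on_def
  proof
    fix m assume "m \<in> M"
    then obtain t y where t: "t \<in> {1, - 1}" "ev (zeta m) f = of_int t * zeta m ^ (odd_total * y)"
      using f unfolding two_power_on_def by blast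
    have "ev (zeta m) g = of_int (t * s) * zeta m ^ (odd_total * (y + (total - 1) * r))"
      unfolding evg t(2) by (simp add: power_add distrib_left mult_ac)
    moreover have "t * s \<in> {1, - 1}" using t s by auto
    ultimately show "\<exists>s\<in>{1, - 1}. \<exists>r. ev (zeta m) g = of_int s * zeta m ^ (odd_total * r)" by blast
  qed
  have gP: "ev (zeta m) g = 1" if "m \<in> P" for m
  proof -
    have "ev (zeta m) g = (of_int s * of_int s) *
        (zeta m ^ (odd_total * r) * zeta m ^ ((total - 1) * (odd_total * r)))"
      unfolding evg fP[OF that] by (simp add: mult_ac)
    then show ?thesis using zeta_inverse[of m] that PM s by auto
  qed
  have odd_edge: "ev (zeta a) g = of_int d \<longleftrightarrow> ev (zeta b) g = of_int d"
    if "(a, b) \<in> edges M - p_edges M 2" "d \<in> {1, - 1}" for a b d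
    using two_power_odd_edge[OF g that, of 0] by simp
  have pm1: "ev (zeta m) g = 1 \<or> ev (zeta m) g = - 1" if "m \<in> M" for m
  proof (rule T_property_descent[OF two_is_prime_nat uniq _ _ _ that])
    show "ev (zeta m) g = 1 \<or> ev (zeta m) g = - 1" if "m \<in> P" for m using gP that by blast
    show "ev (zeta a) g = 1 \<or> ev (zeta a) g = - 1 \<longleftrightarrow> ev (zeta b) g = 1 \<or> ev (zeta b) g = - 1"
      if "(a, b) \<in> edges M - p_edges M 2" for a b
      using odd_edge[OF that, of 1] odd_edge[OF that, of "- 1"] by simp
    fix a b assume ab: "(a, b) \<in> p_edges M 2" and a: "ev (zeta a) g = 1 \<or> ev (zeta a) g = - 1"
    then obtain d :: int where d: "d \<in> {1, - 1}" "ev (zeta a) g = of_int d * zeta a ^ 0"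
      by (auto intro: that[of 1] that[of "- 1"])
    have "b \<in> M" using ab p_edges_subset by auto
    then obtain t y where t: "t \<in> {1, - 1}" "ev (zeta b) g = of_int t * zeta b ^ (odd_total * y)"
      using g unfolding two_power_on_def by blast
    have "of_int d * zeta b ^ 0 = ev (zeta b) g \<or> of_int d * zeta b ^ 0 = - ev (zeta b) g"
      using p_edge_exponents(2)[OF ab d(1) t(1) d(2) t(2)] t(2) by auto
    then show "ev (zeta b) g = 1 \<or> ev (zeta b) g = - 1"
      using d(1) by (auto simp: minus_equation_iff)
  qed
  have const: "ev (zeta a) g = ev (zeta b) g" if ab: "(a, b) \<in> ?E" for a b
  proof -
    have abM: "a \<in> M" "b \<in> M" using ab sub by auto
    obtain d :: int where d: "d \<in> {1, - 1}" "ev (zeta a) g = of_int d"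
      using pm1[OF abM(1)] by (auto intro: that[of 1] that[of "- 1"])
    obtain d' :: int where d': "d' \<in> {1, - 1}" "ev (zeta b) g = of_int d'"
      using pm1[OF abM(2)] by (auto intro: that[of 1] that[of "- 1"])
    show ?thesis
    proof (cases "(a, b) \<in> p_edges M 2")
      case False
      then show ?thesis using odd_edge[of a b d] ab d by auto
    next
      case True
      then obtain c where c: "(c, a) \<in> p_edges M 2" using ab by (auto simp: highest_p_edges_def)
      then have "c \<in> M" using p_edges_subset by auto
      then obtain d0 :: int where d0: "d0 \<in> {1, - 1}" "ev (zeta c) g = of_int d0"
        using pm1[OF \<open>c \<in> M\<close>] by (auto intro: that[of 1] that[of "- 1"])
      obtain i where i: "i \<ge> 1" "c = 2 ^ i * a" using c by (auto elim: p_edgesE)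
      obtain j where j: "j \<ge> 1" "a = 2 ^ j * b" using True by (auto elim: p_edgesE)
      have "d = d'"
        by (rule chain_congruence[OF pos_M[OF abM(2)] i(1) j(1), of d0 d d' g])
           (use d0 d d' i(2) j(2) in auto)
      then show ?thesis using d d' by simp
    qed
  qed
  have "monomial_on M g"
  proof (cases "\<forall>m\<in>M. ev (zeta m) g = 1")
    case True
    then show ?thesis unfolding monomial_on_def by (intro bexI[of _ 1] exI[of _ 0]) auto
  next
    case False
    let ?A = "{m \<in> M. ev (zeta m) g = 1}" and ?B = "{m \<in> M. ev (zeta m) g = - 1}"
    have B: "?B \<noteq> {}" using False pm1 by auto
    have cl: "closed_in M ?E ?A" "closed_in M ?E ?B"
      using const sub by (auto simp: closed_in_def)
    have clP: "closed_in M ?E P" by (rule highest_2_plane_closed[OF P(1)])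
    have clAP: "closed_in M ?E (?A - P)"
      using cl(1) clP by (fastforce simp: closed_in_def)
    have "?A - P = {}"
    proof (rule ccontr)
      assume "?A - P \<noteq> {}"
      moreover have "card (graph_components M ?E) \<le> 2" using S by (auto simp: S2_property_def)
      moreover have "P \<inter> (?A - P) = {}" "P \<inter> ?B = {}" "(?A - P) \<inter> ?B = {}" using gP by auto
      ultimately show False
        using three_closed_sets[OF finite_M sub _ clP clAP cl(2)] B P(2) by blast
    qed
    then have AP: "m \<in> P \<longleftrightarrow> ev (zeta m) g = 1" if "m \<in> M" for m using that gP by blast
    define l where "l = multiplicity 2 x"
    have low: "m \<in> P \<or> multiplicity 2 m < l" if "m \<in> M" for m
    proof (rule T_property_descent[OF two_is_prime_nat uniq _ _ _ that])
      show "m \<in> P \<or> multiplicity 2 m < l" if "m \<in> P" for m using that by blast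
      show "(a \<in> P \<or> multiplicity 2 a < l) \<longleftrightarrow> (b \<in> P \<or> multiplicity 2 b < l)"
        if ab: "(a, b) \<in> edges M - p_edges M 2" for a b
      proof -
        obtain q where q: "q \<noteq> 2" "(a, b) \<in> p_edges M q" using ab edges_Diff_iff by blast
        have "multiplicity 2 a = multiplicity 2 b" using multiplicity_other_edge q by simp
        then show ?thesis using closed_inD[OF closed_in_plane[OF PP] ab] by simp
      qed
      fix a b assume ab: "(a, b) \<in> p_edges M 2" "a \<in> P \<or> multiplicity 2 a < l"
      have "multiplicity 2 a = l" if "a \<in> P" unfolding l_def
        by (rule multiplicity_plane[OF PP two_is_prime_nat that x])
      then show "b \<in> P \<or> multiplicity 2 b < l" using ab(2) multiplicity_p_edge[OF ab(1)] by auto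
    qed
    obtain y where y: "y \<in> M" "y \<notin> P" using B AP by auto
    then have l0: "l > 0" using low[OF y(1)] by auto
    \<comment> \<open>The root of unity \<open>zeta m ^ odd_total\<close> has order 2^v for the
      2-multiplicity v of \<open>m\<close>. This is 2^l on \<open>P\<close> and a proper divisor of
      it elsewhere, so the power with exponent 2^(l-1) is -1 on \<open>P\<close> and 1
      elsewhere.\<close>
    have "ev (zeta m) g = of_int (- 1) * zeta m ^ (odd_total * 2 ^ (l - 1))" if m: "m \<in> M" for m
    proof -
      obtain c where c: "m = 2 ^ multiplicity 2 m * c" "odd c" "c dvd odd_total" using odd_part[OF m] .
      show ?thesis
      proof (cases "m \<in> P")
        case True
        have v: "multiplicity 2 m = l" unfolding l_def
          by (rule multiplicity_plane[OF PP two_is_prime_nat True x])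
        have "m dvd 2 * (odd_total * 2 ^ (l - 1))"
        proof -
          have "2 * (odd_total * 2 ^ (l - 1)) = 2 ^ l * odd_total" using l0 by (cases l) simp_all
          then show ?thesis using c(1,3) v by (metis mult_dvd_mono dvd_refl)
        qed
        moreover have "\<not> m dvd odd_total * 2 ^ (l - 1)"
        proof
          assume "m dvd odd_total * 2 ^ (l - 1)"
          then have "2 ^ l dvd odd_total * 2 ^ (l - 1)" using c(1) v by (metis dvd_mult_left)
          moreover have "coprime (2 ^ l) odd_total" using odd_odd_total by simp
          ultimately have "2 ^ l dvd (2 ^ (l - 1) :: nat)" by (simp add: coprime_dvd_mult_right_iff)
          then have "l \<le> l - 1" by (simp add: dvd_power_iff_le)
          then show False using l0 by simp
        qed
        ultimately have "zeta m ^ (odd_total * 2 ^ (l - 1)) = - 1"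
          using zeta_power_eq_minus_1_iff pos_M[OF m] by blast
        then show ?thesis using gP[OF True] by simp
      next
        case False
        then have "multiplicity 2 m \<le> l - 1" using low[OF m] by auto
        then have "m dvd odd_total * 2 ^ (l - 1)"
          using c(1,3) by (metis le_imp_power_dvd mult.commute mult_dvd_mono)
        then have "zeta m ^ (odd_total * 2 ^ (l - 1)) = 1"
          using zeta_power_eq_1_iff pos_M[OF m] by blast
        then show ?thesis using AP[OF m] False pm1[OF m] by simp
      qed
    qed
    then show ?thesis unfolding monomial_on_def by blast
  qed
  then show ?thesis unfolding g_def using monomial_on_shift s by blast
qed

lemma condition_I_trivial_units:
  assumes "condition_I M" shows "trivial_units M"
  unfolding trivial_units_def
proof (intro allI impI)
  fix f assume f: "unit_on M f"
  have I: "card (graph_components M (edges M)) = 1" "S2_property M"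
    "\<And>p. prime p \<Longrightarrow> p \<ge> 3 \<Longrightarrow> T_property M p"
    using assms by (auto simp: condition_I_def)
  obtain k where "two_power_on (f * monom 1 k)" using two_power_reduction[OF I(3) f] by blast
  then have "monomial_on M (f * monom 1 k)" by (rule condition_I_two_power[OF I(1,2)])
  then show "monomial_on M f" by (rule monomial_on_shift) simp
qed

end

lemma chinese_remainder_parity:
  fixes a b x y :: nat
  assumes "coprime a b" "[x = y] (mod 2)"
  shows "\<exists>z. [z = x] (mod 2 * a) \<and> [z = y] (mod 2 * b)"
proof -
  obtain z where z: "[z = x div 2] (mod a)" "[z = y div 2] (mod b)"
    using binary_chinese_remainder_nat[OF assms(1)] by blast
  have par: "x mod 2 = y mod 2" using assms(2) by (simp add: cong_def)
  have *: "[2 * z + w mod 2 = w] (mod 2 * c)" if "[z = w div 2] (mod c)" for w c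
  proof -
    have "[2 * z = 2 * (w div 2)] (mod 2 * c)" using that by (simp add: cong_def flip: mult_mod_right)
    then have "[2 * z + w mod 2 = 2 * (w div 2) + w mod 2] (mod 2 * c)" by (rule cong_add) simp
    then show ?thesis by (simp only: mult_div_mod_eq)
  qed
  have "[2 * z + x mod 2 = x] (mod 2 * a)" "[2 * z + x mod 2 = y] (mod 2 * b)"
    using *[OF z(1)] *[OF z(2)] par by auto
  then show ?thesis by blast
qed

section \<open>Sufficiency for two components\<close>

context pos_set
begin

lemma pos_subset: "N \<subseteq> M \<Longrightarrow> pos_set N"
  by standard (use finite_M finite_subset pos_M in auto)

lemma p_edges_mono:
  assumes "(a, b) \<in> p_edges M p" "N \<subseteq> M" "a \<in> N" "b \<in> N" shows "(a, b) \<in> p_edges N p"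
  using assms unfolding p_edges_def by blast

lemma component_connected:
  assumes "N \<in> graph_components M (edges M)"
  shows "card (graph_components N (edges N)) = 1"
  unfolding connected_iff[OF edges_subset]
proof (intro conjI allI impI)
  show "N \<noteq> {}" by (rule component_nonempty[OF assms])
  fix A assume A: "closed_in N (edges N) A"
  have N: "closed_in M (edges M) N" by (rule component_closed[OF edges_subset assms])
  have sub: "N \<subseteq> M" using N by (simp add: closed_in_def)
  have "a \<in> A \<longleftrightarrow> b \<in> A" if ab: "(a, b) \<in> edges M" for a b
  proof (cases "a \<in> N")
    case True
    then have "b \<in> N" using closed_inD[OF N ab] by simp
    then have "(a, b) \<in> edges N" using p_edges_mono[OF _ sub True] ab by (auto simp: edges_def)
    then show ?thesis using closed_inD[OF A] by blast
  next
    case False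
    then show ?thesis using closed_inD[OF N ab] A by (auto simp: closed_in_def)
  qed
  then have cl: "closed_in M (edges M) A" using A sub by (auto simp: closed_in_def)
  show "A = {} \<or> A = N"
  proof (cases "A = {}")
    case False
    then obtain x where "x \<in> A" "x \<in> N" using A by (auto simp: closed_in_def)
    then have "N \<subseteq> A" using component_minimal[OF assms cl] by blast
    then show ?thesis using A by (auto simp: closed_in_def)
  qed simp
qed

text \<open>The 2-multiplicity is constant on a 2-plane, so the graph of \<open>N\<close> has no
  2-edges and S_2 reduces to connectedness.\<close>

lemma condition_I_component:
  assumes "N \<in> graph_components M (edges M)" "N \<in> p_planes M 2"
    and "\<And>p. prime p \<Longrightarrow> p \<ge> 3 \<Longrightarrow> T_property N p"
  shows "condition_I N"
proof -
  have sub: "N \<subseteq> M" by (rule component_subset[OF assms(1)])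
  interpret N: pos_set N by (rule pos_subset[OF sub])
  have con: "card (graph_components N (edges N)) = 1" by (rule component_connected[OF assms(1)])
  have "p_edges N 2 = {}"
  proof (rule equals0I)
    fix e assume e: "e \<in> p_edges N 2"
    obtain a b where ab: "e = (a, b)" by force
    have "a \<in> N" "b \<in> N" using e ab p_edges_subset[of N 2] by auto
    then have "multiplicity 2 a = multiplicity 2 b"
      using multiplicity_plane[OF assms(2) two_is_prime_nat] by blast
    then show False using N.multiplicity_p_edge[of a b 2] e ab by simp
  qed
  then have "edges N - highest_p_edges N 2 = edges N" by (auto simp: highest_p_edges_def)
  then show ?thesis using con assms(3) by (simp add: condition_I_def S2_property_def)
qed

text \<open>Half of the Lcm has 2-multiplicity l - 1 and is still divisible by all odd parts. Adding
  it to an exponent changes the sign at all vertices of \<open>N\<close> simultaneously.\<close>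

lemma zeta_half_Lcm:
  assumes N: "N \<subseteq> M" "\<And>m. m \<in> N \<Longrightarrow> multiplicity 2 m = l" "l > 0" "m \<in> N"
  shows "zeta m ^ (Lcm N div 2) = - 1"
    and "even (Lcm N)" and "\<not> 2 ^ l dvd Lcm N div 2" and "2 ^ l dvd Lcm N"
proof -
  have pl: "2 ^ l dvd m" using multiplicity_dvd[of 2 m] N(2)[OF N(4)] by simp
  have mL: "m dvd Lcm N" using N(4) by (rule dvd_Lcm)
  then show lL: "2 ^ l dvd Lcm N" using pl dvd_trans by blast
  then show ev: "even (Lcm N)" using N(3) by (metis dvd_power dvd_trans)
  have "Lcm N dvd 2 ^ l * odd_total"
  proof (rule Lcm_least)
    fix x assume x: "x \<in> N"
    then obtain c where "x = 2 ^ multiplicity 2 x * c" "c dvd odd_total" using odd_part N(1) by blast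
    then show "x dvd 2 ^ l * odd_total" using N(2)[OF x] by (metis mult_dvd_mono dvd_refl)
  qed
  show nd: "\<not> 2 ^ l dvd Lcm N div 2"
  proof
    assume "2 ^ l dvd Lcm N div 2"
    then have "2 * 2 ^ l dvd 2 * (Lcm N div 2)" by (rule mult_dvd_mono[OF dvd_refl])
    then have "2 * 2 ^ l dvd 2 ^ l * odd_total" using \<open>Lcm N dvd 2 ^ l * odd_total\<close> ev
      by (metis dvd_mult_div_cancel dvd_trans)
    then have "2 dvd odd_total" by (simp add: mult.commute)
    then show False using odd_odd_total by simp
  qed
  have m0: "m > 0" using N pos_M by blast
  have "\<not> m dvd Lcm N div 2" using nd pl dvd_trans by blast
  moreover have "m dvd 2 * (Lcm N div 2)" using mL ev by simp
  ultimately show "zeta m ^ (Lcm N div 2) = - 1"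
    using zeta_power_eq_minus_1_iff[OF m0] by blast
qed

lemma zeta_cong_Lcm:
  assumes "N \<subseteq> M" "m \<in> N" "[x = y] (mod Lcm N)" shows "zeta m ^ x = zeta m ^ y"
proof -
  have "[x = y] (mod m)" using assms(2,3) by (meson cong_dvd_modulus_nat dvd_Lcm)
  then show ?thesis using zeta_power_eq_iff pos_M assms by blast
qed

lemma condition_II_trivial_units:
  assumes "condition_II M" shows "trivial_units M"
  unfolding trivial_units_def
proof (intro allI impI)
  fix f assume f: "unit_on M f"
  obtain M1 M2 where comps: "graph_components M (edges M) = {M1, M2}"
    and planes: "M1 \<in> p_planes M 2" "M2 \<in> p_planes M 2"
    and "\<forall>p. prime p \<and> 3 \<le> p \<longrightarrow> T_property M1 p \<and> T_property M2 p"
    and gcd: "gcd (Lcm M1) (Lcm M2) \<in> {1, 2}"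
    and val: "max_valuation M1 2 > max_valuation M2 2" "max_valuation M2 2 \<in> {0, 1}"
    using assms unfolding condition_II_def by (elim exE conjE)
  then have T: "\<And>p. prime p \<Longrightarrow> p \<ge> 3 \<Longrightarrow> T_property M1 p \<and> T_property M2 p" by blast
  have sub: "M1 \<subseteq> M" "M2 \<subseteq> M" using component_subset[of _ M "edges M"] comps by auto
  have cover: "m \<in> M1 \<or> m \<in> M2" if "m \<in> M" for m
    using component_cover[OF that, of "edges M"] comps by (metis empty_iff insert_iff)
  interpret M1: pos_set M1 by (rule pos_subset[OF sub(1)])
  interpret M2: pos_set M2 by (rule pos_subset[OF sub(2)])
  have "trivial_units M1"
    by (rule M1.condition_I_trivial_units, rule condition_I_component) (use comps planes T in auto)
  moreover have "unit_on M1 f" using f sub unfolding unit_on_def by blast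
  ultimately have "monomial_on M1 f" unfolding trivial_units_def by blast
  then obtain s1 k1 where f1: "s1 \<in> {1, - 1}" "\<And>m. m \<in> M1 \<Longrightarrow> ev (zeta m) f = of_int s1 * zeta m ^ k1"
    unfolding monomial_on_def by blast
  have "trivial_units M2"
    by (rule M2.condition_I_trivial_units, rule condition_I_component) (use comps planes T in auto)
  moreover have "unit_on M2 f" using f sub unfolding unit_on_def by blast
  ultimately have "monomial_on M2 f" unfolding trivial_units_def by blast
  then obtain s2 k2 where f2: "s2 \<in> {1, - 1}" "\<And>m. m \<in> M2 \<Longrightarrow> ev (zeta m) f = of_int s2 * zeta m ^ k2"
    unfolding monomial_on_def by blast
  have const: "multiplicity 2 m = max_valuation N 2" if "N \<in> p_planes M 2" "m \<in> N" for N m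
  proof -
    have "multiplicity 2 ` N = (\<lambda>_. multiplicity 2 m) ` N"
      by (intro image_cong refl multiplicity_plane[OF that(1) two_is_prime_nat _ that(2)])
    also have "\<dots> = {multiplicity 2 m}" using that(2) by (rule image_constant)
    finally have "multiplicity 2 ` N = {multiplicity 2 m}" .
    then show ?thesis by (simp add: max_valuation_def)
  qed
  define l1 l2 where "l1 = max_valuation M1 2" and "l2 = max_valuation M2 2"
  have v1: "\<And>m. m \<in> M1 \<Longrightarrow> multiplicity 2 m = l1" and v2: "\<And>m. m \<in> M2 \<Longrightarrow> multiplicity 2 m = l2"
    using const planes by (simp_all add: l1_def l2_def)
  have l: "l1 > l2" "l2 \<in> {0, 1}" using val by (simp_all add: l1_def l2_def)
  then have l1: "l1 > 0" by simp
  obtain x1 where x1: "x1 \<in> M1" using component_nonempty[of M1 M "edges M"] comps by auto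
  obtain x2 where x2: "x2 \<in> M2" using component_nonempty[of M2 M "edges M"] comps by auto
  have half1: "zeta m ^ (Lcm M1 div 2) = - 1" "even (Lcm M1)" "\<not> 2 ^ l1 dvd Lcm M1 div 2"
    "2 ^ l1 dvd Lcm M1" if "m \<in> M1" for m
    using zeta_half_Lcm[of M1 l1 m] sub(1) v1 l1 that by blast+
  \<comment> \<open>The exponent on \<open>M1\<close> once the sign there is prescribed to be
    \<open>e\<close>; this freedom is what makes a common sign on both components possible.\<close>
  define k1' where "k1' e = k1 + (if e = s1 then 0 else Lcm M1 div 2)" for e :: int
  have f1': "ev (zeta m) f = of_int e * zeta m ^ k1' e" if "m \<in> M1" "e \<in> {1, - 1}" for m e
    using that f1 half1(1)[OF that(1)] by (auto simp: k1'_def power_add)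
  show "monomial_on M f"
  proof (cases "l2 = 0")
    case True
    have "odd (Lcm M2)"
    proof
      assume "even (Lcm M2)"
      have "Lcm M2 dvd odd_total"
      proof (rule Lcm_least)
        fix x assume x: "x \<in> M2"
        then obtain c where "x = 2 ^ multiplicity 2 x * c" "c dvd odd_total" using odd_part sub(2) by blast
        then show "x dvd odd_total" using v2[OF x] True by simp
      qed
      then show False using \<open>even (Lcm M2)\<close> odd_odd_total dvd_trans by blast
    qed
    then have "gcd (Lcm M1) (Lcm M2) \<noteq> 2" by (metis gcd_dvd2)
    then have "coprime (Lcm M1) (Lcm M2)" using gcd by (simp add: coprime_iff_gcd_eq_1)
    then obtain z where z: "[z = k1' s2] (mod Lcm M1)" "[z = k2] (mod Lcm M2)"
      using binary_chinese_remainder_nat by blast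
    have "ev (zeta m) f = of_int s2 * zeta m ^ z" if "m \<in> M" for m
      using cover[OF that]
    proof
      assume "m \<in> M1" then show ?thesis using f1'[OF _ f2(1)] zeta_cong_Lcm[OF sub(1) _ z(1)] by simp
    next
      assume "m \<in> M2" then show ?thesis using f2(2) zeta_cong_Lcm[OF sub(2) _ z(2)] by simp
    qed
    then show ?thesis using f2(1) unfolding monomial_on_def by blast
  next
    case False
    then have l2: "l2 = 1" and "l2 > 0" using l by simp_all
    have half2: "zeta m ^ (Lcm M2 div 2) = - 1" "even (Lcm M2)" "\<not> 2 ^ l2 dvd Lcm M2 div 2"
      if "m \<in> M2" for m
      using zeta_half_Lcm[of M2 l2 m] sub(2) v2 \<open>l2 > 0\<close> that by blast+
    define a b where "a = Lcm M1 div 2" and "b = Lcm M2 div 2"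
    have ab: "Lcm M1 = 2 * a" "Lcm M2 = 2 * b"
      using half1(2)[OF x1] half2(2)[OF x2] by (simp_all add: a_def b_def)
    have "odd b" using half2(3)[OF x2] l2 by (simp add: b_def)
    have "2 ^ 2 dvd 2 * a" using half1(4)[OF x1] l l2 unfolding ab
      by (metis Suc_1 Suc_leI dvd_trans le_imp_power_dvd)
    then have "even a" by simp
    have "gcd (Lcm M1) (Lcm M2) = 2 * gcd a b" unfolding ab by (simp add: gcd_mult_left)
    then have "coprime a b" using gcd by (auto simp: coprime_iff_gcd_eq_1)
    define k2' where "k2' e = k2 + (if e = s2 then 0 else b)" for e :: int
    have f2': "ev (zeta m) f = of_int e * zeta m ^ k2' e" if "m \<in> M2" "e \<in> {1, - 1}" for m e
      using that f2 half2(1)[OF that(1)] by (auto simp: k2'_def b_def power_add)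
    \<comment> \<open>Changing the sign shifts the exponent on \<open>M2\<close> by
      \<open>b\<close>, which is odd since \<open>l2\<close> = 1, and the exponent on
      \<open>M1\<close> by \<open>a\<close>, which is even since \<open>l1\<close> is at least 2.
      The relative parity flips, so one of the two signs makes the exponents compatible.\<close>
    have "\<exists>e\<in>{1, - 1}. [k1' e = k2' e] (mod 2)"
    proof (rule ccontr)
      assume "\<not> ?thesis"
      then have "\<not> [k1' 1 = k2' 1] (mod 2)" "\<not> [k1' (- 1) = k2' (- 1)] (mod 2)" by auto
      then show False using f1(1) f2(1) \<open>odd b\<close> \<open>even a\<close>
        by (cases "odd k1"; cases "odd k2")
           (auto simp: k1'_def k2'_def a_def[symmetric] cong_def mod_2_eq_odd)
    qed
    then obtain e where e: "e \<in> {1, - 1}" "[k1' e = k2' e] (mod 2)" by blast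
    obtain z where z: "[z = k1' e] (mod Lcm M1)" "[z = k2' e] (mod Lcm M2)"
      using chinese_remainder_parity[OF \<open>coprime a b\<close> e(2)] unfolding ab by blast
    have "ev (zeta m) f = of_int e * zeta m ^ z" if "m \<in> M" for m
      using cover[OF that]
    proof
      assume "m \<in> M1" then show ?thesis using f1'[OF _ e(1)] zeta_cong_Lcm[OF sub(1) _ z(1)] by simp
    next
      assume "m \<in> M2" then show ?thesis using f2'[OF _ e(1)] zeta_cong_Lcm[OF sub(2) _ z(2)] by simp
    qed
    then show ?thesis using e(1) unfolding monomial_on_def by blast
  qed
qed

end

section \<open>Necessity of the graph conditions\<close>

text \<open>The equation \<open>zeta n ^ k = - 1\<close> forces the 2-multiplicity of
  \<open>n\<close> to exceed that of \<open>k\<close> by exactly one, whereas the value 1 at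
  \<open>m\<close> means that \<open>m\<close> divides \<open>k\<close>. The sign pattern of a power
  of t is thus visible in the 2-multiplicities of the orders.\<close>

lemma zeta_power_signs:
  assumes "m > 0" "n > 0" "zeta n ^ k = - 1"
  shows "zeta m ^ k = 1 \<Longrightarrow> multiplicity 2 m < multiplicity 2 n"
    and "zeta m ^ k = - 1 \<Longrightarrow> multiplicity 2 m = multiplicity 2 n"
proof -
  have *: "k > 0 \<and> multiplicity 2 n = Suc (multiplicity 2 k)" if n: "n > 0" "zeta n ^ k = - 1" for n
  proof -
    have nk: "\<not> n dvd k" "n dvd 2 * k" using n zeta_power_eq_minus_1_iff by auto
    then have k: "k > 0" by (auto intro: Nat.gr0I)
    obtain c where c: "n = 2 ^ multiplicity 2 n * c" "odd c"
      using multiplicity_decompose'[of n "2::nat"] n(1) by auto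
    have "c dvd 2 * k" using c(1) nk(2) by (metis dvd_mult_right)
    then have "c dvd k" using c(2) by (simp add: coprime_dvd_mult_right_iff)
    have "\<not> multiplicity 2 n \<le> multiplicity 2 k"
    proof
      assume "multiplicity 2 n \<le> multiplicity 2 k"
      then have "2 ^ multiplicity 2 n dvd k" by (rule multiplicity_dvd')
      then have "2 ^ multiplicity 2 n * c dvd k" using \<open>c dvd k\<close> c(2) by (intro divides_mult) auto
      then show False using nk(1) c(1) by simp
    qed
    moreover have "multiplicity 2 n \<le> multiplicity 2 (2 * k)"
      using nk(2) k by (intro dvd_imp_multiplicity_le) auto
    moreover have "multiplicity 2 (2 * k) = Suc (multiplicity 2 k)"
      using k by (simp add: prime_elem_multiplicity_mult_distrib)
    ultimately show ?thesis using k by simp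
  qed
  { assume "zeta m ^ k = 1"
    then have "m dvd k" using zeta_power_eq_1_iff assms(1) by blast
    then have "multiplicity 2 m \<le> multiplicity 2 k" using *[OF assms(2,3)] by (intro dvd_imp_multiplicity_le) auto
    then show "multiplicity 2 m < multiplicity 2 n" using *[OF assms(2,3)] by simp }
  { assume "zeta m ^ k = - 1"
    then show "multiplicity 2 m = multiplicity 2 n" using *[OF assms(1)] *[OF assms(2,3)] by simp }
qed

lemma zeta_half:
  assumes "t = 2 ^ k * n" "k \<ge> 1" "n > 0"
  shows "zeta t ^ (t div 2) = - 1" and "n dvd t div 2"
proof -
  have e: "t = 2 * (2 ^ (k - 1) * n)" using assms by (cases k) simp_all
  then show "n dvd t div 2" by simp
  have "\<not> t dvd t div 2" using e assms(3) by (auto dest!: dvd_imp_le)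
  moreover have "t dvd 2 * (t div 2)" using e by simp
  ultimately show "zeta t ^ (t div 2) = - 1"
    using zeta_power_eq_minus_1_iff[of t "t div 2"] assms(1,3) by simp
qed

definition opart :: "nat \<Rightarrow> nat" where "opart m = m div 2 ^ multiplicity 2 m"

lemma opart_eq: "m = 2 ^ multiplicity 2 m * opart m"
  unfolding opart_def by (simp add: multiplicity_dvd)

lemma Phis_Un: "finite A \<Longrightarrow> finite B \<Longrightarrow> A \<inter> B = {} \<Longrightarrow> Phis (A \<union> B) = Phis A * Phis B"
  unfolding Phis_def by (rule prod.union_disjoint)

lemma Phis_empty [simp]: "Phis {} = 1" by (simp add: Phis_def)

section \<open>Gluing units over complementary vertex sets\<close>

context pos_set
begin

lemma comb_1_Phis:
  assumes "A \<subseteq> M" "B \<subseteq> M" "A \<inter> B = {}"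
    and "\<And>a b. a \<in> A \<Longrightarrow> b \<in> B \<Longrightarrow> \<not> prime_power_ratio a b \<and> \<not> prime_power_ratio b a"
  shows "comb 1 (Phis A) (Phis B)"
proof -
  have fin: "finite A" "finite B" using assms(1,2) finite_M finite_subset by blast+
  have "comb 1 (Phi a) (Phi b)" if "a \<in> A" "b \<in> B" for a b
    using comb_1_Phi[of a b] that assms pos_M by blast
  then have "comb 1 (Phi a) (Phis B)" if "a \<in> A" for a
    unfolding Phis_def using comb_1_prod[OF fin(2)] that by blast
  then have "comb 1 (Phis B) (Phi a)" if "a \<in> A" for a using that comb_commute by blast
  then have "comb 1 (Phis B) (Phis A)" unfolding Phis_def[of A] using comb_1_prod[OF fin(1)] by blast
  then show ?thesis using comb_commute by blast
qed

lemma glue_values: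
  assumes "A \<subseteq> M" "B \<subseteq> M" "comb (u - v) (Phis A) (Phis B)"
  obtains f where "\<And>m. m \<in> A \<Longrightarrow> ev (zeta m) f = ev (zeta m) u"
    "\<And>m. m \<in> B \<Longrightarrow> ev (zeta m) f = ev (zeta m) v"
proof -
  have fin: "finite A" "finite B" using assms(1,2) finite_M finite_subset by blast+
  have zero: "ev (zeta m) (Phis N) = 0" if "m \<in> N" "N \<subseteq> M" "finite N" for m N
    using \<open>m \<in> N\<close> \<open>N \<subseteq> M\<close> ev_Phis_eq_0_iff[OF \<open>finite N\<close>] pos_M ev_zeta_Phi by (metis subsetD)
  obtain x y where xy: "u - v = Phis A * x + Phis B * y" using assms(3) by (auto simp: comb_def)
  define f where "f = u - Phis A * x"
  have f: "f = v + Phis B * y" using xy by (simp add: f_def algebra_simps)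
  have "ev (zeta m) f = ev (zeta m) u" if "m \<in> A" for m
    using zero[OF that assms(1) fin(1)] by (simp add: f_def)
  moreover have "ev (zeta m) f = ev (zeta m) v" if "m \<in> B" for m
    using zero[OF that assms(2) fin(2)] by (simp add: f)
  ultimately show ?thesis using that by blast
qed

text \<open>The necessary conditions come from here: a polynomial glued from two monomials is a
  unit, and triviality imposes a single monomial on both sides.\<close>

lemma trivial_units_glue:
  assumes triv: "trivial_units M" and A: "A \<subseteq> M"
    and comb: "comb (monom s j - monom s' j') (Phis A) (Phis (M - A))"
    and s: "s \<in> {1, - 1}" "s' \<in> {1, - 1}"
  obtains t k where "t \<in> {1, - 1}"
    "\<And>m. m \<in> A \<Longrightarrow> of_int s * zeta m ^ j = of_int t * zeta m ^ k"
    "\<And>m. m \<in> M - A \<Longrightarrow> of_int s' * zeta m ^ j' = of_int t * zeta m ^ k"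
proof -
  from glue_values[OF A Diff_subset comb] obtain f
    where "\<And>m. m \<in> A \<Longrightarrow> ev (zeta m) f = ev (zeta m) (monom s j)"
      "\<And>m. m \<in> M - A \<Longrightarrow> ev (zeta m) f = ev (zeta m) (monom s' j')" by blast
  then have f: "m \<in> A \<Longrightarrow> ev (zeta m) f = of_int s * zeta m ^ j"
    "m \<in> M - A \<Longrightarrow> ev (zeta m) f = of_int s' * zeta m ^ j'" for m by simp_all
  have "unit_on M f" unfolding unit_on_def
  proof
    fix m assume "m \<in> M"
    then show "\<exists>s\<in>{1, - 1}. \<exists>k. ev (zeta m) f = of_int s * zeta m ^ k"
      using f[of m] s by (cases "m \<in> A") blast+
  qed
  then have "monomial_on M f" using triv unfolding trivial_units_def by blast
  then obtain t k where t: "t \<in> {1, - 1}" and k: "\<And>m. m \<in> M \<Longrightarrow> ev (zeta m) f = of_int t * zeta m ^ k"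
    unfolding monomial_on_def by blast
  have "of_int s * zeta m ^ j = of_int t * zeta m ^ k" if "m \<in> A" for m
    using f(1)[OF that] k[of m] that A by auto
  moreover have "of_int s' * zeta m ^ j' = of_int t * zeta m ^ k" if "m \<in> M - A" for m
    using f(2)[OF that] k[of m] that by auto
  ultimately show ?thesis using that t by blast
qed

text \<open>The two sides can be interchanged, because \<open>f\<close> may be replaced by \<open>- f\<close>.\<close>

lemma trivial_units_sign:
  assumes triv: "trivial_units M" and A: "A \<subseteq> M" and comb: "comb 2 (Phis A) (Phis (M - A))"
  shows "(\<exists>k. (\<forall>m\<in>A. zeta m ^ k = - 1) \<and> (\<forall>m\<in>M - A. zeta m ^ k = 1)) \<or>
    (\<exists>k. (\<forall>m\<in>A. zeta m ^ k = 1) \<and> (\<forall>m\<in>M - A. zeta m ^ k = - 1))"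
proof -
  have "comb (monom (- 1) 0 - monom 1 0) (Phis A) (Phis (M - A))"
    using comb_mult[OF comb, of "- 1"] by (simp add: monom_0 numeral_poly one_pCons)
  from trivial_units_glue[OF triv A this] obtain t :: int and k where t: "t \<in> {1, - 1}"
    and k: "\<And>m. m \<in> A \<Longrightarrow> of_int (- 1) * zeta m ^ 0 = of_int t * zeta m ^ k"
      "\<And>m. m \<in> M - A \<Longrightarrow> of_int 1 * zeta m ^ 0 = of_int t * zeta m ^ k" by blast
  show ?thesis
  proof (cases "t = 1")
    case True then show ?thesis using k by (intro disjI1 exI[of _ k]) auto
  next
    case False
    then have "- 1 = - (zeta m ^ k)" if "m \<in> A" for m using k(1)[OF that] t by simp
    moreover have "zeta m ^ k = - 1" if "m \<in> M - A" for m
    proof -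
      have "1 = - (zeta m ^ k)" using k(2)[OF that] False t by simp
      then show ?thesis by (metis minus_minus)
    qed
    ultimately show ?thesis by (intro disjI2 exI[of _ k]) auto
  qed
qed

text \<open>For a highest \<open>p\<close>-plane \<open>P\<close> on which the \<open>p\<close>-valuation is \<open>l \<ge> 1\<close>, the unit that is
  \<open>t ^ e\<close> on \<open>P\<close> and \<open>1\<close> elsewhere, where \<open>e\<close> has \<open>p\<close>-valuation \<open>l - 1\<close>.\<close>

lemma highest_planes_contradiction:
  assumes con: "card (graph_components M (edges M)) = 1" and triv: "trivial_units M"
    and p: "prime p" "p \<noteq> 2"
    and P: "highest_p_plane M p P" "highest_p_plane M p P'" "P \<noteq> P'"
    and xy: "x \<in> P" "y \<in> P'" "multiplicity p x \<le> multiplicity p y"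
  shows False
proof -
  have PP: "P \<in> p_planes M p" "P' \<in> p_planes M p" using P by (auto simp: highest_p_plane_def)
  have sub: "P \<subseteq> M" "P' \<subseteq> M" using closed_in_plane[OF PP(1)] closed_in_plane[OF PP(2)]
    by (auto simp: closed_in_def)
  have disj: "P \<inter> P' = {}" using PP P(3) component_disjoint unfolding p_planes_def by blast
  define l where "l = multiplicity p x"
  have vP: "multiplicity p m = l" if "m \<in> P" for m
    unfolding l_def by (rule multiplicity_plane[OF PP(1) p(1) that xy(1)])
  \<comment> \<open>For l = 0 no p-edge would touch \<open>P\<close>, and connectedness would make
    \<open>P\<close> all of \<open>M\<close>.\<close>
  have l0: "l > 0"
  proof (rule ccontr)
    assume "\<not> l > 0"
    then have "a \<notin> P" if "(a, b) \<in> p_edges M p" for a b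
      using multiplicity_p_edge[OF that] vP[of a] by auto
    moreover have "b \<notin> P" if "(a, b) \<in> p_edges M p" for a b
      using P(1) that by (auto simp: highest_p_plane_def)
    ultimately have "closed_in M (edges M) P"
      using closed_in_plane[OF PP(1)] by (fastforce simp: closed_in_def)
    then have "P = M" using con xy(1) unfolding connected_iff[OF edges_subset] by blast
    then show False using disj sub xy by blast
  qed
  obtain w where w: "total = p ^ multiplicity p total * w" "\<not> p dvd w"
    using multiplicity_decompose'[of total p] total_pos p(1) by (metis less_irrefl not_prime_unit)
  \<comment> \<open>Here \<open>w\<close> is the part of \<open>total\<close> prime to
    \<open>p\<close>. Every number obtained from an element of \<open>P\<close> by dividing by a
    positive power of \<open>p\<close> divides \<open>e\<close>, whereas p^l does not divide
    \<open>e\<close>.\<close>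
  define e where "e = p ^ (l - 1) * w"
  have quot: "n dvd e" if mn: "m \<in> P" "m = p ^ k * n" "k \<ge> 1" for m n k
  proof -
    obtain c where c: "m = p ^ l * c" using vP[OF mn(1)] multiplicity_dvd[of p m] by auto
    have "\<not> p dvd c"
    proof
      assume "p dvd c"
      then have "p ^ Suc l dvd m" unfolding c by (auto simp: mult_ac)
      then have "Suc l \<le> multiplicity p m"
        using mn(1) sub pos_M p(1) by (intro multiplicity_geI) auto
      then show False using vP[OF mn(1)] by simp
    qed
    have "c dvd m" unfolding c by simp
    then have "c dvd p ^ multiplicity p total * w" using dvd_total[of m] mn(1) sub w(1) dvd_trans by (metis subsetD)
    moreover have "coprime c (p ^ multiplicity p total)"
      using prime_imp_coprime[OF p(1) \<open>\<not> p dvd c\<close>] by (metis coprime_commute coprime_power_left_iff)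
    ultimately have "c dvd w" by (simp add: coprime_dvd_mult_right_iff)
    have "p * n dvd p * (p ^ (l - 1) * c)"
    proof -
      have "p * (p ^ (l - 1) * c) = m" using l0 unfolding c by (cases l) simp_all
      moreover have "p * n dvd p ^ k * n" using mn(3) by (intro mult_dvd_mono) auto
      ultimately show ?thesis using mn(2) by simp
    qed
    then have "n dvd p ^ (l - 1) * c" using p(1) prime_gt_0_nat[of p] by simp
    then show ?thesis unfolding e_def using \<open>c dvd w\<close> by (meson dvd_refl dvd_trans mult_dvd_mono)
  qed
  let ?Q1 = "{q \<in> M - P. q dvd e}" and ?Q2 = "{q \<in> M - P. \<not> q dvd e}"
  have fin: "finite ?Q1" "finite ?Q2" using finite_M by auto
  have "Phis ?Q1 dvd monom 1 e - 1"
    by (rule Phis_dvdI[OF fin(1)]) (use pos_M Phi_dvd_X in auto)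
  then have 1: "comb (monom 1 e - 1) (Phis P) (Phis ?Q1)"
    unfolding comb_commute[of _ "Phis P"] by (rule comb_dvd)
  have 2: "comb 1 (Phis P) (Phis ?Q2)"
  proof (rule comb_1_Phis)
    fix a b assume ab: "a \<in> P" "b \<in> ?Q2"
    then have bM: "b \<in> M - P" by simp
    show "\<not> prime_power_ratio a b \<and> \<not> prime_power_ratio b a"
    proof (intro conjI notI)
      assume "prime_power_ratio a b"
      then obtain q k where q: "prime q" "k \<ge> 1" "a = q ^ k * b" by (auto simp: prime_power_ratio_def)
      then have "q = p" using highest_plane_ratio(1)[OF P(1) q(1,2) ab(1) bM] by blast
      then show False using quot[OF ab(1)] q ab(2) by blast
    next
      assume "prime_power_ratio b a"
      then show False using highest_plane_ratio(2)[OF P(1) _ _ ab(1) bM] by (auto simp: prime_power_ratio_def)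
    qed
  qed (use sub in auto)
  have "Phis (M - P) = Phis ?Q1 * Phis ?Q2"
    by (subst Phis_Un[symmetric, OF fin]) (auto intro: arg_cong[of _ _ Phis])
  then have "comb (monom 1 e - 1) (Phis P) (Phis (M - P))" using comb_mult_right[OF 1 2] by simp
  then have "comb (monom 1 e - monom 1 0) (Phis P) (Phis (M - P))" by (simp add: monom_0 one_pCons)
  from trivial_units_glue[OF triv sub(1) this] obtain s :: int and k where s: "s \<in> {1, - 1}"
    and k: "\<And>m. m \<in> P \<Longrightarrow> of_int 1 * zeta m ^ e = of_int s * zeta m ^ k"
      "\<And>m. m \<in> M - P \<Longrightarrow> of_int 1 * zeta m ^ 0 = of_int s * zeta m ^ k" by blast
  \<comment> \<open>Squaring removes the unknown sign. At \<open>y\<close>, whose p-multiplicity is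
    at least l, it shows that p^l divides 2k; at \<open>x\<close> it gives 2k = 2e modulo p^l. So
    p^l would divide \<open>e\<close>.\<close>
  have sq: "(of_int s * zeta m ^ k)\<^sup>2 = zeta m ^ (2 * k)" for m
    using s by (auto simp: power_mult_distrib simp flip: power_mult simp: mult.commute)
  have odd: "coprime (p ^ l) 2" using p primes_dvd_imp_eq[OF two_is_prime_nat p(1)] by auto
  have "y \<in> M" "y \<notin> P" using xy(2) sub disj by auto
  then have "zeta y ^ (2 * k) = 1" using sq[of y] k(2)[of y] by auto
  then have "y dvd 2 * k" using zeta_power_eq_1_iff pos_M xy(2) sub by blast
  moreover have "p ^ l dvd y" using xy(3) unfolding l_def by (rule multiplicity_dvd')
  ultimately have "p ^ l dvd 2 * k" using dvd_trans by blast
  have "x \<in> M" using xy(1) sub by blast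
  then have "zeta x ^ (2 * k) = (zeta x ^ e)\<^sup>2" using sq[of x] k(1)[of x] xy(1) by simp
  also have "\<dots> = zeta x ^ (2 * e)" by (simp add: mult.commute flip: power_mult)
  finally have "zeta x ^ (2 * k) = zeta x ^ (2 * e)" .
  then have "[2 * k = 2 * e] (mod x)" using zeta_power_eq_iff pos_M xy(1) sub by blast
  then have "[2 * k = 2 * e] (mod p ^ l)"
    by (rule cong_dvd_modulus_nat) (simp add: l_def multiplicity_dvd)
  then have "p ^ l dvd 2 * e" using \<open>p ^ l dvd 2 * k\<close> cong_dvd_iff by blast
  then have "p ^ l dvd e" using odd by (simp add: coprime_dvd_mult_right_iff)
  moreover have "p ^ l = p ^ (l - 1) * p" using l0 by (cases l) simp_all
  ultimately have "p dvd w" unfolding e_def using p(1) prime_gt_0_nat[of p] by simp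
  then show False using w(2) by blast
qed

lemma trivial_units_T_property:
  assumes con: "card (graph_components M (edges M)) = 1" and triv: "trivial_units M"
    and p: "prime p" "p \<ge> 3"
  shows "T_property M p"
proof -
  have ne: "M \<noteq> {}" using con connected_iff[OF edges_subset] by blast
  obtain P where P: "highest_p_plane M p P" "P \<noteq> {}" by (rule highest_plane_exists[OF p(1) ne])
  have "P' = P" if P': "highest_p_plane M p P'" for P'
  proof (rule ccontr)
    assume "P' \<noteq> P"
    have "P' \<noteq> {}" using P' component_nonempty by (auto simp: highest_p_plane_def p_planes_def)
    then obtain x y where "x \<in> P" "y \<in> P'" using P(2) by blast
    moreover have "p \<noteq> 2" using p(2) by simp
    ultimately show False
      using highest_planes_contradiction[OF con triv p(1) _ P(1) P', of x y]
        highest_planes_contradiction[OF con triv p(1) _ P' P(1), of y x] \<open>P' \<noteq> P\<close>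
      by (metis nat_le_linear)
  qed
  then show ?thesis unfolding T_property_def using P(1) by blast
qed

text \<open>On the chain of elements with a given odd part, only the top edge may be a highest \<open>2\<close>-edge,
  hence a set closed under the other edges contains none or all of the elements below the top.\<close>

lemma comb_2_chain:
  assumes C: "closed_in M (edges M - highest_p_edges M 2) C"
    and W: "finite W" "W \<subseteq> M" "\<And>a b. a \<in> W \<Longrightarrow> b \<in> W \<Longrightarrow> a \<le> b \<Longrightarrow> \<exists>k. b = 2 ^ k * a"
    and t: "t \<in> W" "\<And>a. a \<in> W \<Longrightarrow> a \<le> t" "t \<in> C"
  shows "comb 2 (Phis (W \<inter> C)) (Phis (W - C))"
proof (cases "W - C = {}")
  case True
  show ?thesis unfolding True comb_commute[of _ "Phis (W \<inter> C)"] by (simp add: comb_dvd)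
next
  case False
  then obtain y where y: "y \<in> W" "y \<notin> C" by blast
  have below: "\<exists>k. k \<ge> 1 \<and> t = 2 ^ k * a" if a: "a \<in> W" "a \<noteq> t" for a
  proof -
    obtain k where k: "t = 2 ^ k * a" using W(3)[OF a(1) t(1) t(2)[OF a(1)]] by blast
    then have "k \<noteq> 0" using a(2) by (cases k) auto
    then show ?thesis using k by (intro exI[of _ k]) simp
  qed
  have path: "(\<exists>c. (c, a) \<in> p_edges M 2) \<longrightarrow> (a \<in> C \<longleftrightarrow> b \<in> C)" if "(a, b) \<in> (p_edges M 2)\<^sup>+" for a b
    using that
  proof (induction rule: trancl_induct)
    case (base b)
    then show ?case using closed_inD[OF C, of a b] by (auto simp: highest_p_edges_def edges_def)
  next
    case (step b c)
    obtain d where "(d, b) \<in> p_edges M 2" using step.hyps(1) by (meson tranclD2)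
    then have "b \<in> C \<longleftrightarrow> c \<in> C"
      using closed_inD[OF C, of b c] step.hyps(2) by (auto simp: highest_p_edges_def edges_def)
    then show ?case using step.IH by blast
  qed
  have same: "a \<in> C \<longleftrightarrow> b \<in> C" if ab: "a \<in> W" "b \<in> W" "a \<noteq> t" "b \<noteq> t" "b < a" for a b
  proof -
    obtain k where k: "a = 2 ^ k * b" using W(3)[OF ab(2,1)] ab(5) by auto
    have "k \<noteq> 0" using k ab(5) by (cases k) auto
    then have "(a, b) \<in> (p_edges M 2)\<^sup>+"
      using prime_ratio_trancl[OF two_is_prime_nat, of b k] W(2) ab(1,2) k by auto
    moreover obtain i where i: "i \<ge> 1" "t = 2 ^ i * a" using below ab(1,3) by blast
    then have "(t, a) \<in> (p_edges M 2)\<^sup>+"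
      using prime_ratio_trancl[OF two_is_prime_nat, of a i] W(2) ab(1) t(1) by auto
    then have "\<exists>c. (c, a) \<in> p_edges M 2" by (meson tranclD2)
    ultimately show ?thesis using path by blast
  qed
  have "W \<inter> C = {t}"
  proof -
    have "a = t" if a: "a \<in> W" "a \<in> C" for a
    proof (rule ccontr)
      assume "a \<noteq> t"
      moreover have "y \<noteq> t" "a \<noteq> y" using y t(3) a by auto
      ultimately have "a \<in> C \<longleftrightarrow> y \<in> C" using same[of a y] same[of y a] a y by (meson linorder_neqE_nat)
      then show False using a y by blast
    qed
    then show ?thesis using t by blast
  qed
  moreover have t0: "t > 0" using t(1) W(2) pos_M by blast
  obtain k where k: "k \<ge> 1" "t = 2 ^ k * y" using below y t(3) by metis
  \<comment> \<open>With X for the polynomial variable, X^(t/2) + 1 vanishes at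
    \<open>zeta t\<close> and X^(t/2) - 1 at \<open>zeta a\<close> for all \<open>a\<close> in W -
    C; their difference is the constant 2.\<close>
  have "zeta t ^ (t div 2) = - 1" using zeta_half(1)[OF k(2,1)] y W(2) pos_M by blast
  then have 1: "comb (monom 1 (t div 2) + 1) (Phi t) (Phis (W - C))"
    using t0 by (intro comb_dvd) (simp add: Phi_dvd_iff)
  have "Phi a dvd monom 1 (t div 2) - 1" if a: "a \<in> W - C" for a
  proof -
    have "a > 0" using a W(2) pos_M by blast
    obtain k where k: "k \<ge> 1" "t = 2 ^ k * a" using below[of a] a t(3) by blast
    show ?thesis using Phi_dvd_X[OF \<open>a > 0\<close> zeta_half(2)[OF k(2,1) \<open>a > 0\<close>]] .
  qed
  then have "Phis (W - C) dvd monom 1 (t div 2) - 1"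
    using W(1,2) pos_M by (intro Phis_dvdI) auto
  then have 2: "comb (monom 1 (t div 2) - 1) (Phi t) (Phis (W - C))"
    unfolding comb_commute[of _ "Phi t"] by (rule comb_dvd)
  have "comb 2 (Phi t) (Phis (W - C))" using comb_diff[OF 1 2] by simp
  ultimately show ?thesis by (simp add: Phis_def)
qed

text \<open>Numbers with the same odd part form a chain, to which \<open>comb_2_chain\<close>
  applies with \<open>C\<close> or its complement, whichever contains the top. Between
  \<open>C\<close> and its complement, numbers with different odd parts have no prime power ratio,
  since edges for odd primes are never removed; \<open>comb_cross\<close> joins the pieces.\<close>

lemma comb_2_closed:
  assumes C: "closed_in M (edges M - highest_p_edges M 2) C"
  shows "comb 2 (Phis C) (Phis (M - C))"
proof -
  let ?E = "edges M - highest_p_edges M 2"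
  have sub: "?E \<subseteq> M \<times> M" using edges_subset by blast
  have C': "closed_in M ?E (M - C)" by (rule closed_in_Diff[OF sub C])
  have CM: "C \<subseteq> M" using C by (simp add: closed_in_def)
  define X where "X W = {m \<in> C. opart m \<in> W}" for W
  define Y where "Y W = {m \<in> M - C. opart m \<in> W}" for W
  have fin: "finite (X W)" "finite (Y W)" for W
    using finite_subset[OF _ finite_M, of "X W"] finite_subset[OF _ finite_M, of "Y W"] CM
    by (auto simp: X_def Y_def)
  have XM: "X W \<subseteq> M" "Y W \<subseteq> M" for W using CM by (auto simp: X_def Y_def)
  have single: "comb 2 (Phis (X {r})) (Phis (Y {r}))" for r
  proof -
    define W where "W = {m \<in> M. opart m = r}"
    have XW: "W \<inter> C = X {r}" "W - C = Y {r}" "W \<inter> (M - C) = Y {r}" "W - (M - C) = X {r}"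
      using CM by (auto simp: W_def X_def Y_def)
    have W: "finite W" "W \<subseteq> M" using finite_M by (auto simp: W_def)
    have chain: "\<exists>k. b = 2 ^ k * a" if ab: "a \<in> W" "b \<in> W" "a \<le> b" for a b
    proof -
      have a: "a = 2 ^ multiplicity 2 a * r" and b: "b = 2 ^ multiplicity 2 b * r"
        using opart_eq[of a] opart_eq[of b] ab by (auto simp: W_def)
      have "a > 0" using ab(1) W(2) pos_M by blast
      then have "r > 0" by (metis a mult_0_right neq0_conv)
      then have "(2::nat) ^ multiplicity 2 a \<le> 2 ^ multiplicity 2 b" using a b ab(3)
        by (metis mult_le_cancel2)
      then have "multiplicity 2 a \<le> multiplicity 2 b" by simp
      then have "b = 2 ^ (multiplicity 2 b - multiplicity 2 a) * a"
        using b by (subst a) (simp flip: mult.assoc power_add)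
      then show ?thesis by blast
    qed
    show ?thesis
    proof (cases "W = {}")
      case True
      then have "X {r} = {}" using XW(1) by blast
      then show ?thesis by (simp add: comb_dvd)
    next
      case False
      define t where "t = Max W"
      have t: "t \<in> W" "\<And>a. a \<in> W \<Longrightarrow> a \<le> t" using False W(1) by (auto simp: t_def)
      show ?thesis
      proof (cases "t \<in> C")
        case True
        show ?thesis using comb_2_chain[OF C W chain t True] unfolding XW .
      next
        case False
        then have "t \<in> M - C" using t(1) W(2) by blast
        from comb_2_chain[OF C' W chain t this] show ?thesis
          unfolding XW using comb_commute by blast
      qed
    qed
  qed
  have cross: "comb 1 (Phis (X U)) (Phis (Y V))" if UV: "U \<inter> V = {}" for U V
  proof (rule comb_1_Phis[OF XM])
    show "X U \<inter> Y V = {}" by (auto simp: X_def Y_def)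
    have ratio: False if ab: "prime_power_ratio a b" "a \<in> M" "b \<in> M" "opart a \<noteq> opart b"
      "a \<in> C \<longleftrightarrow> b \<notin> C" for a b
    proof -
      obtain q k where q: "prime q" "k \<ge> 1" "a = q ^ k * b" using ab(1) by (auto simp: prime_power_ratio_def)
      have t: "(a, b) \<in> (p_edges M q)\<^sup>+" using prime_ratio_trancl q ab(2,3) by blast
      show False
      proof (cases "q = 2")
        case True
        have "multiplicity 2 a = k + multiplicity 2 b"
          using pos_M[OF ab(3)] q(3) True by (simp add: prime_elem_multiplicity_mult_distrib multiplicity_same_power)
        then have "opart a = opart b" unfolding opart_def using q(3) True by (simp add: power_add div_mult2_eq)
        then show False using ab(4) by blast
      next
        case False
        have edge: "x \<in> C \<longleftrightarrow> y \<in> C" if "(x, y) \<in> p_edges M q" for x y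
        proof -
          have "(x, y) \<in> edges M - p_edges M 2" using that edges_Diff_iff False by blast
          then have "(x, y) \<in> ?E" by (auto simp: highest_p_edges_def)
          then show ?thesis by (rule closed_inD[OF C])
        qed
        have "a \<in> C \<longleftrightarrow> b \<in> C" using t by (induction rule: trancl_induct) (use edge in blast)+
        then show False using ab(5) by blast
      qed
    qed
    show "\<not> prime_power_ratio a b \<and> \<not> prime_power_ratio b a" if "a \<in> X U" "b \<in> Y V" for a b
    proof -
      have "opart a \<noteq> opart b" "a \<in> M" "b \<in> M" "a \<in> C" "b \<notin> C"
        using that UV CM by (auto simp: X_def Y_def)
      then show ?thesis using ratio[of a b] ratio[of b a] by metis
    qed
  qed
  have "comb 2 (Phis (X W)) (Phis (Y W))" if "finite W" for W
    using that
  proof (induction W)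
    case empty
    have "X {} = {}" by (simp add: X_def)
    then show ?case by (simp add: comb_dvd)
  next
    case (insert r W)
    have "X (insert r W) = X W \<union> X {r}" "Y (insert r W) = Y W \<union> Y {r}" by (auto simp: X_def Y_def)
    moreover have "X W \<inter> X {r} = {}" "Y W \<inter> Y {r} = {}" using insert.hyps by (auto simp: X_def Y_def)
    ultimately have "Phis (X (insert r W)) = Phis (X W) * Phis (X {r})"
      "Phis (Y (insert r W)) = Phis (Y W) * Phis (Y {r})"
      using Phis_Un fin by metis+
    moreover have "W \<inter> {r} = {}" "{r} \<inter> W = {}" using insert.hyps by auto
    ultimately show ?case using comb_cross[OF insert.IH single cross cross] by simp
  qed
  moreover have "X (opart ` M) = C" "Y (opart ` M) = M - C" using CM by (auto simp: X_def Y_def)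
  ultimately show ?thesis using finite_M by (metis finite_imageI)
qed

text \<open>Each component can be given the sign opposite to that of all others. By
  \<open>zeta_power_signs\<close>, its elements then have larger 2-multiplicity than all others, or
  smaller than all others while these share one value. With three components this cannot hold for
  two of them.\<close>

lemma trivial_units_S2:
  assumes triv: "trivial_units M" and ne: "M \<noteq> {}"
  shows "S2_property M"
proof (rule ccontr)
  let ?E = "edges M - highest_p_edges M 2"
  have sub: "?E \<subseteq> M \<times> M" using edges_subset by blast
  assume "\<not> S2_property M"
  moreover have "graph_components M ?E \<noteq> {}" using ne component_cover by (metis ex_in_conv)
  then have "card (graph_components M ?E) > 0"
    using finite_components[OF finite_M] by (simp add: card_gt_0_iff)
  ultimately have "3 \<le> card (graph_components M ?E)" by (auto simp: S2_property_def)
  then obtain T where T: "T \<subseteq> graph_components M ?E" "card T = 3" using obtain_subset_with_card_n by metis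
  then obtain C1 C2 C3 where Ts: "T = {C1, C2, C3}" "C1 \<noteq> C2" "C2 \<noteq> C3" "C1 \<noteq> C3"
    by (auto simp: card_3_iff)
  have comps: "C1 \<in> graph_components M ?E" "C2 \<in> graph_components M ?E" "C3 \<in> graph_components M ?E"
    using T(1) Ts(1) by auto
  obtain x1 where x1: "x1 \<in> C1" using component_nonempty[OF comps(1)] by blast
  obtain x2 where x2: "x2 \<in> C2" using component_nonempty[OF comps(2)] by blast
  obtain x3 where x3: "x3 \<in> C3" using component_nonempty[OF comps(3)] by blast
  note x = x1 x2 x3
  have xM: "x1 \<in> M" "x2 \<in> M" "x3 \<in> M" using comps x component_subset by blast+
  have sign: "(\<exists>k. zeta x ^ k = - 1 \<and> (\<forall>m\<in>{y, z}. zeta m ^ k = 1)) \<or>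
      (\<exists>k. zeta x ^ k = 1 \<and> (\<forall>m\<in>{y, z}. zeta m ^ k = - 1))"
    if C: "C \<in> graph_components M ?E" "x \<in> C" "y \<in> M - C" "z \<in> M - C" for C x y z
  proof -
    have cl: "closed_in M ?E C" by (rule component_closed[OF sub C(1)])
    have "C \<subseteq> M" by (rule component_subset[OF C(1)])
    from trivial_units_sign[OF triv this comb_2_closed[OF cl]] show ?thesis using C(2-4) by auto
  qed
  have val: "(multiplicity 2 y < multiplicity 2 x \<and> multiplicity 2 z < multiplicity 2 x) \<or>
      (multiplicity 2 x < multiplicity 2 y \<and> multiplicity 2 y = multiplicity 2 z)"
    if C: "C \<in> graph_components M ?E" "x \<in> C" "y \<in> M - C" "z \<in> M - C" for C x y z
  proof -
    have pos: "x > 0" "y > 0" "z > 0" using C component_subset[OF C(1)] pos_M by auto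
    from sign[OF C] show ?thesis
    proof (elim disjE exE conjE)
      fix k assume "zeta x ^ k = - 1" "\<forall>m\<in>{y, z}. zeta m ^ k = 1"
      then show ?thesis using zeta_power_signs(1)[OF pos(2,1)] zeta_power_signs(1)[OF pos(3,1)] by blast
    next
      fix k assume "zeta x ^ k = 1" "\<forall>m\<in>{y, z}. zeta m ^ k = - 1"
      then show ?thesis using zeta_power_signs(1)[OF pos(1,2)] zeta_power_signs(2)[OF pos(2,3)] by blast
    qed
  qed
  have "x2 \<notin> C1" "x3 \<notin> C1" "x1 \<notin> C2" "x3 \<notin> C2"
    using comps x Ts component_disjoint by metis+
  then show False
    using val[OF comps(1) x(1), of x2 x3] val[OF comps(2) x(2), of x1 x3] xM by auto
qed

section \<open>Disconnected graphs\<close>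

lemma closed_comb_1:
  assumes "closed_in M (edges M) A" shows "comb 1 (Phis A) (Phis (M - A))"
proof (rule comb_1_Phis)
  show AM: "A \<subseteq> M" using assms by (simp add: closed_in_def)
  fix a b assume ab: "a \<in> A" "b \<in> M - A"
  then have M: "a \<in> M" "b \<in> M" using AM by auto
  show "\<not> prime_power_ratio a b \<and> \<not> prime_power_ratio b a"
    using closed_in_ratio[OF assms _ _ M(1)] closed_in_ratio[OF assms _ _ M(2)] ab M
    unfolding prime_power_ratio_def by blast
qed blast+

text \<open>A unit on \<open>A\<close> extends to \<open>M\<close> by the value 1 outside
  \<open>A\<close>.\<close>

lemma trivial_units_closed:
  assumes triv: "trivial_units M" and A: "closed_in M (edges M) A"
  shows "trivial_units A"
  unfolding trivial_units_def
proof (intro allI impI)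
  fix f assume f: "unit_on A f"
  have AM: "A \<subseteq> M" by (rule closed_in_subset[OF A])
  have "comb (f - 1) (Phis A) (Phis (M - A))" by (rule comb_1[OF closed_comb_1[OF A]])
  from glue_values[OF AM Diff_subset this] obtain g where g: "\<And>m. m \<in> A \<Longrightarrow> ev (zeta m) g = ev (zeta m) f"
    "\<And>m. m \<in> M - A \<Longrightarrow> ev (zeta m) g = ev (zeta m) 1" by blast
  have "unit_on M g" unfolding unit_on_def
  proof
    fix m assume m: "m \<in> M"
    show "\<exists>s\<in>{1, - 1}. \<exists>k. ev (zeta m) g = of_int s * zeta m ^ k"
    proof (cases "m \<in> A")
      case True then show ?thesis using f g(1) unfolding unit_on_def by simp
    next
      case False then show ?thesis using g(2)[of m] m by (intro bexI[of _ 1] exI[of _ 0]) auto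
    qed
  qed
  then have "monomial_on M g" using triv unfolding trivial_units_def by blast
  then show "monomial_on A f" using g(1) AM unfolding monomial_on_def by (metis subsetD)
qed

text \<open>The sign pattern given by \<open>k\<close> makes the 2-multiplicity constant on
  \<open>A\<close> and smaller outside. The remaining claims come from a second unit, which is t on
  \<open>A\<close> and 1 elsewhere.\<close>

lemma split_valuations:
  assumes triv: "trivial_units M" and A: "closed_in M (edges M) A" and ne: "A \<noteq> {}" "A \<noteq> M"
    and k: "\<And>m. m \<in> A \<Longrightarrow> zeta m ^ k = - 1" "\<And>m. m \<in> M - A \<Longrightarrow> zeta m ^ k = 1"
  shows "\<exists>l l'. l > l' \<and> l' \<in> {0, 1} \<and> (\<forall>m\<in>A. multiplicity 2 m = l) \<and> (\<forall>m\<in>M - A. multiplicity 2 m = l')"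
    and "gcd (Lcm A) (Lcm (M - A)) \<in> {1, 2}"
proof -
  have AM: "A \<subseteq> M" by (rule closed_in_subset[OF A])
  obtain x where x: "x \<in> A" using ne by blast
  obtain y where y: "y \<in> M - A" using ne AM by blast
  define l where "l = multiplicity 2 x"
  have vA: "multiplicity 2 m = l" if "m \<in> A" for m
    unfolding l_def using zeta_power_signs(2)[of m x k] k(1) that x AM pos_M by blast
  have vB: "multiplicity 2 m < l" if "m \<in> M - A" for m
    unfolding l_def using zeta_power_signs(1)[of m x k] k that x AM pos_M by blast
  have l0: "l > 0" using vB[OF y] by simp
  have "comb (monom 1 1 - monom 1 0) (Phis A) (Phis (M - A))" by (rule comb_1[OF closed_comb_1[OF A]])
  from trivial_units_glue[OF triv AM this] obtain s :: int and j0 where "s \<in> {1, - 1}"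
    and j0: "\<And>m. m \<in> A \<Longrightarrow> of_int 1 * zeta m ^ 1 = of_int s * zeta m ^ j0"
      "\<And>m. m \<in> M - A \<Longrightarrow> of_int 1 * zeta m ^ 0 = of_int s * zeta m ^ j0" by blast
  then have s: "s = 1 \<or> s = - 1" by simp
  \<comment> \<open>The summand makes \<open>j\<close> positive, so that \<open>2 * j - 2\<close>
    below is not truncated.\<close>
  define j where "j = j0 + total"
  have "j > 0" using total_pos by (simp add: j_def)
  have j: "zeta m ^ j = zeta m ^ j0" if "m \<in> M" for m
    using zeta_total[OF that, of 1] by (simp add: j_def power_add)
  have jA: "zeta m = of_int s * zeta m ^ j" if "m \<in> A" for m using j0(1)[OF that] j[of m] that AM by auto
  have jB: "of_int s * zeta m ^ j = 1" if "m \<in> M - A" for m using j0(2)[OF that] j[of m] that by auto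
  have sq: "(of_int s * zeta m ^ j)\<^sup>2 = zeta m ^ (2 * j)" for m
    using s by (auto simp: power_mult_distrib simp flip: power_mult simp: mult.commute)
  \<comment> \<open>The square of the second unit is free of the sign \<open>s\<close>: it gives 2j
    = 0 modulo the orders outside \<open>A\<close> and 2j = 2 modulo those in \<open>A\<close>, so
    the gcd divides 2.\<close>
  have "Lcm (M - A) dvd 2 * j"
  proof (rule Lcm_least)
    fix m assume m: "m \<in> M - A"
    have "zeta m ^ (2 * j) = 1" using sq[of m] unfolding jB[OF m] by simp
    then show "m dvd 2 * j" using zeta_power_eq_1_iff pos_M m by blast
  qed
  moreover have "Lcm A dvd 2 * j - 2"
  proof (rule Lcm_least)
    fix m assume m: "m \<in> A"
    have "(zeta m)\<^sup>2 = zeta m ^ (2 * j)" using sq[of m] jA[OF m] by simp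
    then have "[2 = 2 * j] (mod m)" using zeta_power_eq_iff pos_M m AM by blast
    then have "[2 * j = 2] (mod m)" by (rule cong_sym)
    then show "m dvd 2 * j - 2" using \<open>j > 0\<close> cong_altdef_nat[of 2 "2 * j" m] by simp
  qed
  ultimately have "gcd (Lcm A) (Lcm (M - A)) dvd 2 * j - (2 * j - 2)"
    by (meson dvd_diff_nat dvd_trans gcd_dvd1 gcd_dvd2)
  then have g2: "gcd (Lcm A) (Lcm (M - A)) dvd 2" using \<open>j > 0\<close> by simp
  then show "gcd (Lcm A) (Lcm (M - A)) \<in> {1, 2}"
    using two_is_prime_nat unfolding prime_nat_iff by blast
  have "\<not> multiplicity 2 m < multiplicity 2 n" if mn: "m \<in> M - A" "n \<in> M - A" for m n
  proof
    assume less: "multiplicity 2 m < multiplicity 2 n"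
    \<comment> \<open>With s = -1 both \<open>zeta m ^ j\<close> and \<open>zeta n ^ j\<close> would
      be -1, which forces equal 2-multiplicities. For s = 1 the even number \<open>n\<close> divides
      \<open>j\<close>, although j = 1 modulo the even number \<open>x\<close>.\<close>
    have "s = 1"
    proof (rule ccontr)
      assume "s \<noteq> 1"
      then have "- (zeta m ^ j) = 1" "- (zeta n ^ j) = 1" using s jB[OF mn(1)] jB[OF mn(2)] by auto
      then have "zeta m ^ j = - 1" "zeta n ^ j = - 1" by (metis minus_minus)+
      then show False using zeta_power_signs(2)[of m n j] pos_M mn less by auto
    qed
    then have "n dvd j" using jB[OF mn(2)] zeta_power_eq_1_iff pos_M mn(2) by auto
    moreover have "2 dvd n" using less by (metis multiplicity_eq_zero_iff not_less_zero not_dvd_imp_multiplicity_0)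
    ultimately have "even j" using dvd_trans by blast
    have "zeta x ^ 1 = zeta x ^ j" using jA[OF x] \<open>s = 1\<close> by simp
    then have "[1 = j] (mod x)" using zeta_power_eq_iff pos_M x AM by blast
    moreover have "2 dvd x" using l0 unfolding l_def
      by (metis less_irrefl not_dvd_imp_multiplicity_0)
    ultimately have "[1 = j] (mod 2)" by (rule cong_dvd_modulus_nat)
    then show False using \<open>even j\<close> by (simp add: cong_def mod_2_eq_odd)
  qed
  then have cB: "multiplicity 2 m = multiplicity 2 y" if "m \<in> M - A" for m
    using that y by (meson linorder_neqE_nat)
  have "multiplicity 2 y \<le> 1"
  proof (rule ccontr)
    assume "\<not> multiplicity 2 y \<le> 1"
    then have "2 \<le> multiplicity 2 y" "2 \<le> multiplicity 2 x" using vB[OF y] by (simp_all add: l_def)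
    then have "2 ^ 2 dvd y" "2 ^ 2 dvd x" by (blast intro: multiplicity_dvd')+
    then have "2 ^ 2 dvd Lcm A" "2 ^ 2 dvd Lcm (M - A)" using x y by (meson dvd_Lcm dvd_trans)+
    then have "2 ^ 2 dvd gcd (Lcm A) (Lcm (M - A))" by (rule gcd_greatest)
    then have "2 ^ 2 dvd (2::nat)" using g2 dvd_trans by blast
    then show False by simp
  qed
  then have "multiplicity 2 y \<in> {0, 1}" by auto
  then show "\<exists>l l'. l > l' \<and> l' \<in> {0, 1} \<and> (\<forall>m\<in>A. multiplicity 2 m = l) \<and> (\<forall>m\<in>M - A. multiplicity 2 m = l')"
    using vA cB vB[OF y] by blast
qed

lemma split_valuations_differ:
  assumes triv: "trivial_units M" and A: "closed_in M (edges M) A" and ne: "A \<noteq> {}" "A \<noteq> M"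
  shows "\<exists>l l'. l \<noteq> l' \<and> (\<forall>m\<in>A. multiplicity 2 m = l) \<and> (\<forall>m\<in>M - A. multiplicity 2 m = l')"
  using trivial_units_sign[OF triv closed_in_subset[OF A] comb_1[OF closed_comb_1[OF A]]]
proof (elim disjE exE conjE)
  fix k assume "\<forall>m\<in>A. zeta m ^ k = - 1" "\<forall>m\<in>M - A. zeta m ^ k = 1"
  then show ?thesis using split_valuations(1)[OF triv A ne, of k] by (metis less_irrefl)
next
  fix k assume k: "\<forall>m\<in>A. zeta m ^ k = 1" "\<forall>m\<in>M - A. zeta m ^ k = - 1"
  have AM: "A \<subseteq> M" by (rule closed_in_subset[OF A])
  then have AA: "M - (M - A) = A" by blast
  have "closed_in M (edges M) (M - A)" by (rule closed_in_Diff[OF edges_subset A])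
  moreover have "M - A \<noteq> {}" "M - A \<noteq> M" using ne AM by blast+
  ultimately show ?thesis using split_valuations(1)[OF triv, of "M - A" k] k unfolding AA
    by (metis less_irrefl)
qed

text \<open>If a component \<open>C\<close> were smaller than \<open>A\<close> or its complement,
  two vertices outside \<open>C\<close>, one on each side, would have the same 2-multiplicity by
  \<open>split_valuations_differ\<close>, although the two sides have different ones. Constancy on
  each side also excludes 2-edges, so the components are the 2-planes.\<close>

lemma split_condition_II:
  assumes triv: "trivial_units M" and A: "closed_in M (edges M) A" and ne: "A \<noteq> {}" "A \<noteq> M"
    and k: "\<And>m. m \<in> A \<Longrightarrow> zeta m ^ k = - 1" "\<And>m. m \<in> M - A \<Longrightarrow> zeta m ^ k = 1"
  shows "condition_II M"
proof -
  let ?B = "M - A"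
  have AM: "A \<subseteq> M" by (rule closed_in_subset[OF A])
  have B: "closed_in M (edges M) ?B" by (rule closed_in_Diff[OF edges_subset A])
  have neB: "?B \<noteq> {}" using ne AM by blast
  obtain l l' where l: "l > l'" "l' \<in> {0, 1}" and vA: "\<And>m. m \<in> A \<Longrightarrow> multiplicity 2 m = l"
    and vB: "\<And>m. m \<in> ?B \<Longrightarrow> multiplicity 2 m = l'"
    using split_valuations(1)[OF triv A ne k] by blast
  have mixed: "multiplicity 2 a = multiplicity 2 b"
    if X: "closed_in M (edges M) X" "X \<noteq> {}" "X \<noteq> M" "a \<in> M - X" "b \<in> M - X" for X a b
    using split_valuations_differ[OF triv X(1-3)] X(4,5) by metis
  have comp: "C = X" if C: "C \<in> graph_components M (edges M)" "C \<inter> X \<noteq> {}" and X: "X = A \<or> X = ?B" for C X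
  proof -
    have Xc: "closed_in M (edges M) X" using X A B by blast
    have CX: "C \<subseteq> X" using component_minimal[OF C(1) Xc] C(2) by blast
    have Cc: "closed_in M (edges M) C" "C \<noteq> {}"
      using component_closed[OF edges_subset C(1)] component_nonempty[OF C(1)] by blast+
    show ?thesis
    proof (rule ccontr)
      assume "C \<noteq> X"
      then obtain a where a: "a \<in> X" "a \<notin> C" using CX by blast
      have "M - X \<noteq> {}" using X ne neB AM by blast
      then obtain b where b: "b \<in> M - X" by blast
      have "a \<in> M" "C \<noteq> M" using a X AM by blast+
      then have "multiplicity 2 a = multiplicity 2 b" using mixed[OF Cc, of a b] a b CX by blast
      then show False using X a(1) b vA vB l(1) AM by (metis Diff_iff less_irrefl)
    qed
  qed
  have gc: "graph_components M (edges M) = {A, ?B}"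
  proof
    show "graph_components M (edges M) \<subseteq> {A, ?B}"
    proof
      fix C assume C: "C \<in> graph_components M (edges M)"
      obtain x where "x \<in> C" "x \<in> M" using component_nonempty[OF C] component_subset[OF C] by blast
      then have "C \<inter> A \<noteq> {} \<or> C \<inter> ?B \<noteq> {}" by blast
      then have "C = A \<or> C = ?B" using comp[OF C, of A] comp[OF C, of ?B] by argo
      then show "C \<in> {A, ?B}" by simp
    qed
    have "X \<in> graph_components M (edges M)" if X: "X = A \<or> X = ?B" for X
    proof -
      obtain x where x: "x \<in> X" "x \<in> M" using X ne neB AM by blast
      obtain C where C: "C \<in> graph_components M (edges M)" "x \<in> C" using x(2) by (rule component_cover)
      then have "C = X" using comp[OF C(1) _ X] x(1) by blast
      then show ?thesis using C(1) by simp
    qed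
    then show "{A, ?B} \<subseteq> graph_components M (edges M)" by blast
  qed
  have "p_edges M 2 = {}"
  proof (rule equals0I)
    fix e assume e: "e \<in> p_edges M 2"
    obtain a b where ab: "e = (a, b)" by force
    have "(a, b) \<in> edges M" using e ab by (auto simp: edges_def)
    then have "a \<in> A \<longleftrightarrow> b \<in> A" by (rule closed_inD[OF A])
    moreover have "a \<in> M" "b \<in> M" using e ab p_edges_subset by auto
    ultimately have "multiplicity 2 a = multiplicity 2 b" using vA vB by (metis Diff_iff)
    then show False using multiplicity_p_edge e ab by (metis less_irrefl)
  qed
  then have planes: "p_planes M 2 = {A, ?B}" using gc by (simp add: p_planes_def)
  have T: "T_property X p" if X: "X = A \<or> X = ?B" and p: "prime p" "p \<ge> 3" for X p
  proof -
    have Xc: "closed_in M (edges M) X" using X A B by blast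
    interpret X: pos_set X by (rule pos_subset) (use Xc in \<open>simp add: closed_in_def\<close>)
    show ?thesis
      by (rule X.trivial_units_T_property[OF component_connected trivial_units_closed[OF triv Xc] p])
         (use gc X in blast)
  qed
  have mv: "max_valuation X 2 = c" if X: "X \<noteq> {}" "\<And>m. m \<in> X \<Longrightarrow> multiplicity 2 m = c" for X c
  proof -
    obtain x where x: "x \<in> X" using X(1) by blast
    have "multiplicity 2 ` X = (\<lambda>_. c) ` X" by (intro image_cong refl X(2))
    also have "\<dots> = {c}" using x by (rule image_constant)
    finally show ?thesis by (simp add: max_valuation_def)
  qed
  have "max_valuation A 2 = l" by (rule mv[OF ne(1) vA])
  moreover have "max_valuation ?B 2 = l'" by (rule mv[OF neB vB])
  moreover have "gcd (Lcm A) (Lcm ?B) \<in> {1, 2}" by (rule split_valuations(2)[OF triv A ne k])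
  moreover have "A \<noteq> ?B" using ne by blast
  ultimately show ?thesis
    unfolding condition_II_def using gc planes T l by (intro exI[of _ A] exI[of _ ?B]) auto
qed

text \<open>The empty set has only trivial units but satisfies neither condition, because its graph
  has no components.\<close>

lemma trivial_units_iff:
  assumes "M \<noteq> {}"
  shows "trivial_units M \<longleftrightarrow> condition_I M \<or> condition_II M"
proof
  assume triv: "trivial_units M"
  show "condition_I M \<or> condition_II M"
  proof (cases "card (graph_components M (edges M)) = 1")
    case True
    then show ?thesis
      using trivial_units_T_property[OF True triv] trivial_units_S2[OF triv assms]
      by (simp add: condition_I_def)
  next
    case False
    then obtain A where A: "closed_in M (edges M) A" "A \<noteq> {}" "A \<noteq> M"
      using assms connected_iff[OF edges_subset] by blast
    have AM: "A \<subseteq> M" by (rule closed_in_subset[OF A(1)])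
    then have AA: "M - (M - A) = A" by blast
    from trivial_units_sign[OF triv AM comb_1[OF closed_comb_1[OF A(1)]]] have "condition_II M"
    proof (elim disjE exE conjE)
      fix k assume "\<forall>m\<in>A. zeta m ^ k = - 1" "\<forall>m\<in>M - A. zeta m ^ k = 1"
      then show ?thesis using split_condition_II[OF triv A, of k] by blast
    next
      fix k assume k: "\<forall>m\<in>A. zeta m ^ k = 1" "\<forall>m\<in>M - A. zeta m ^ k = - 1"
      have "closed_in M (edges M) (M - A)" by (rule closed_in_Diff[OF edges_subset A(1)])
      moreover have "M - A \<noteq> {}" "M - A \<noteq> M" using A AM by blast+
      ultimately show ?thesis using split_condition_II[OF triv, of "M - A" k] k unfolding AA by blast
    qed
    then show ?thesis ..
  qed
next
  assume "condition_I M \<or> condition_II M"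
  then show "trivial_units M" using condition_I_trivial_units condition_II_trivial_units by blast
qed

end

section \<open>Lattices with a cyclic endomorphism\<close>

text \<open>Turns the module into one over polynomials, the variable acting as \<open>T\<close>. It
  is instantiated with the lattice over the integers and with the complexification over the complex
  numbers.\<close>

locale module_endo = module scale
  for scale :: "'r::comm_ring_1 \<Rightarrow> 'b::ab_group_add \<Rightarrow> 'b" +
  fixes T :: "'b \<Rightarrow> 'b"
  assumes T_add: "T (x + y) = T x + T y" and T_scale: "T (scale c x) = scale c (T x)"
begin

definition act :: "'r poly \<Rightarrow> 'b \<Rightarrow> 'b" where
  "act f x = fold_coeffs (\<lambda>a y. scale a x + T y) f 0"

lemma T_0 [simp]: "T 0 = 0" using T_add[of 0 0] by simp

lemma act_0 [simp]: "act 0 x = 0" by (simp add: act_def)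

lemma act_pCons: "act (pCons a f) x = scale a x + T (act f x)"
  by (cases "a = 0 \<and> f = 0") (auto simp: act_def)

lemma act_const [simp]: "act [:a:] x = scale a x" by (simp add: act_pCons)

lemma act_1 [simp]: "act 1 x = x" by (simp add: one_pCons)

lemma act_add: "act (f + g) x = act f x + act g x"
  by (induction f g rule: poly_induct2) (simp_all add: act_pCons T_add scale_left_distrib)

lemma act_smult: "act (smult c f) x = scale c (act f x)"
  by (induction f) (simp_all add: act_pCons T_scale scale_right_distrib)

lemma act_minus: "act (- f) x = - act f x"
  using act_smult[of "- 1" f x] by simp

lemma act_diff: "act (f - g) x = act f x - act g x"
  using act_add[of f "- g" x] by (simp add: act_minus)

lemma act_T: "act f (T x) = T (act f x)"
  by (induction f) (simp_all add: act_pCons T_scale T_add)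

lemma act_mult: "act (f * g) x = act f (act g x)"
  by (induction f) (simp_all add: act_pCons act_add act_smult act_T)

lemma act_commute: "act f (act g x) = act g (act f x)"
  by (metis act_mult mult.commute)

lemma act_add_right: "act f (x + y) = act f x + act f y"
  by (induction f) (simp_all add: act_pCons T_add scale_right_distrib)

lemma act_scale_right: "act f (scale c x) = scale c (act f x)"
  by (induction f) (simp_all add: act_pCons T_scale scale_right_distrib mult.commute)

lemma act_sum: "act (sum f A) x = (\<Sum>a\<in>A. act (f a) x)"
  by (induction A rule: infinite_finite_induct) (simp_all add: act_add)

lemma act_monom: "act (monom c k) x = scale c ((T ^^ k) x)"
  by (induction k) (simp_all add: monom_0 monom_Suc act_pCons T_scale)

lemma act_altdef:
  assumes "degree f < n" shows "act f x = (\<Sum>i<n. scale (coeff f i) ((T ^^ i) x))"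
proof -
  have "f = (\<Sum>i\<le>n - 1. monom (coeff f i) i)" using assms by (subst poly_as_sum_of_monoms') auto
  also have "{..n - 1} = {..<n}" using assms by auto
  finally have "act f x = act (\<Sum>i<n. monom (coeff f i) i) x" by simp
  then show ?thesis by (simp add: act_sum act_monom)
qed

lemma act_eigenvector:
  assumes "T v = scale c v" shows "act f v = scale (poly f c) v"
  by (induction f) (simp_all add: act_pCons T_scale assms scale_left_distrib mult.commute)

end

lemma additive_zscale:
  assumes "additive h" shows "h (zscale k x) = zscale k (h x)"
  by (simp add: zscale_def additive.sum[OF assms] additive.minus[OF assms])

lemma module_endo_zscale: "additive h \<Longrightarrow> module_endo zscale h"
  by unfold_locales (simp_all add: additive_zscale additive.add)

lemma module_endo_cscale:
  assumes "additive h" shows "module_endo cscale (cmap h)"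
proof -
  interpret L: Vector_Spaces.linear cscale cscale "cmap h" by (rule cmap_linear[OF assms])
  show ?thesis by unfold_locales (rule L.add L.scale)+
qed

lemma ctensor_0: "ctensor z 0 = 0"
  using ctensor_add_right[of z 0 0] by simp

section \<open>The lattice as a quotient of the ring of integer polynomials\<close>

locale cyclic_lattice =
  fixes n :: nat and h :: "'a::ab_group_add \<Rightarrow> 'a" and e :: 'a
  assumes n_pos: "n > 0" and additive_h: "additive h"
    and basis: "is_zbasis n (\<lambda>i. (h ^^ i) e)"
begin

sublocale Z: module_endo zscale h by (rule module_endo_zscale[OF additive_h])

sublocale C: module_endo cscale "cmap h" by (rule module_endo_cscale[OF additive_h])

lemma poly_representation: obtains f where "degree f < n" "Z.act f e = x"
proof -
  let ?b = "\<lambda>i. (h ^^ i) e"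
  have inj: "inj_on ?b {..<n}" using basis by (simp add: is_zbasis_def)
  have "x \<in> zmod.span (?b ` {..<n})" using basis by (simp add: is_zbasis_def)
  then obtain u where "x = (\<Sum>v\<in>?b ` {..<n}. zscale (u v) v)" by (auto simp: zmod.span_finite)
  then have x: "x = (\<Sum>i<n. zscale (u (?b i)) (?b i))" by (simp add: sum.reindex[OF inj])
  define f where "f = (\<Sum>i<n. monom (u (?b i)) i)"
  have "degree f \<le> n - 1" unfolding f_def
    by (rule degree_sum_le) (auto intro: order.trans[OF degree_monom_le])
  then have "degree f < n" using n_pos by simp
  moreover have "Z.act f e = x" by (simp add: f_def x Z.act_sum Z.act_monom)
  ultimately show ?thesis using that by blast
qed

lemma poly_unique:
  assumes "degree f < n" "Z.act f e = 0" shows "f = 0"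
proof (rule poly_eqI)
  let ?b = "\<lambda>i. (h ^^ i) e"
  have inj: "inj_on ?b {..<n}" and ind: "zmod.independent (?b ` {..<n})"
    using basis by (simp_all add: is_zbasis_def)
  define u where "u v = coeff f (the_inv_into {..<n} ?b v)" for v
  have u: "u (?b i) = coeff f i" if "i < n" for i
    using that by (simp add: u_def the_inv_into_f_f[OF inj])
  have "(\<Sum>v\<in>?b ` {..<n}. zscale (u v) v) = (\<Sum>i<n. zscale (u (?b i)) (?b i))"
    by (simp add: sum.reindex[OF inj])
  also have "\<dots> = Z.act f e" by (simp add: Z.act_altdef[OF assms(1)] u)
  finally have "(\<Sum>v\<in>?b ` {..<n}. zscale (u v) v) = 0" using assms(2) by simp
  then have "u v = 0" if "v \<in> ?b ` {..<n}" for v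
    using zmod.independentD[OF ind finite_imageI[OF finite_lessThan] subset_refl] that by blast
  then have "coeff f i = 0" if "i < n" for i using u that by (metis image_eqI lessThan_iff)
  then show "coeff f i = coeff 0 i" for i using assms(1) by (cases "i < n") (auto simp: coeff_eq_0)
qed

definition coords :: "'a \<Rightarrow> int poly" where
  "coords x = (SOME f. degree f < n \<and> Z.act f e = x)"

lemma degree_coords: "degree (coords x) < n" and act_coords: "Z.act (coords x) e = x"
proof -
  have "degree (coords x) < n \<and> Z.act (coords x) e = x"
    unfolding coords_def by (rule someI_ex) (metis poly_representation)
  then show "degree (coords x) < n" "Z.act (coords x) e = x" by blast+
qed

lemma coords_eqI: "degree f < n \<Longrightarrow> Z.act f e = x \<Longrightarrow> coords x = f"
  using poly_unique[of "coords x - f"] degree_coords[of x]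
  by (simp add: degree_diff_less Z.act_diff act_coords)

lemma coords_add: "coords (x + y) = coords x + coords y"
  by (rule coords_eqI) (simp_all add: degree_add_less degree_coords Z.act_add act_coords)

text \<open>The characteristic polynomial of \<open>h\<close>, which in the basis of the iterates of
  \<open>e\<close> is given by a companion matrix; it is also the minimal polynomial.\<close>

definition chi :: "int poly" where "chi = monom 1 n - coords ((h ^^ n) e)"

lemma degree_chi: "degree chi = n" and lead_coeff_chi: "lead_coeff chi = 1"
proof -
  have c: "coeff chi n = 1" using degree_coords by (simp add: chi_def coeff_eq_0)
  have "degree chi \<le> n" unfolding chi_def
    using degree_coords less_imp_le by (intro degree_diff_le) (auto simp: degree_monom_le)
  moreover have "n \<le> degree chi" using c by (intro le_degree) simp
  ultimately show "degree chi = n" by simp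
  then show "lead_coeff chi = 1" using c by simp
qed

lemma act_eq_on_generator:
  assumes "Z.act f e = Z.act g e" shows "Z.act f = Z.act g"
proof
  fix x
  have "Z.act f (Z.act (coords x) e) = Z.act g (Z.act (coords x) e)"
    using assms by (metis Z.act_commute)
  then show "Z.act f x = Z.act g x" by (simp add: act_coords)
qed

lemma act_chi: "Z.act chi x = 0"
proof -
  have "Z.act chi e = Z.act 0 e" by (simp add: chi_def Z.act_diff Z.act_monom act_coords)
  then have "Z.act chi = Z.act 0" by (rule act_eq_on_generator)
  then show ?thesis by simp
qed

lemma act_eq_0_iff: "Z.act f e = 0 \<longleftrightarrow> chi dvd f"
proof
  assume f: "Z.act f e = 0"
  obtain q r where qr: "f = chi * q + r" "r = 0 \<or> degree r < degree chi"
    using monic_division[OF lead_coeff_chi] by blast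
  have "Z.act r e = 0" using f by (simp add: qr(1) Z.act_add Z.act_mult act_chi)
  then have "r = 0" using qr(2) poly_unique by (auto simp: degree_chi)
  then show "chi dvd f" using qr(1) by simp
qed (auto simp: Z.act_mult act_chi)

lemma act_ctensor: "C.act (map_poly of_int f) (ctensor z x) = ctensor z (Z.act f x)"
proof (induction f)
  case 0 show ?case by (simp add: ctensor_0)
next
  case (pCons a f)
  have zs: "ctensor z (zscale k y) = cscale (of_int k) (ctensor z y)" for k and y :: 'a
  proof -
    have m: "ctensor z (- y) = - ctensor z y" for y :: 'a
      using ctensor_add_right[of z y "- y"] by (simp add: ctensor_0 eq_neg_iff_add_eq_0 add.commute)
    have s: "ctensor z (\<Sum>i<k. y) = cscale (of_nat k) (ctensor z y)" for k :: nat and y :: 'a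
      by (induction k) (simp_all add: ctensor_0 ctensor_add_right cx.scale_left_distrib add.commute
          del: cscale_ctensor sum_constant)
    show ?thesis
    proof (cases "0 \<le> k")
      case True
      then show ?thesis using s[of y "nat k"] by (simp add: zscale_def)
    next
      case False
      then have "ctensor z (zscale k y) = - cscale (of_nat (nat (- k))) (ctensor z y)"
        by (simp only: zscale_def m s if_False)
      also have "\<dots> = cscale (- of_nat (nat (- k))) (ctensor z y)"
        by (simp only: cx.scale_minus_left)
      also have "- of_nat (nat (- k)) = (of_int k :: complex)" using False by simp
      finally show ?thesis .
    qed
  qed
  have "C.act (map_poly of_int (pCons a f)) (ctensor z x) =
      cscale (of_int a) (ctensor z x) + cmap h (C.act (map_poly of_int f) (ctensor z x))"
    using pCons.hyps by (simp add: map_poly_pCons C.act_pCons del: cscale_ctensor)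
  also have "\<dots> = ctensor z (zscale a x + h (Z.act f x))"
    by (simp add: pCons.IH cmap_ctensor[OF additive_h] ctensor_add_right zs del: cscale_ctensor)
  finally show ?case by (simp add: Z.act_pCons)
qed

lemma additive_act: "additive (Z.act f)"
  by (simp add: additive_def Z.act_add_right)

lemma cmap_act: "cmap (Z.act f) v = C.act (map_poly of_int f) v"
proof (induction v rule: complexification_induct)
  case zero
  show ?case using cmap_diff[OF additive_act, of f 0 0] C.act_scale_right[of _ 0 0] by simp
next
  case (ctensor z a) show ?case by (simp add: cmap_ctensor[OF additive_act] act_ctensor)
next
  case (diff v w)
  have "C.act p (v - w) = C.act p v - C.act p w" for p
    using C.act_add_right[of p "v - w" w] by simp
  then show ?case using diff by (simp add: cmap_diff[OF additive_act])
qed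

text \<open>The coordinate functionals on the complexification are obtained by pairing with \<open>e\<close>
  under a suitable bilinear form.\<close>

lemma C_act_unique:
  assumes "degree q < n" "C.act q (ctensor 1 e) = 0" shows "q = 0"
proof (rule poly_eqI)
  fix i
  show "coeff q i = coeff 0 i"
  proof (cases "i < n")
    case True
    define B where "B x y = coeff (coords x) i * coeff (coords y) 0" for x y :: 'a
    have B: "biadditive B" unfolding biadditive_def B_def additive_def
      by (simp add: coords_add ring_distribs)
    have diff: "cform B (v - w) u = cform B v u - cform B w u" for v w u by (rule cform_diff_left[OF B])
    have zero: "cform B 0 u = 0" for u using diff[of 0 0 u] by simp
    have add: "cform B (v + w) u = cform B v u + cform B w u" for v w u
      using diff[of "v + w" w u] by simp
    have sum: "cform B (sum v A) u = (\<Sum>a\<in>A. cform B (v a) u)" for v u and A :: "nat set"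
      by (induction A rule: infinite_finite_induct) (simp_all add: zero add)
    have c1: "coords e = 1" by (rule coords_eqI) (use n_pos in simp_all)
    have ck: "coords ((h ^^ k) e) = monom 1 k" if "k < n" for k
      by (rule coords_eqI) (use that in \<open>simp_all add: degree_monom_eq Z.act_monom\<close>)
    have pow: "(cmap h ^^ k) (ctensor 1 e) = ctensor 1 ((h ^^ k) e)" for k
      by (induction k) (simp_all add: cmap_ctensor[OF additive_h])
    have "cform B (C.act q (ctensor 1 e)) (ctensor 1 e) =
        (\<Sum>k<n. coeff q k * of_int (coeff (monom 1 k) i))"
      unfolding C.act_altdef[OF assms(1)] sum
      by (intro sum.cong) (simp_all add: pow cform_ctensor[OF B] B_def c1 ck)
    also have "\<dots> = (\<Sum>k<n. if k = i then coeff q k else 0)" by (intro sum.cong) auto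
    also have "\<dots> = coeff q i" using True by simp
    finally show ?thesis using assms(2) zero by simp
  qed (use assms(1) in \<open>simp add: coeff_eq_0\<close>)
qed

text \<open>For a root of \<open>chi\<close>, the quotient of \<open>chi\<close> by the linear
  factor, applied to \<open>e\<close>, is an eigenvector; its degree is below \<open>n\<close>, so
  the vector is nonzero.\<close>

lemma is_eigenvalue_iff: "is_eigenvalue h \<mu> \<longleftrightarrow> ev \<mu> chi = 0"
proof
  assume "is_eigenvalue h \<mu>"
  then obtain v where v: "cmap h v = cscale \<mu> v" "v \<noteq> 0"
    by (auto simp: is_eigenvalue_def eigenspace_def)
  have "cscale (ev \<mu> chi) v = C.act (map_poly of_int chi) v"
    unfolding ev_def by (rule C.act_eigenvector[OF v(1), symmetric])
  also have "\<dots> = cmap (Z.act chi) v" by (rule cmap_act[symmetric])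
  also have "\<dots> = cmap (\<lambda>x. 0) v" by (simp add: act_chi[abs_def])
  also have "\<dots> = 0"
  proof (induction v rule: complexification_induct)
    case zero then show ?case using cmap_diff[of "\<lambda>x :: 'a. 0" 0 0] by (simp add: additive_def)
  next
    case (ctensor z a) then show ?case by (simp add: cmap_ctensor additive_def ctensor_0)
  next
    case (diff v w) then show ?case by (simp add: cmap_diff additive_def)
  qed
  finally show "ev \<mu> chi = 0" using v(2) by simp
next
  assume "ev \<mu> chi = 0"
  then have "[:- \<mu>, 1:] dvd map_poly of_int chi" by (simp add: ev_def poly_eq_0_iff_dvd)
  then obtain q where q: "map_poly of_int chi = [:- \<mu>, 1:] * q" by blast
  have nz: "(map_poly of_int chi :: complex poly) \<noteq> 0" using degree_chi n_pos by (metis degree_0 degree_map_poly of_int_0_eq_iff less_irrefl)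
  then have q0: "q \<noteq> 0" using q by auto
  have "degree (map_poly of_int chi :: complex poly) = n" by (simp add: degree_map_poly degree_chi)
  then have dq: "degree q < n"
    using degree_mult_eq[of "[:- \<mu>, 1:]" q] q0 by (simp add: q[symmetric] del: mult_pCons_left)
  let ?v = "C.act q (ctensor 1 e)"
  have "?v \<noteq> 0" using C_act_unique[OF dq] q0 by blast
  then have "C.act (map_poly of_int chi) (ctensor 1 e) = 0" by (simp add: act_ctensor act_chi ctensor_0)
  then have "C.act [:- \<mu>, 1:] ?v = 0" by (simp only: q C.act_mult)
  then have "cmap h ?v = cscale \<mu> ?v"
    by (simp add: C.act_pCons cx.scale_minus_left)
  then show "is_eigenvalue h \<mu>" using \<open>?v \<noteq> 0\<close> by (auto simp: is_eigenvalue_def eigenspace_def)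
qed

text \<open>For a double root with cofactor \<open>q\<close>, the vectors q(h) e and (h - mu) q(h) e
  lie in the generalized eigenspace. They are linearly independent, because a relation would be a
  nonzero polynomial of degree below \<open>n\<close> that annihilates \<open>e\<close>.\<close>

lemma simple_eigenvalue:
  assumes "eigenvalue_mult h \<mu> = 1" shows "\<not> [:- \<mu>, 1:]\<^sup>2 dvd map_poly of_int chi"
proof
  assume "[:- \<mu>, 1:]\<^sup>2 dvd (map_poly of_int chi :: complex poly)"
  then obtain q where q: "map_poly of_int chi = [:- \<mu>, 1:]\<^sup>2 * q" by blast
  let ?l = "[:- \<mu>, 1:]" and ?x = "ctensor 1 e"
  have dX: "degree (map_poly of_int chi :: complex poly) = n" by (simp add: degree_map_poly degree_chi)
  then have q0: "q \<noteq> 0" using q n_pos by auto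
  have dq: "degree q + 2 = n"
    using dX degree_mult_eq[of "?l\<^sup>2" q] q0 by (simp add: q degree_power_eq del: mult_pCons_left)
  then have zero: "C.act (?l\<^sup>2 * q) ?x = 0" by (simp add: q[symmetric] act_ctensor act_chi ctensor_0)
  let ?D = "\<lambda>u. cmap h u - cscale \<mu> u"
  have D: "?D u = C.act ?l u" for u by (simp add: C.act_pCons cx.scale_minus_left)
  let ?G = "{v. \<exists>k. (?D ^^ k) v = 0}"
  define u where "u = C.act q ?x"
  define v where "v = C.act ?l u"
  have "?D v = 0" using zero by (simp only: D v_def u_def C.act_mult power2_eq_square mult.assoc)
  then have "(?D ^^ 1) v = 0" "(?D ^^ 2) u = 0"
    using D[of u] by (simp_all add: v_def numeral_2_eq_2)
  then have G: "v \<in> ?G" "u \<in> ?G" by blast+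
  obtain S where "S \<subseteq> ?G" "cx.independent S" and S: "?G \<subseteq> cx.span S" "card S = cx.dim ?G"
    by (rule cx.basis_exists)
  then have "card S = 1" using assms by (simp add: eigenvalue_mult_def)
  then obtain b where b: "S = {b}" by (rule card_1_singletonE)
  obtain c where c: "u = cscale c b" using S(1) G(2) by (auto simp: b cx.span_singleton)
  obtain d where d: "v = cscale d b" using S(1) G(1) by (auto simp: b cx.span_singleton)
  have "C.act (smult d q - smult c (?l * q)) ?x = cscale d u - cscale c v"
    by (simp only: C.act_diff C.act_smult C.act_mult u_def v_def)
  also have "\<dots> = 0" by (simp add: c d mult.commute)
  finally have "smult d q - smult c (?l * q) = 0"
    by (intro C_act_unique) (use dq in \<open>auto intro!: degree_diff_less le_less_trans[OF degree_smult_le] le_less_trans[OF degree_mult_le]\<close>)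
  moreover have "q * [:d:] = smult d q" by simp
  ultimately have "q * ([:d:] - smult c ?l) = 0"
    by (simp only: right_diff_distrib mult_smult_right mult.commute[of ?l q])
  then have "[:d:] - smult c ?l = 0" using q0 by (metis mult_eq_0_iff)
  then have "d = 0" by auto
  then have "v = 0" using d by simp
  then have "C.act (?l * q) ?x = 0" by (simp only: v_def u_def C.act_mult)
  moreover have "degree (?l * q) < n" using degree_mult_eq[of ?l q] q0 dq by simp
  ultimately have "?l * q = 0" by (intro C_act_unique)
  then show False using q0 by (metis mult_eq_0_iff pCons_eq_0_iff zero_neq_one)
qed

end

lemma exp_eq_zeta: "exp (2 * of_real pi * \<i> / of_nat m) = zeta m"
  by (simp add: zeta_def cis_conv_exp mult_ac)

lemma map_poly_of_int_mult:
  "(map_poly of_int (f * g) :: complex poly) = map_poly of_int f * map_poly of_int g"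
proof -
  have "poly (map_poly of_int (f * g) :: complex poly) = poly (map_poly of_int f * map_poly of_int g)"
    using ev_mult unfolding ev_def by (auto simp: fun_eq_iff)
  then show ?thesis by (simp only: poly_eq_poly_eq_iff)
qed

lemma ev_of_int [simp]: "ev (of_int a) f = of_int (poly f a)"
  by (induction f) (simp_all add: ev_pCons)

lemma ev_cnj: "ev (cnj w) f = cnj (ev w f)"
  by (induction f) (simp_all add: ev_pCons)

lemma unit_on_monomial: "s \<in> {1, - 1} \<Longrightarrow> unit_on M (monom s k)"
  by (auto simp: unit_on_def)

section \<open>Automorphisms of the triple as units at the eigenvalues\<close>

locale cyclic_lattice_form = cyclic_lattice n h e + pos_set M
  for n and h :: "'a::ab_group_add \<Rightarrow> 'a" and e and M +
  fixes S :: "'a \<Rightarrow> 'a \<Rightarrow> int"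
  assumes eigenvalues: "is_eigenvalue h \<mu> \<Longrightarrow> (\<exists>k\<ge>1. \<mu> ^ k = 1) \<and> eigenvalue_mult h \<mu> = 1"
    and biadditive_S: "biadditive S" and S_h: "S (h x) (h y) = S x y"
    and nondegenerate: "nondegenerate_on (cx.span (\<Union>\<mu>\<in>- {1, -1}. eigenspace h \<mu>)) S"
    and M_def: "M = eigenvalue_orders h"
begin

lemma in_M_iff: "m \<in> M \<longleftrightarrow> m > 0 \<and> ev (zeta m) chi = 0"
  by (auto simp: M_def eigenvalue_orders_def exp_eq_zeta is_eigenvalue_iff)

lemma root_of_chi:
  assumes "ev w chi = 0"
  obtains d a where "d \<in> M" "w = zeta d ^ a" "coprime a d" "a > 0"
proof -
  obtain k where k: "k \<ge> 1" "w ^ k = 1" using eigenvalues assms is_eigenvalue_iff by blast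
  then have "k > 0" by simp
  obtain d a b where d: "d > 0" "w = zeta d ^ a" "coprime a d" "a > 0" "zeta d = w ^ b" "coprime b d" "b > 0"
    using zeta_primitive_order[OF \<open>k > 0\<close> k(2)] by metis
  have "w ^ d = 1" using d(1,2) by (metis mult.commute power_mult power_one zeta_power_self)
  then have "ev (zeta d) chi = 0" unfolding d(5) by (rule ev_conjugate[OF d(1) _ assms d(6,7)])
  then show ?thesis using that d in_M_iff by blast
qed

lemma ev_zeta_power_Phi:
  assumes "m > 0" "coprime a m" "a > 0" shows "ev (zeta m ^ a) (Phi m) = 0"
  using assms by (intro ev_conjugate[of m]) simp_all

text \<open>Every root of \<open>chi\<close> is conjugate to some \<open>zeta d\<close> with
  \<open>d\<close> in \<open>M\<close> and is thus a root of \<open>Phis M\<close>; a root of the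
  cofactor would be double, against multiplicity 1.\<close>

lemma chi_eq_Phis: "chi = Phis M"
proof -
  have "Phis M dvd chi" by (rule Phis_dvdI[OF finite_M]) (simp add: in_M_iff Phi_dvd_iff)
  then obtain g where g: "chi = Phis M * g" by blast
  have lg: "lead_coeff g = 1"
    using lead_coeff_chi lead_coeff_Phis[OF finite_M pos_M] by (simp add: g lead_coeff_mult)
  have "degree g = 0"
  proof (rule ccontr)
    assume "degree g \<noteq> 0"
    then have "degree (map_poly of_int g :: complex poly) \<noteq> 0" by (simp add: degree_map_poly)
    then obtain w where w: "ev w g = 0" unfolding ev_def
      by (metis constant_degree fundamental_theorem_of_algebra)
    then have chiw: "ev w chi = 0" by (simp add: g)
    obtain d a where d: "d \<in> M" "w = zeta d ^ a" "coprime a d" "a > 0" using root_of_chi[OF chiw] .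
    have "ev w (Phi d) = 0" unfolding d(2) by (rule ev_zeta_power_Phi[OF pos_M[OF d(1)] d(3,4)])
    then have "ev w (Phis M) = 0" using ev_Phis_eq_0_iff[OF finite_M] d(1) by blast
    then have "[:- w, 1:] dvd (map_poly of_int (Phis M) :: complex poly)" "[:- w, 1:] dvd (map_poly of_int g :: complex poly)"
      using w by (simp_all add: ev_def poly_eq_0_iff_dvd)
    then have "[:- w, 1:]\<^sup>2 dvd (map_poly of_int chi :: complex poly)"
      unfolding g map_poly_of_int_mult power2_eq_square by (rule mult_dvd_mono)
    moreover have "eigenvalue_mult h w = 1" using eigenvalues chiw is_eigenvalue_iff by blast
    ultimately show False using simple_eigenvalue by blast
  qed
  then obtain c where c: "g = [:c:]" by (rule degree_eq_zeroE)
  then have "g = 1" using lg by (simp add: one_pCons)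
  then show ?thesis using g by simp
qed

lemma M_nonempty: "M \<noteq> {}"
proof
  assume "M = {}"
  then have "chi = 1" by (simp add: chi_eq_Phis)
  then show False using degree_chi n_pos by simp
qed

lemma act_eq_iff: "Z.act f = Z.act g \<longleftrightarrow> (\<forall>m\<in>M. ev (zeta m) f = ev (zeta m) g)"
proof -
  have "Z.act f = Z.act g \<longleftrightarrow> Z.act (f - g) e = 0"
    using act_eq_on_generator[of f g] by (auto simp: Z.act_diff)
  also have "\<dots> \<longleftrightarrow> Phis M dvd f - g" by (simp add: act_eq_0_iff chi_eq_Phis)
  also have "\<dots> \<longleftrightarrow> (\<forall>m\<in>M. Phi m dvd f - g)"
    using Phis_dvdI[OF finite_M, of "f - g"] Phi_dvd_Phis[OF finite_M] pos_M dvd_trans by blast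
  also have "\<dots> \<longleftrightarrow> (\<forall>m\<in>M. ev (zeta m) f = ev (zeta m) g)"
    using pos_M by (simp add: Phi_dvd_iff)
  finally show ?thesis .
qed

lemma act_id_iff: "(\<forall>x. Z.act f x = x) \<longleftrightarrow> (\<forall>m\<in>M. ev (zeta m) f = 1)"
proof -
  have "(\<forall>x. Z.act f x = x) \<longleftrightarrow> Z.act f = Z.act 1" by (auto simp: fun_eq_iff)
  then show ?thesis by (simp add: act_eq_iff)
qed

lemma commuting_eq_act:
  assumes "additive g" "g \<circ> h = h \<circ> g" shows "g = Z.act (coords (g e))"
proof
  fix x
  have gh: "g (h y) = h (g y)" for y using fun_cong[OF assms(2), of y] by simp
  have "g (Z.act f e) = Z.act f (g e)" for f
    by (induction f)
       (simp_all add: Z.act_pCons additive.zero[OF assms(1)] additive.add[OF assms(1)]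
          additive_zscale[OF assms(1)] gh)
  then have "g (Z.act (coords x) e) = Z.act (coords x) (g e)" .
  also have "\<dots> = Z.act (coords x) (Z.act (coords (g e)) e)" by (simp only: act_coords)
  also have "\<dots> = Z.act (coords (g e)) x" by (subst Z.act_commute) (simp add: act_coords)
  finally show "g x = Z.act (coords (g e)) x" by (simp add: act_coords)
qed

lemma h_pow_act: "(h ^^ k) x = Z.act (monom 1 k) x" by (simp add: Z.act_monom)

lemma h_total: "(h ^^ (total * k)) x = x"
  using act_id_iff[of "monom 1 (total * k)"] zeta_total by (simp add: h_pow_act)

lemma S_add: "S (x + y) z = S x z + S y z" "S z (x + y) = S z x + S z y"
  using biadditive_S by (auto simp: biadditive_def additive_def)

lemma S_zscale: "S (zscale c x) y = c * S x y" "S x (zscale c y) = c * S x y"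
proof -
  have a: "additive (\<lambda>x. S x y)" "additive (S x)" for x y using biadditive_S by (auto simp: biadditive_def)
  have "g (zscale c z) = c * g z" if "additive g" for g :: "'a \<Rightarrow> int" and c z
    by (simp add: zscale_def additive.sum[OF that] additive.minus[OF that])
  then show "S (zscale c x) y = c * S x y" "S x (zscale c y) = c * S x y" using a by blast+
qed

text \<open>Represents f(1/t), the adjoint of f(h) with respect to \<open>S\<close>. As h^total is
  the identity, 2 total - 1 stands for -1; the factor 2 keeps it positive even when
  \<open>total\<close> is 1.\<close>

definition dual :: "int poly \<Rightarrow> int poly" where "dual f = pcompose f (monom 1 (2 * total - 1))"

lemma dual_pCons: "Z.act (dual (pCons c f)) x = zscale c x + Z.act (dual f) ((h ^^ (2 * total - 1)) x)"
  by (simp add: dual_def pcompose_pCons Z.act_add h_pow_act Z.act_mult[symmetric] mult.commute)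

lemma S_act: "S (Z.act f x) y = S x (Z.act (dual f) y)"
proof (induction f arbitrary: y)
  case 0
  have "S 0 y = 0" "S x 0 = 0" using S_add(1)[of 0 0] S_add(2)[of x 0 0] by simp_all
  then show ?case by (simp add: dual_def)
next
  case (pCons c f)
  have "h ((h ^^ (2 * total - 1)) y) = y"
  proof -
    have "Suc (2 * total - 1) = total * 2" using total_pos by simp
    then have "h ((h ^^ (2 * total - 1)) y) = (h ^^ (total * 2)) y" by (metis comp_apply funpow.simps(2))
    then show ?thesis using h_total by simp
  qed
  then have "S (h (Z.act f x)) y = S (Z.act f x) ((h ^^ (2 * total - 1)) y)" by (metis S_h)
  then show ?case by (simp add: Z.act_pCons dual_pCons S_add S_zscale pCons.IH)
qed

lemma ev_dual:
  assumes f: "unit_on M f" and m: "m \<in> M" shows "ev (zeta m) (f * dual f) = 1"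
proof -
  obtain s k where s: "s \<in> {1, - 1}" and k: "ev (zeta m) f = of_int s * zeta m ^ k"
    using f m unfolding unit_on_def by blast
  let ?N = "2 * total - 1"
  have m0: "m > 0" using pos_M m by blast
  have "coprime ?N (2 * total)" by (rule coprime_diff_one_left_nat) (use total_pos in simp)
  then have 1: "coprime ?N m" using dvd_total[OF m] by (meson coprime_divisors dvd_refl dvd_mult)
  have 2: "ev (zeta m) (f - monom s k) = 0" using k by simp
  have 3: "?N > 0" using total_pos by simp
  have "ev (zeta m ^ ?N) (f - monom s k) = 0"
    by (rule ev_conjugate[OF m0 zeta_power_self[OF m0] 2 1 3])
  then have "ev (zeta m) (dual f) = of_int s * zeta m ^ (?N * k)"
    by (simp add: dual_def power_mult)
  then have "ev (zeta m) (f * dual f) = (of_int s * of_int s) * (zeta m ^ k * zeta m ^ (?N * k))"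
    by (simp add: k)
  also have "zeta m ^ k * zeta m ^ (?N * k) = 1"
  proof -
    have "k + ?N * k = total * (2 * k)" using total_pos by (cases total) simp_all
    then show ?thesis using zeta_total[OF m, of "2 * k"] by (simp flip: power_add)
  qed
  finally show ?thesis using s by auto
qed

text \<open>For a unit the adjoint is the inverse, which gives bijectivity and isometry
  together.\<close>

lemma act_in_lattice_aut:
  assumes f: "unit_on M f" shows "Z.act f \<in> lattice_aut h S"
proof -
  have inv: "Z.act f (Z.act (dual f) x) = x" for x
    using act_id_iff[of "f * dual f"] ev_dual[OF f] by (simp add: Z.act_mult)
  then have inv': "Z.act (dual f) (Z.act f x) = x" for x by (subst Z.act_commute)
  have "bij (Z.act f)" by (rule o_bij[of "Z.act (dual f)"]) (auto simp: inv inv')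
  moreover have "Z.act f \<circ> h = h \<circ> Z.act f" by (auto simp: Z.act_T)
  moreover have "S (Z.act f x) (Z.act f y) = S x y" for x y by (simp add: S_act inv')
  ultimately show ?thesis by (simp add: lattice_aut_def additive_act)
qed

lemma cform_invariant:
  assumes g: "additive g" "\<And>x y. S (g x) (g y) = S x y"
  shows "cform S (cmap g v) (cmap g w) = cform S v w"
proof -
  note diff = cform_diff_left[OF biadditive_S] cform_diff_right[OF biadditive_S] cmap_diff[OF g(1)]
  have zero: "cmap g 0 = 0" using diff(3)[of 0 0] by simp
  have zero': "cform S 0 u = 0" "cform S u 0 = 0" for u using diff(1)[of 0 0 u] diff(2)[of u 0 0] by simp_all
  show ?thesis
  proof (induction v rule: complexification_induct)
    case (ctensor z a)
    show ?case
      by (induction w rule: complexification_induct)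
         (simp_all add: zero zero' cmap_ctensor[OF g(1)] cform_ctensor[OF biadditive_S] g(2) diff)
  qed (simp_all add: zero zero' diff)
qed

text \<open>For an eigenvalue mu other than 1 and -1, invariance under \<open>h\<close> lets the
  eigenspace of mu pair nontrivially only with that of its complex conjugate. Invariance under f(h)
  then makes the product of f(mu) and its conjugate equal to 1, and Kronecker's theorem
  applies.\<close>

lemma lattice_aut_unit:
  assumes "Z.act f \<in> lattice_aut h S" shows "unit_on M f"
proof -
  let ?g = "Z.act f"
  have g: "additive ?g" "bij ?g" "?g \<circ> h = h \<circ> ?g" "\<And>x y. S (?g x) (?g y) = S x y"
    using assms by (auto simp: lattice_aut_def)
  have eig: "cmap ?g v = cscale (ev \<mu> f) v" if "v \<in> eigenspace h \<mu>" for v \<mu>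
    unfolding cmap_act ev_def using that by (intro C.act_eigenvector) (simp add: eigenspace_def)
  note scale = cform_cscale[OF biadditive_S]
  have norm: "cmod (ev \<mu> f) = 1" if chi: "ev \<mu> chi = 0" for \<mu>
  proof (cases "\<mu> \<in> {1, - 1}")
    case True
    \<comment> \<open>At 1 and -1 the form gives no information. The inverse automorphism is a
      polynomial in \<open>h\<close> too, so f(a) is an integer that divides 1.\<close>
    then obtain a :: int where a: "\<mu> = of_int a" by (auto intro: that[of 1] that[of "- 1"])
    define g' where "g' = inv ?g"
    have g'g: "g' (?g x) = x" "?g (g' x) = x" for x
      using g(2) by (simp_all add: g'_def bij_is_inj bij_is_surj surj_f_inv_f)
    have "additive g'"
    proof (rule additive.intro)
      fix x y show "g' (x + y) = g' x + g' y" by (metis g'g Z.act_add_right)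
    qed
    moreover have "g' \<circ> h = h \<circ> g'"
    proof
      fix x show "(g' \<circ> h) x = (h \<circ> g') x" using g'g Z.act_T[of f "g' x"] by (metis comp_apply)
    qed
    ultimately have g': "g' = Z.act (coords (g' e))" by (rule commuting_eq_act)
    have "Z.act (f * coords (g' e) - 1) e = 0"
      using g'g(2)[of e] g' by (simp add: Z.act_diff Z.act_mult)
    then obtain k where "f * coords (g' e) - 1 = chi * k" using act_eq_0_iff by blast
    then have "ev \<mu> (f * coords (g' e) - 1) = 0" using chi by simp
    then have "of_int (poly f a * poly (coords (g' e)) a) = (1 :: complex)" by (simp add: a)
    then have "poly f a * poly (coords (g' e)) a = 1" by (simp only: of_int_eq_1_iff)
    then have "poly f a dvd 1" by (metis dvd_triv_left)
    then have "\<bar>poly f a\<bar> = 1" by simp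
    then show ?thesis by (auto simp: a abs_if split: if_splits)
  next
    case False
    obtain v where v: "v \<in> eigenspace h \<mu>" "v \<noteq> 0"
      using chi is_eigenvalue_iff is_eigenvalue_def by blast
    let ?U = "\<Union>\<mu>\<in>- {1, -1}. eigenspace h \<mu>"
    have "v \<in> cx.span ?U" using v(1) False by (intro cx.span_base) blast
    then obtain w where w: "w \<in> cx.span ?U" "cform S v w \<noteq> 0"
      using nondegenerate v(2) unfolding nondegenerate_on_def by blast
    have "\<exists>u\<in>?U. cform S v u \<noteq> 0"
    proof (rule ccontr)
      assume none: "\<not> (\<exists>u\<in>?U. cform S v u \<noteq> 0)"
      have z: "cform S v 0 = 0" using cform_diff_right[OF biadditive_S, of v 0 0] by simp
      have add: "cform S v (x + y) = cform S v x + cform S v y" for x y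
        using cform_diff_right[OF biadditive_S, of v "x + y" y] by simp
      have "cx.subspace (Collect (\<lambda>u. cform S v u = 0))"
        by (rule cx.subspaceI) (simp_all add: z add scale)
      then have "cform S v w = 0" using cx.span_induct[OF w(1)] none by blast
      then show False using w(2) by blast
    qed
    then obtain \<nu> u where u: "u \<in> eigenspace h \<nu>" "cform S v u \<noteq> 0" by blast
    have "cform S (cmap h v) (cmap h u) = cform S v u" by (rule cform_invariant[OF additive_h S_h])
    then have "\<mu> * \<nu> = 1" using v(1) u by (simp add: eigenspace_def scale mult.commute)
    moreover have "\<mu> * cnj \<mu> = 1"
    proof -
      obtain k where "k \<ge> 1" "\<mu> ^ k = 1" using eigenvalues chi is_eigenvalue_iff by blast
      then have "cmod \<mu> ^ k = 1" "k > 0" by (simp_all flip: norm_power)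
      then have "cmod \<mu> = 1" using power_eq_imp_eq_base[of "cmod \<mu>" k 1] by simp
      then show ?thesis by (simp add: complex_norm_square[symmetric])
    qed
    ultimately have "\<nu> = cnj \<mu>" by (metis mult_cancel_left mult_zero_left zero_neq_one)
    have "cform S (cmap ?g v) (cmap ?g u) = cform S v u" by (rule cform_invariant[OF g(1,4)])
    then have "ev \<mu> f * ev \<nu> f = 1" using eig[OF v(1)] eig[OF u(1)] u(2) by (simp add: scale mult.commute)
    then have "ev \<mu> f * cnj (ev \<mu> f) = 1" by (simp add: \<open>\<nu> = cnj \<mu>\<close> ev_cnj)
    then have "of_real ((cmod (ev \<mu> f))\<^sup>2) = (1 :: complex)" by (simp only: complex_norm_square)
    then have "(cmod (ev \<mu> f))\<^sup>2 = 1" by (simp only: of_real_eq_1_iff)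
    then show ?thesis using power_eq_imp_eq_base[of "cmod (ev \<mu> f)" 2 1] by simp
  qed
  show ?thesis unfolding unit_on_def
  proof
    fix m assume m: "m \<in> M"
    then have m0: "m > 0" by (rule pos_M)
    have "cmod (ev w f) = 1" if "ev w (Phi m) = 0" for w
    proof (rule norm)
      show "ev w chi = 0" unfolding chi_eq_Phis using ev_Phis_eq_0_iff[OF finite_M] m that by blast
    qed
    then obtain N where "N > 0" "ev (zeta m) f ^ N = 1" using kronecker[OF m0] by blast
    then show "\<exists>s\<in>{1, - 1}. \<exists>k. ev (zeta m) f = of_int s * zeta m ^ k"
      using root_of_unity_at_zeta[OF m0] by blast
  qed
qed

lemma int_iterate_eq:
  "(\<exists>k. g = int_iterate h k \<or> g = (\<lambda>x. - int_iterate h k x)) \<longleftrightarrow>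
    (\<exists>s\<in>{1, - 1}. \<exists>k. g = Z.act (monom s k))"
proof -
  have pos: "int_iterate h (int k) = Z.act (monom 1 k)" for k
    by (simp add: int_iterate_def fun_eq_iff h_pow_act)
  have neg: "Z.act (monom (- 1) k) x = - Z.act (monom 1 k) x" for k x
    using Z.act_minus[of "monom 1 k" x] by (simp add: minus_monom)
  have inv: "inv h = h ^^ (total - 1)"
  proof (rule inv_equality)
    have T: "(h ^^ Suc (total - 1)) x = x" for x using h_total[of 1 x] total_pos by simp
    show "(h ^^ (total - 1)) (h x) = x" for x using T[of x] by (simp add: funpow_swap1 del: funpow.simps(1))
    show "h ((h ^^ (total - 1)) x) = x" for x using T[of x] by simp
  qed
  have all: "\<exists>l. int_iterate h k = Z.act (monom 1 l)" for k
  proof (cases "k \<ge> 0")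
    case True then show ?thesis using pos[of "nat k"] by auto
  next
    case False
    then have "int_iterate h k = h ^^ ((total - 1) * nat (- k))"
      by (simp add: int_iterate_def inv funpow_mult mult.commute)
    then show ?thesis using pos by (metis int_iterate_def nat_int of_nat_0_le_iff)
  qed
  show ?thesis
  proof
    assume "\<exists>k. g = int_iterate h k \<or> g = (\<lambda>x. - int_iterate h k x)"
    then obtain k where k: "g = int_iterate h k \<or> g = (\<lambda>x. - int_iterate h k x)" by blast
    obtain l where l: "int_iterate h k = Z.act (monom 1 l)" using all by blast
    have "g = Z.act (monom 1 l) \<or> g = Z.act (monom (- 1) l)" using k by (auto simp: l neg fun_eq_iff)
    then show "\<exists>s\<in>{1, - 1}. \<exists>k. g = Z.act (monom s k)" by blast
  next
    assume "\<exists>s\<in>{1, - 1}. \<exists>k. g = Z.act (monom s k)"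
    then obtain k where "g = Z.act (monom 1 k) \<or> g = Z.act (monom (- 1) k)" by blast
    then have "g = int_iterate h (int k) \<or> g = (\<lambda>x. - int_iterate h (int k) x)"
      by (auto simp: pos neg fun_eq_iff)
    then show "\<exists>k. g = int_iterate h k \<or> g = (\<lambda>x. - int_iterate h k x)" by blast
  qed
qed

lemma lattice_aut_iff_trivial_units:
  "lattice_aut h S = {g. \<exists>k::int. g = int_iterate h k \<or> g = (\<lambda>x. - int_iterate h k x)} \<longleftrightarrow>
    trivial_units M"
  unfolding int_iterate_eq
proof
  assume eq: "lattice_aut h S = {g. \<exists>s\<in>{1, - 1}. \<exists>k. g = Z.act (monom s k)}"
  show "trivial_units M" unfolding trivial_units_def
  proof (intro allI impI)
    fix f assume "unit_on M f"
    then have "Z.act f \<in> lattice_aut h S" by (rule act_in_lattice_aut)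
    then obtain s k where s: "s \<in> {1, - 1}" "Z.act f = Z.act (monom s k)" unfolding eq by blast
    then have "\<forall>m\<in>M. ev (zeta m) f = of_int s * zeta m ^ k" using act_eq_iff[of f "monom s k"] by simp
    then show "monomial_on M f" using s(1) unfolding monomial_on_def by blast
  qed
next
  assume triv: "trivial_units M"
  show "lattice_aut h S = {g. \<exists>s\<in>{1, - 1}. \<exists>k. g = Z.act (monom s k)}"
  proof (intro equalityI subsetI CollectI)
    fix g assume g: "g \<in> lattice_aut h S"
    then have act: "g = Z.act (coords (g e))" by (intro commuting_eq_act) (auto simp: lattice_aut_def)
    then have "unit_on M (coords (g e))" using g lattice_aut_unit[of "coords (g e)"] by simp
    then have "monomial_on M (coords (g e))" using triv unfolding trivial_units_def by blast
    then obtain s k where s: "s \<in> {1, - 1}"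
      and k: "\<And>m. m \<in> M \<Longrightarrow> ev (zeta m) (coords (g e)) = of_int s * zeta m ^ k"
      unfolding monomial_on_def by blast
    have "Z.act (coords (g e)) = Z.act (monom s k)" using k by (simp add: act_eq_iff)
    then show "\<exists>s\<in>{1, - 1}. \<exists>k. g = Z.act (monom s k)" using s act by metis
  next
    fix g assume "g \<in> {g. \<exists>s\<in>{1, - 1}. \<exists>k. g = Z.act (monom s k)}"
    then show "g \<in> lattice_aut h S" using act_in_lattice_aut unit_on_monomial by blast
  qed
qed

end

theorem theorem1p2:
  fixes M :: "nat set" and n :: nat
    and h :: "'a::ab_group_add \<Rightarrow> 'a" and S :: "'a \<Rightarrow> 'a \<Rightarrow> int"
  assumes "finite M" and "\<forall>m\<in>M. 1 \<le> m"
    and "1 \<le> n" and "cyclic_lattice_triple n h S"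
    and "M = eigenvalue_orders h"
  shows "lattice_aut h S =
           {g. \<exists>k::int. g = int_iterate h k \<or> g = (\<lambda>x. - int_iterate h k x)}
         \<longleftrightarrow> condition_I M \<or> condition_II M"
proof -
  obtain e where e: "is_zbasis n (\<lambda>i. (h ^^ i) e)"
    using assms(4) unfolding cyclic_lattice_triple_def by blast
  interpret cyclic_lattice_form n h e M S
    by (intro cyclic_lattice_form.intro cyclic_lattice.intro pos_set.intro cyclic_lattice_form_axioms.intro)
       (use assms e in \<open>auto simp: cyclic_lattice_triple_def Suc_le_eq\<close>)
  show ?thesis using lattice_aut_iff_trivial_units trivial_units_iff[OF M_nonempty] by simp
qed

end
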